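(* Let $\bar X\in\mathcal K$ and $\bar V\in\mathcal H_{\bar X}$. Then the Lagrangian solution $X_t$ with data $(\bar X,\bar V)$ is globally sticky, i.e. $\Omega_{X_s}\subset\Omega_{X_t}$ for all $0\le s\le t$. In particular, with $V_t=\frac{d^+}{dt}X_t$, $\rho_t=X_{t\#}\mathfrak m$, $\bar\Psi=\Psi[\bar X,\bar V]$ and $\Psi_t=V_t+\Phi*\rho_t(X_t)$: - for all $t\ge0$: $V_t\in\mathcal H_{X_t}$ and $\Psi_t\in\mathcal H_{X_t}$; - for $0\le s\le t$: $\Psi_s-\Psi_t\in\partial I_{\mathcal K}(X_t)$, hence $\Psi_t=\mathrm P_{\mathcal H_{X_t}}\Psi_s$, and $X_t=\mathrm P_{\mathcal K}\left(X_s+(t-s)\Psi_s-\int_s^t\Phi*\rho_r(X_r)\,dr\right)$; - for all $t\ge0$: $V_t=\mathrm P_{\mathcal H_{X_t}}U[X_t]=\mathrm P_{\mathcal H_{X_t}}\bar\Psi-\Phi*\rho_t(X_t)$, $\Psi_t=\mathrm P_{\mathcal H_{X_t}}\bar\Psi$, and $X_t=\mathrm P_{\mathcal K}\left(\bar X+\int_0^tU[X_s]\,ds\right)=\mathrm P_{\mathcal K}\left(\bar X+t\bar\Psi-\int_0^t\Phi*\rho_s(X_s)\,ds\right)$. Furthermore, for all $t\ge0$ there is a unique $v_t\in L^2(\mathbb R,\rho_t)$ such that $V_t=v_t\circ X_t$.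
   Context: The communication protocol $\phi$ on $\mathbb R$ is nonnegative, symmetric, radially nonincreasing and locally integrable; $\Phi(x)=\int_0^x\phi(y)dy$. $\Omega=(0,1)$, $\mathfrak m$ is Lebesgue measure on $\Omega$. $\mathcal K\subset L^2(\Omega)$ is the closed convex cone of nondecreasing right-continuous functions; for $X\in\mathcal K$, $\partial I_{\mathcal K}(X)=\{W\in L^2(\Omega):\langle W,Y-X\rangle\le0\ \forall Y\in\mathcal K\}$ (subdifferential of the indicator function of $\mathcal K$). $\Omega_X=\{m\in\Omega: X\text{ is constant in a neighborhood of }m\}$, and $\mathcal H_X=\{U\in L^2(\Omega): U\text{ is constant on each interval contained in }\Omega_X\}$. $\mathrm P_{\mathcal C}$ is the metric projection in $L^2(\Omega)$ onto a closed convex set $\mathcal C$. If $X\in\mathcal K$ and $\rho=X_\#\mathfrak m$, then $\Phi*\rho(X)=\int_\Omega\Phi(X-X(\omega))d\omega$, and $\Psi[X,V]=V+\Phi*\rho(X)$. Given data $\bar X\in\mathcal K$, $\bar V\in L^2(\Omega)$, put $\bar\Psi=\Psi[\bar X,\bar V]$ and $U[X]=\bar\Psi-\int_\Omega\Phi(X-X(\omega))d\omega$. Lagrangian solution with data $(\bar X,\bar V)$: the unique absolutely continuous curve $X_t:[0,\infty)\to\mathcal K$ with $X_0=\bar X$ and $-\dot X_t\in-U[X_t]+\partial I_{\mathcal K}(X_t)$ for a.e. $t>0$; its right-derivative $V_t=\frac{d^+}{dt}X_t$ exists for all $t\ge0$. *)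

theory Defs
  imports "HOL-Analysis.Analysis"
begin

definition Omega :: "real set" (\<open>\<Omega>\<close>) where
  "\<Omega> = {0<..<1}"

abbreviation mass :: "real measure" (\<open>\<mm>\<close>) where
  "\<mm> \<equiv> lebesgue_on \<Omega>"

definition square_integrable :: "'a measure \<Rightarrow> ('a \<Rightarrow> real) \<Rightarrow> bool" where
  "square_integrable M f \<longleftrightarrow> f \<in> borel_measurable M \<and> integrable M (\<lambda>x. (f x)\<^sup>2)"

lemma square_integrableD:
  assumes "square_integrable M f"
  shows "f \<in> borel_measurable M" "integrable M (\<lambda>x. (f x)\<^sup>2)"
  using assms by (auto simp: square_integrable_def)

lemma square_integrable_mult:
  assumes f: "square_integrable M f" and g: "square_integrable M g"
  shows "integrable M (\<lambda>x. f x * g x)"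
proof (rule Bochner_Integration.integrable_bound)
  show "integrable M (\<lambda>x. (f x)\<^sup>2 + (g x)\<^sup>2)"
    using f g by (auto simp: square_integrable_def)
  show "(\<lambda>x. f x * g x) \<in> borel_measurable M"
    using f g by (auto simp: square_integrable_def)
  show "AE x in M. norm (f x * g x) \<le> norm ((f x)\<^sup>2 + (g x)\<^sup>2)"
  proof (rule AE_I2)
    fix x
    have "0 \<le> (\<bar>f x\<bar> - \<bar>g x\<bar>)\<^sup>2" by simp
    then have "2 * (\<bar>f x\<bar> * \<bar>g x\<bar>) \<le> (f x)\<^sup>2 + (g x)\<^sup>2"
      by (simp add: power2_diff)
    moreover have "0 \<le> \<bar>f x\<bar> * \<bar>g x\<bar>" by simp
    ultimately have "\<bar>f x\<bar> * \<bar>g x\<bar> \<le> (f x)\<^sup>2 + (g x)\<^sup>2" by linarith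
    then show "norm (f x * g x) \<le> norm ((f x)\<^sup>2 + (g x)\<^sup>2)"
      by (simp add: abs_mult)
  qed
qed

lemma square_integrable_add:
  assumes f: "square_integrable M f" and g: "square_integrable M g"
  shows "square_integrable M (\<lambda>x. f x + g x)"
proof -
  have "integrable M (\<lambda>x. (f x)\<^sup>2 + (g x)\<^sup>2 + 2 * (f x * g x))"
    using square_integrable_mult[OF f g] f g by (auto simp: square_integrable_def)
  then show ?thesis
    using f g by (auto simp: square_integrable_def power2_sum mult.assoc)
qed

lemma square_integrable_scale:
  "square_integrable M f \<Longrightarrow> square_integrable M (\<lambda>x. c * f x)"
  by (auto simp: square_integrable_def power_mult_distrib)

lemma square_integrable_diff:
  "square_integrable M f \<Longrightarrow> square_integrable M g \<Longrightarrow> square_integrable M (\<lambda>x. f x - g x)"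
  using square_integrable_add[of M f "\<lambda>x. (-1) * g x"] square_integrable_scale[of M g "-1"]
  by simp

definition l2_rel :: "(real \<Rightarrow> real) \<Rightarrow> (real \<Rightarrow> real) \<Rightarrow> bool" where
  "l2_rel f g \<longleftrightarrow> square_integrable \<mm> f \<and> square_integrable \<mm> g \<and> (AE m in \<mm>. f m = g m)"

quotient_type l2 = "real \<Rightarrow> real" / partial: l2_rel
proof (rule part_equivpI)
  show "\<exists>f. l2_rel f f"
    by (rule exI[of _ "\<lambda>_. 0"]) (simp add: l2_rel_def square_integrable_def)
  show "symp l2_rel"
    by (auto simp: symp_def l2_rel_def)
  show "transp l2_rel"
    by (auto simp: transp_def l2_rel_def)
qed

lemma l2_rel_refl [simp]: "l2_rel f f \<longleftrightarrow> square_integrable \<mm> f"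
  by (simp add: l2_rel_def)

instantiation l2 :: real_inner
begin

lift_definition zero_l2 :: l2 is "\<lambda>_. 0"
  by (simp add: square_integrable_def)

lift_definition plus_l2 :: "l2 \<Rightarrow> l2 \<Rightarrow> l2" is "\<lambda>f g m. f m + g m"
  unfolding l2_rel_def by (auto intro: square_integrable_add elim!: eventually_elim2)

lift_definition minus_l2 :: "l2 \<Rightarrow> l2 \<Rightarrow> l2" is "\<lambda>f g m. f m - g m"
  unfolding l2_rel_def by (auto intro: square_integrable_diff elim!: eventually_elim2)

lift_definition uminus_l2 :: "l2 \<Rightarrow> l2" is "\<lambda>f m. - f m"
  unfolding l2_rel_def
  using square_integrable_scale[of \<mm> _ "-1"] by auto

lift_definition scaleR_l2 :: "real \<Rightarrow> l2 \<Rightarrow> l2" is "\<lambda>c f m. c * f m"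
  unfolding l2_rel_def by (auto intro: square_integrable_scale)

lift_definition inner_l2 :: "l2 \<Rightarrow> l2 \<Rightarrow> real" is "\<lambda>f g. \<integral>m. f m * g m \<partial>\<mm>"
  unfolding l2_rel_def
  by (intro integral_cong_AE) (auto simp: square_integrable_def)

definition norm_l2 :: "l2 \<Rightarrow> real" where
  "norm_l2 f = sqrt (f \<bullet> f)"

definition sgn_l2 :: "l2 \<Rightarrow> l2" where
  "sgn_l2 f = inverse (norm f) *\<^sub>R f"

definition dist_l2 :: "l2 \<Rightarrow> l2 \<Rightarrow> real" where
  "dist_l2 f g = norm (f - g)"

definition uniformity_l2 :: "(l2 \<times> l2) filter" where
  "uniformity_l2 = (INF e\<in>{0<..}. principal {(x, y). dist x y < e})"

definition open_l2 :: "l2 set \<Rightarrow> bool" where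
  "open_l2 U \<longleftrightarrow> (\<forall>x\<in>U. \<forall>\<^sub>F (x', y) in uniformity. x' = x \<longrightarrow> y \<in> U)"

instance
proof
  fix a b c :: l2 and r s :: real
  show "a + b + c = a + (b + c)"
    by transfer (auto simp: l2_rel_def add.assoc intro!: square_integrable_add)
  show "a + b = b + a"
    by transfer (auto simp: l2_rel_def add.commute intro!: square_integrable_add)
  show "0 + a = a"
    by transfer (auto simp: l2_rel_def)
  show "- a + a = 0"
    by transfer (auto simp: l2_rel_def square_integrable_def)
  show "a - b = a + - b"
    by transfer (auto simp: l2_rel_def intro!: square_integrable_diff)
  show "r *\<^sub>R (a + b) = r *\<^sub>R a + r *\<^sub>R b"
    by transfer (auto simp: l2_rel_def distrib_left
        intro!: square_integrable_add square_integrable_scale)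
  show "(r + s) *\<^sub>R a = r *\<^sub>R a + s *\<^sub>R a"
    by transfer (auto simp: l2_rel_def distrib_right
        intro!: square_integrable_add square_integrable_scale)
  show "r *\<^sub>R s *\<^sub>R a = (r * s) *\<^sub>R a"
    by transfer (auto simp: l2_rel_def mult.assoc intro!: square_integrable_scale)
  show "1 *\<^sub>R a = a"
    by transfer (auto simp: l2_rel_def)
  show "dist a b = norm (a - b)"
    by (rule dist_l2_def)
  show "sgn a = inverse (norm a) *\<^sub>R a"
    by (rule sgn_l2_def)
  show "uniformity = (INF e\<in>{0<..}. principal {(x :: l2, y). dist x y < e})"
    by (rule uniformity_l2_def)
  show "open U \<longleftrightarrow> (\<forall>x\<in>U. \<forall>\<^sub>F (x', y) in uniformity. x' = x \<longrightarrow> y \<in> U)" for U :: "l2 set"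
    by (rule open_l2_def)
  show "a \<bullet> b = b \<bullet> a"
    by transfer (simp add: mult.commute)
  show "(a + b) \<bullet> c = a \<bullet> c + b \<bullet> c"
    by transfer (simp add: distrib_right square_integrable_mult)
  show "(r *\<^sub>R a) \<bullet> b = r * (a \<bullet> b)"
    by transfer (simp add: mult.assoc)
  show "0 \<le> a \<bullet> a"
    by transfer (simp add: integral_nonneg_AE)
  show "a \<bullet> a = 0 \<longleftrightarrow> a = 0"
  proof transfer
    fix f assume "l2_rel f f"
    then have f: "square_integrable \<mm> f" by simp
    have "(\<integral>m. f m * f m \<partial>\<mm>) = 0 \<longleftrightarrow> (AE m in \<mm>. f m * f m = 0)"
      using square_integrable_mult[OF f f] by (intro integral_nonneg_eq_0_iff_AE) auto
    then show "(\<integral>m. f m * f m \<partial>\<mm>) = 0 \<longleftrightarrow> l2_rel f (\<lambda>_. 0)"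
      using f by (simp add: l2_rel_def square_integrable_def)
  qed
  show "norm a = sqrt (a \<bullet> a)"
    by (rule norm_l2_def)
qed

end

lemma finite_measure_mass: "finite_measure \<mm>"
  by (rule finite_measureI) (simp add: emeasure_restrict_space space_restrict_space Omega_def)

lemma abs_rep_l2: "abs_l2 (rep_l2 F) = F"
  by (rule Quotient3_abs_rep[OF Quotient3_l2])

lemma square_integrable_rep_l2: "square_integrable \<mm> (rep_l2 F)"
  using Quotient3_rep_reflp[OF Quotient3_l2, of F] by simp

lemma norm_abs_diff_l2:
  assumes "square_integrable \<mm> f" "square_integrable \<mm> g"
  shows "norm (abs_l2 f - abs_l2 g) = sqrt (\<integral>m. (f m - g m)\<^sup>2 \<partial>\<mm>)"
  using assms
  by (simp add: norm_eq_sqrt_inner minus_l2.abs_eq inner_l2.abs_eq square_integrable_diff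
      power2_eq_square)

instance l2 :: banach
proof
  fix S :: "nat \<Rightarrow> l2"
  assume cau: "Cauchy S"
  interpret finite_measure \<mm> by (rule finite_measure_mass)
  define s where "s n = rep_l2 (S n)" for n
  have sq: "square_integrable \<mm> (s n)" for n
    by (simp add: s_def square_integrable_rep_l2)
  have Ss: "S n = abs_l2 (s n)" for n
    by (simp add: s_def abs_rep_l2)
  have meas [measurable]: "s n \<in> borel_measurable \<mm>" for n
    using sq by (simp add: square_integrable_def)
  have dS: "dist (S i) (S j) = sqrt (\<integral>m. (s i m - s j m)\<^sup>2 \<partial>\<mm>)" for i j
    unfolding Ss dist_norm by (rule norm_abs_diff_l2[OF sq sq])
  have sqd: "square_integrable \<mm> (\<lambda>m. s i m - s j m)" for i j
    by (intro square_integrable_diff sq)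
  have one: "square_integrable \<mm> (\<lambda>_. 1)"
    by (simp add: square_integrable_def)
  have L1: "(\<integral>m. norm (s i m - s j m) \<partial>\<mm>) \<le> norm (abs_l2 (\<lambda>_. 1)) * dist (S i) (S j)" for i j
  proof -
    have a: "square_integrable \<mm> (\<lambda>m. \<bar>s i m - s j m\<bar>)"
      using sqd[of i j] by (simp add: square_integrable_def)
    have "(\<integral>m. norm (s i m - s j m) \<partial>\<mm>) = abs_l2 (\<lambda>_. 1) \<bullet> abs_l2 (\<lambda>m. \<bar>s i m - s j m\<bar>)"
      using a one by (simp add: inner_l2.abs_eq)
    also have "\<dots> \<le> norm (abs_l2 (\<lambda>_. 1)) * norm (abs_l2 (\<lambda>m. \<bar>s i m - s j m\<bar>))"
      by (rule norm_cauchy_schwarz)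
    also have "norm (abs_l2 (\<lambda>m. \<bar>s i m - s j m\<bar>)) = dist (S i) (S j)"
      using a by (simp add: norm_eq_sqrt_inner inner_l2.abs_eq dS power2_eq_square
          flip: abs_mult)
    finally show ?thesis .
  qed
  have intS: "integrable \<mm> (s n)" for n
    using square_integrable_imp_integrable[OF meas] sq by (simp add: square_integrable_def)
  have "\<exists>N. \<forall>i\<ge>N. \<forall>j\<ge>N. (\<integral>m. norm (s i m - s j m) \<partial>\<mm>) < e" if "e > 0" for e
  proof -
    define c where "c = norm (abs_l2 (\<lambda>_. 1)) + 1"
    have c: "c > 0" "norm (abs_l2 (\<lambda>_. 1)) \<le> c"
      by (auto simp: c_def add_nonneg_pos)
    obtain N where N: "\<And>i j. i \<ge> N \<Longrightarrow> j \<ge> N \<Longrightarrow> dist (S i) (S j) < e / c"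
      using cau \<open>e > 0\<close> c(1) unfolding Cauchy_def by (meson divide_pos_pos)
    have "(\<integral>m. norm (s i m - s j m) \<partial>\<mm>) < e" if "i \<ge> N" "j \<ge> N" for i j
    proof -
      have "(\<integral>m. norm (s i m - s j m) \<partial>\<mm>) \<le> c * dist (S i) (S j)"
        using L1[of i j] mult_right_mono[OF c(2) zero_le_dist[of "S i" "S j"]] by linarith
      also have "\<dots> < e"
        using N[OF that] c(1) by (simp add: field_simps)
      finally show ?thesis .
    qed
    then show ?thesis by blast
  qed
  from cauchy_L1_AE_cauchy_subseq[OF intS this]
  obtain r where r: "strict_mono r" "AE m in \<mm>. Cauchy (\<lambda>i. s (r i) m)" by blast
  define f where "f m = lim (\<lambda>i. s (r i) m)" for m
  have [measurable]: "f \<in> borel_measurable \<mm>"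
    unfolding f_def[abs_def] by measurable
  have conv: "AE m in \<mm>. (\<lambda>i. s (r i) m) \<longlonglongrightarrow> f m"
    using r(2) by eventually_elim
      (simp add: f_def Cauchy_convergent_iff convergent_LIMSEQ_iff)
  have key: "(\<integral>\<^sup>+ m. ennreal ((s n m - f m)\<^sup>2) \<partial>\<mm>) \<le> ennreal (e\<^sup>2)"
    if N: "\<And>i j. i \<ge> N \<Longrightarrow> j \<ge> N \<Longrightarrow> dist (S i) (S j) < e" and n: "n \<ge> N" for N n e
  proof -
    have "(\<integral>\<^sup>+ m. ennreal ((s n m - f m)\<^sup>2) \<partial>\<mm>)
        = (\<integral>\<^sup>+ m. liminf (\<lambda>i. ennreal ((s n m - s (r i) m)\<^sup>2)) \<partial>\<mm>)"
    proof (rule nn_integral_cong_AE)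
      show "AE m in \<mm>. ennreal ((s n m - f m)\<^sup>2) = liminf (\<lambda>i. ennreal ((s n m - s (r i) m)\<^sup>2))"
        using conv
      proof eventually_elim
        case (elim m)
        have "(\<lambda>i. ennreal ((s n m - s (r i) m)\<^sup>2)) \<longlonglongrightarrow> ennreal ((s n m - f m)\<^sup>2)"
          by (intro tendsto_intros elim) 
        then show ?case
          using lim_imp_Liminf[OF sequentially_bot] by metis
      qed
    qed
    also have "\<dots> \<le> liminf (\<lambda>i. \<integral>\<^sup>+ m. ennreal ((s n m - s (r i) m)\<^sup>2) \<partial>\<mm>)"
      by (rule nn_integral_liminf) measurable
    also have "\<dots> \<le> ennreal (e\<^sup>2)"
    proof (rule Liminf_le)
      show "\<forall>\<^sub>F i in sequentially. (\<integral>\<^sup>+ m. ennreal ((s n m - s (r i) m)\<^sup>2) \<partial>\<mm>) \<le> ennreal (e\<^sup>2)"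
      proof (rule eventually_sequentiallyI[of N])
        fix i assume "i \<ge> N"
        then have "r i \<ge> N" using seq_suble[OF r(1), of i] by linarith
        from N[OF n this] have "sqrt (\<integral>m. (s n m - s (r i) m)\<^sup>2 \<partial>\<mm>) < e"
          by (simp add: dS)
        then have "(\<integral>m. (s n m - s (r i) m)\<^sup>2 \<partial>\<mm>) \<le> e\<^sup>2"
          by (meson less_imp_le real_sqrt_less_iff sqrt_le_D)
        then show "(\<integral>\<^sup>+ m. ennreal ((s n m - s (r i) m)\<^sup>2) \<partial>\<mm>) \<le> ennreal (e\<^sup>2)"
          using square_integrableD(2)[OF sqd]
          by (subst nn_integral_eq_integral) (auto intro: ennreal_leI)
      qed
    qed simp
    finally show ?thesis .
  qed
  have sqdf: "square_integrable \<mm> (\<lambda>m. s n m - f m)"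
    if N: "\<And>i j. i \<ge> N \<Longrightarrow> j \<ge> N \<Longrightarrow> dist (S i) (S j) < e" and n: "n \<ge> N" for N n e
  proof -
    have "(\<integral>\<^sup>+ m. ennreal (norm ((s n m - f m)\<^sup>2)) \<partial>\<mm>) < \<infinity>"
      using le_less_trans[OF key[OF that] ennreal_less_top] by simp
    then show ?thesis
      unfolding square_integrable_def by (auto intro!: integrableI_bounded)
  qed
  have sqf: "square_integrable \<mm> f"
  proof -
    obtain N where N: "\<And>i j. i \<ge> N \<Longrightarrow> j \<ge> N \<Longrightarrow> dist (S i) (S j) < 1"
      using cau unfolding Cauchy_def by (meson zero_less_one)
    have "square_integrable \<mm> (\<lambda>m. s N m - f m)"
      by (rule sqdf[OF N order_refl])
    from square_integrable_diff[OF sq[of N] this] show ?thesis by simp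
  qed
  have "S \<longlonglongrightarrow> abs_l2 f"
  proof (rule metric_LIMSEQ_I)
    fix e :: real assume "e > 0"
    then obtain N where N: "\<And>i j. i \<ge> N \<Longrightarrow> j \<ge> N \<Longrightarrow> dist (S i) (S j) < e / 2"
      using cau unfolding Cauchy_def by (meson half_gt_zero)
    have "dist (S n) (abs_l2 f) < e" if "n \<ge> N" for n
    proof -
      have "ennreal (\<integral>m. (s n m - f m)\<^sup>2 \<partial>\<mm>) \<le> ennreal ((e / 2)\<^sup>2)"
        using key[OF N that] square_integrableD(2)[OF sqdf[OF N that]]
        by (simp add: nn_integral_eq_integral)
      then have "(\<integral>m. (s n m - f m)\<^sup>2 \<partial>\<mm>) \<le> (e / 2)\<^sup>2"
        by (subst (asm) ennreal_le_iff) auto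
      then have "dist (S n) (abs_l2 f) \<le> e / 2"
        unfolding Ss dist_norm norm_abs_diff_l2[OF sq sqf]
        using \<open>e > 0\<close> by (intro real_le_lsqrt) auto
      then show ?thesis using \<open>e > 0\<close> by simp
    qed
    then show "\<exists>N. \<forall>n\<ge>N. dist (S n) (abs_l2 f) < e" by blast
  qed
  then show "convergent S" by (auto simp: convergent_def)
qed

definition absolutely_continuous_on :: "real set \<Rightarrow> (real \<Rightarrow> 'a::metric_space) \<Rightarrow> bool" where
  "absolutely_continuous_on S f \<longleftrightarrow>
    (\<forall>e>0. \<exists>d>0. \<forall>P. finite P \<and> (\<forall>(a, b)\<in>P. a \<le> b \<and> {a..b} \<subseteq> S)
        \<and> disjoint_family_on (\<lambda>(a, b). {a<..<b}) P \<and> (\<Sum>(a, b)\<in>P. b - a) < d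
      \<longrightarrow> (\<Sum>(a, b)\<in>P. dist (f a) (f b)) < e)"

(* The library's closest_point is restricted to Heine-Borel spaces. *)
definition metric_proj :: "'a::metric_space set \<Rightarrow> 'a \<Rightarrow> 'a" where
  "metric_proj C w = (THE z. z \<in> C \<and> (\<forall>y\<in>C. dist w z \<le> dist w y))"

definition monotone_repr :: "l2 \<Rightarrow> (real \<Rightarrow> real) \<Rightarrow> bool" where
  "monotone_repr X f \<longleftrightarrow> square_integrable \<mm> f \<and> abs_l2 f = X
    \<and> mono_on \<Omega> f \<and> (\<forall>m\<in>\<Omega>. continuous (at_right m) f)"

definition Kcone :: "l2 set" (\<open>\<K>\<close>) where
  "\<K> = {X. \<exists>f. monotone_repr X f}"

lemma monotone_repr_unique:
  assumes f: "monotone_repr X f" and g: "monotone_repr X g" and m: "m \<in> \<Omega>"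
  shows "f m = g m"
proof (rule ccontr)
  assume ne: "f m \<noteq> g m"
  have "AE x in \<mm>. f x = g x"
    using f g Quotient3_rel[OF Quotient3_l2, of f g]
    by (auto simp: monotone_repr_def l2_rel_def)
  then have ae: "AE x in lebesgue. x \<in> \<Omega> \<longrightarrow> f x = g x"
    by (simp add: AE_restrict_space_iff Omega_def)
  have "((\<lambda>x. f x - g x) \<longlongrightarrow> f m - g m) (at_right m)"
    using f g m by (auto simp: monotone_repr_def continuous_within intro!: tendsto_diff)
  then have "\<forall>\<^sub>F x in at_right m. f x - g x \<noteq> 0"
    using ne by (intro tendsto_imp_eventually_ne) auto
  then obtain b where b: "b > m" "\<And>x. m < x \<Longrightarrow> x < b \<Longrightarrow> f x \<noteq> g x"
    unfolding eventually_at_right_field by auto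
  define c where "c = min b 1"
  have c: "m < c" using b(1) m by (auto simp: c_def Omega_def)
  have "AE x in lebesgue. x \<notin> {m<..<c}"
    using ae by eventually_elim (use b(2) m in \<open>auto simp: c_def Omega_def\<close>)
  then have "{m<..<c} \<in> null_sets lebesgue"
    by (subst AE_iff_null_sets) auto
  then show False
    using c by (simp add: null_sets_def)
qed

(* By uniqueness, all properties of mono_repr X on the unit interval are those of the
   nondecreasing right-continuous function X; values outside the interval are irrelevant. *)
definition mono_repr :: "l2 \<Rightarrow> real \<Rightarrow> real" where
  "mono_repr X = (SOME f. monotone_repr X f)"

definition subdiff_K :: "l2 \<Rightarrow> l2 set" where
  "subdiff_K X = {W. \<forall>Y\<in>\<K>. W \<bullet> (Y - X) \<le> 0}"

definition Omega_flat :: "l2 \<Rightarrow> real set" where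
  "Omega_flat X = {m\<in>\<Omega>. \<exists>e>0. ball m e \<subseteq> \<Omega> \<and> mono_repr X constant_on ball m e}"

(* An element of l2 is constant on I if some (equivalently any) of its representatives
   is almost everywhere equal to a constant on I. *)
definition Hspace :: "l2 \<Rightarrow> l2 set" where
  "Hspace X = {U. \<forall>I. is_interval I \<and> I \<subseteq> Omega_flat X
      \<longrightarrow> (\<exists>c. AE m in \<mm>. m \<in> I \<longrightarrow> rep_l2 U m = c)}"

definition law :: "l2 \<Rightarrow> real measure" where
  "law X = distr \<mm> borel (mono_repr X)"

(* Monotonicity is only required away from the origin, so that weakly singular protocols,
   which blow up at 0, are covered; the value at 0 does not influence the primitive. *)
definition communication_protocol :: "(real \<Rightarrow> real) \<Rightarrow> bool" where
  "communication_protocol \<phi> \<longleftrightarrow>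
     (\<forall>x. 0 \<le> \<phi> x) \<and> (\<forall>x. \<phi> (- x) = \<phi> x)
     \<and> (\<forall>x y. 0 < \<bar>x\<bar> \<and> \<bar>x\<bar> \<le> \<bar>y\<bar> \<longrightarrow> \<phi> y \<le> \<phi> x)
     \<and> (\<forall>C. compact C \<longrightarrow> set_integrable lborel C \<phi>)"

definition primitive :: "(real \<Rightarrow> real) \<Rightarrow> real \<Rightarrow> real" where
  "primitive \<phi> x = (LBINT y=ereal 0..ereal x. \<phi> y)"

(* The element (Phi * rho)(X) of l2, where rho = law X. *)
definition conv_law :: "(real \<Rightarrow> real) \<Rightarrow> l2 \<Rightarrow> l2" where
  "conv_law \<phi> X = abs_l2 (\<lambda>m. \<integral>y. primitive \<phi> (mono_repr X m - y) \<partial>law X)"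

lemma primitive_measurable:
  assumes "communication_protocol \<phi>"
  shows "primitive \<phi> \<in> borel_measurable borel"
proof (rule borel_measurable_mono, rule monoI)
  fix x y :: real assume "x \<le> y"
  have int: "interval_lebesgue_integrable lborel (ereal a) (ereal b) \<phi>" if "a \<le> b" for a b
  proof -
    have "set_integrable lborel {a..b} \<phi>"
      using assms by (simp add: communication_protocol_def)
    then have "set_integrable lborel {a<..<b} \<phi>"
      by (rule set_integrable_subset) auto
    then show ?thesis using that by (simp add: interval_lebesgue_integrable_def)
  qed
  have "primitive \<phi> x + (LBINT z=ereal x..ereal y. \<phi> z) = primitive \<phi> y"
    unfolding primitive_def
    by (intro interval_integral_sum) (auto simp: min_def max_def intro!: int)
  moreover have "0 \<le> (LBINT z=ereal x..ereal y. \<phi> z)"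
    using \<open>x \<le> y\<close> assms
    by (auto simp: interval_lebesgue_integral_def communication_protocol_def
        set_lebesgue_integral_def intro!: integral_nonneg_AE)
  ultimately show "primitive \<phi> x \<le> primitive \<phi> y" by linarith
qed

lemma conv_law_eq:
  assumes "communication_protocol \<phi>" "X \<in> \<K>"
  shows "conv_law \<phi> X =
    abs_l2 (\<lambda>m. \<integral>\<omega>. primitive \<phi> (mono_repr X m - mono_repr X \<omega>) \<partial>\<mm>)"
proof -
  have "monotone_repr X (mono_repr X)"
    using assms(2) someI_ex[of "monotone_repr X"] by (simp add: Kcone_def mono_repr_def)
  then have [measurable]: "mono_repr X \<in> borel_measurable \<mm>"
    by (simp add: monotone_repr_def square_integrable_def)
  have [measurable]: "primitive \<phi> \<in> borel_measurable borel"
    by (rule primitive_measurable[OF assms(1)])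
  show ?thesis
    unfolding conv_law_def law_def by (subst integral_distr) measurable
qed

definition Psi :: "(real \<Rightarrow> real) \<Rightarrow> l2 \<Rightarrow> l2 \<Rightarrow> l2" where
  "Psi \<phi> X V = V + conv_law \<phi> X"

definition velocity_U :: "(real \<Rightarrow> real) \<Rightarrow> l2 \<Rightarrow> l2 \<Rightarrow> l2 \<Rightarrow> l2" where
  "velocity_U \<phi> Xbar Vbar X = Psi \<phi> Xbar Vbar
     - abs_l2 (\<lambda>m. \<integral>\<omega>. primitive \<phi> (mono_repr X m - mono_repr X \<omega>) \<partial>\<mm>)"

(* Absolute continuity on the half-line is understood locally. *)
definition lagrangian_solution :: "(real \<Rightarrow> real) \<Rightarrow> l2 \<Rightarrow> l2 \<Rightarrow> (real \<Rightarrow> l2) \<Rightarrow> bool" where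
  "lagrangian_solution \<phi> Xbar Vbar X \<longleftrightarrow>
     (\<forall>t\<ge>0. X t \<in> \<K>) \<and> (\<forall>T\<ge>0. absolutely_continuous_on {0..T} X) \<and> X 0 = Xbar
     \<and> (AE t in lborel. t > 0 \<longrightarrow>
          (\<exists>D. (X has_vector_derivative D) (at t)
             \<and> - D \<in> (\<lambda>W. - velocity_U \<phi> Xbar Vbar (X t) + W) ` subdiff_K (X t)))"

definition globally_sticky :: "(real \<Rightarrow> l2) \<Rightarrow> bool" where
  "globally_sticky X \<longleftrightarrow> (\<forall>s t. 0 \<le> s \<and> s \<le> t \<longrightarrow> Omega_flat (X s) \<subseteq> Omega_flat (X t))"

end

theory Submission
  imports Defs
begin

text \<open>Write \<open>P\<^sub>t\<close> for the orthogonal projection onto \<open>Hspace (X t)\<close> and \<open>A\<close> for \<open>conv_law \<phi>\<close>. The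
  projection \<open>P\<^sub>t\<close> maps \<open>\<K>\<close> into itself, and Chebyshev's inequality gives
  \<open>Z \<bullet> (Y - P\<^sub>t Y) \<ge> 0\<close> for \<open>Y, Z \<in> \<K>\<close>. Suppose that \<open>Psibar \<bullet> (Y - P\<^sub>s Y) \<le> 0\<close> for all
  \<open>Y \<in> \<K>\<close>. Testing the differential inclusion with \<open>P\<^sub>s (X t) \<in> \<K>\<close> then shows that the distance
  from \<open>X t\<close> to \<open>Hspace (X s)\<close> does not increase for \<open>t \<ge> s\<close>, so that it vanishes: this is
  stickiness. The supposition holds at every \<open>s\<close> where the inclusion does, because a two-sided
  derivative of \<open>X\<close> at \<open>s\<close> must lie in \<open>Hspace (X s)\<close>, and it extends to all other \<open>s\<close> by
  continuity of \<open>A\<close> along \<open>X\<close>.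

  Elements of \<open>subdiff_K (X t)\<close> are orthogonal to \<open>Hspace (X t)\<close>, so the inclusion reads
  \<open>X' = P\<^sub>t Psibar - A (X t)\<close> almost everywhere. The right-hand side is right continuous in \<open>t\<close>, hence
  it is the right derivative at every \<open>t\<close>. The projection formulas follow because
  \<open>P\<^sub>s Psibar - P\<^sub>t Psibar \<in> subdiff_K (X t)\<close> for \<open>s \<le> t\<close>.\<close>

section \<open>Projections in Hilbert spaces\<close>

text \<open>The interaction is handled by its sign instead: \<open>A (X t)\<close> is a
  nondecreasing function of the mass variable, hence lies in \<open>\<K>\<close>, and by Chebyshev's
  inequality it can only bring \<open>X t\<close> closer to \<open>Hspace (X s)\<close>.

  The inclusion holds almost everywhere, for a curve in an infinite-dimensional space. It is never
  integrated as a whole: the curve is paired with a fixed vector, or its distance to a subspace is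
  squared, and the resulting absolutely continuous real function is shown not to increase.

  The extension from almost every time to every \<open>s\<close> approaches \<open>s\<close> from
  the left, which is impossible at time 0; there the hypothesis on \<open>Vbar\<close> puts
  \<open>Psibar\<close> in \<open>Hspace (X 0)\<close>.

  That elements of the subdifferential annihilate all of \<open>Hspace (X t)\<close>, and not just
  \<open>X t\<close>, comes from splitting \<open>X t\<close> into truncations, each piece being in
  \<open>\<K>\<close>.\<close>

lemma exists_min_norm:
  fixes C :: "'a::{real_inner, banach} set"
  assumes "closed C" "convex C" "C \<noteq> {}"
  shows "\<exists>z\<in>C. \<forall>y\<in>C. norm z \<le> norm y"
proof -
  define d where "d = (INF y\<in>C. norm y)"
  have bdd: "bdd_below (norm ` C)" by (auto intro!: bdd_belowI2[of _ 0])
  have d_le: "d \<le> norm y" if "y \<in> C" for y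
    unfolding d_def using bdd that by (rule cINF_lower)
  have d0: "0 \<le> d"
    unfolding d_def using \<open>C \<noteq> {}\<close> by (intro cINF_greatest) auto
  have "\<exists>y\<in>C. norm y < d + 1 / Suc n" for n
    using cInf_lessD[of "norm ` C" "d + 1 / Suc n"] \<open>C \<noteq> {}\<close> by (auto simp: d_def)
  then obtain y where y: "\<And>n. y n \<in> C" "\<And>n. norm (y n) < d + 1 / Suc n"
    by metis
  have lim: "(\<lambda>n. norm (y n)) \<longlonglongrightarrow> d"
  proof (rule tendsto_sandwich[where f = "\<lambda>_. d" and h = "\<lambda>n. d + 1 / Suc n"])
    show "(\<lambda>n. d + 1 / Suc n) \<longlonglongrightarrow> d"
      using tendsto_add[OF tendsto_const[of d] LIMSEQ_inverse_real_of_nat]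
      by (simp add: inverse_eq_divide)
  qed (use y d_le in \<open>auto intro: always_eventually less_imp_le\<close>)
  \<comment> \<open>Parallelogram identity: the midpoint of \<open>y m\<close> and
    \<open>y n\<close> lies in \<open>C\<close>, so its norm is at least \<open>d\<close>.\<close>
  have est: "(norm (y m - y n))\<^sup>2 \<le> 2 * ((norm (y m))\<^sup>2 - d\<^sup>2) + 2 * ((norm (y n))\<^sup>2 - d\<^sup>2)" for m n
  proof -
    have "(1/2) *\<^sub>R y m + (1/2) *\<^sub>R y n \<in> C"
      using y(1) \<open>convex C\<close> by (intro convexD) auto
    then have "d \<le> norm ((1/2) *\<^sub>R (y m + y n))"
      using d_le by (metis scaleR_add_right)
    then have "2 * d \<le> norm (y m + y n)" by simp
    then have "(2 * d)\<^sup>2 \<le> (norm (y m + y n))\<^sup>2"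
      using d0 by (intro power_mono) auto
    then show ?thesis
      by (simp add: power2_norm_eq_inner inner_simps inner_commute power_mult_distrib)
  qed
  have "Cauchy y"
  proof (rule CauchyI)
    fix e :: real assume "e > 0"
    have "(\<lambda>n. (norm (y n))\<^sup>2 - d\<^sup>2) \<longlonglongrightarrow> d\<^sup>2 - d\<^sup>2"
      by (intro tendsto_intros lim)
    then have "(\<lambda>n. (norm (y n))\<^sup>2 - d\<^sup>2) \<longlonglongrightarrow> 0" by simp
    then have "\<forall>\<^sub>F n in sequentially. (norm (y n))\<^sup>2 - d\<^sup>2 < e\<^sup>2 / 4"
      by (rule order_tendstoD(2)) (use \<open>e > 0\<close> in simp)
    then obtain N where N: "\<And>n. n \<ge> N \<Longrightarrow> (norm (y n))\<^sup>2 - d\<^sup>2 < e\<^sup>2 / 4"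
      by (auto simp: eventually_sequentially)
    have "norm (y m - y n) < e" if "m \<ge> N" "n \<ge> N" for m n
    proof -
      have "(norm (y m - y n))\<^sup>2 < e\<^sup>2"
      proof -
        have "u < e'" if "u \<le> 2 * b + 2 * c" "b < e' / 4" "c < e' / 4" for u b c e' :: real
          using that by (simp add: field_simps)
        from this[OF est N N] that show ?thesis by blast
      qed
      then show ?thesis using \<open>e > 0\<close> by (simp add: power_less_imp_less_base)
    qed
    then show "\<exists>M. \<forall>m\<ge>M. \<forall>n\<ge>M. norm (y m - y n) < e" by blast
  qed
  then obtain z where z: "y \<longlonglongrightarrow> z"
    by (auto simp: Cauchy_convergent_iff convergent_def)
  then have "z \<in> C" using \<open>closed C\<close> y(1) by (auto simp: closed_sequential_limits)
  moreover have "norm z = d"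
    using LIMSEQ_unique[OF tendsto_norm[OF z] lim] .
  ultimately show ?thesis using d_le by auto
qed

text \<open>The angle condition gives the Pythagorean inequality \<open>key\<close>, which yields
  minimality and also the uniqueness that the description operator in \<open>metric_proj\<close>
  demands.\<close>

lemma metric_proj_eqI:
  fixes C :: "'a::real_inner set"
  assumes z: "z \<in> C" and obtuse: "\<And>y. y \<in> C \<Longrightarrow> (w - z) \<bullet> (y - z) \<le> 0"
  shows "metric_proj C w = z"
  unfolding metric_proj_def
proof (rule the_equality)
  have key: "(dist w z)\<^sup>2 + (dist y z)\<^sup>2 \<le> (dist w y)\<^sup>2" if "y \<in> C" for y
    using obtuse[OF that]
    by (simp add: dist_norm power2_norm_eq_inner inner_simps inner_commute)
  have "dist w z \<le> dist w y" if "y \<in> C" for y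
  proof (rule power2_le_imp_le)
    show "(dist w z)\<^sup>2 \<le> (dist w y)\<^sup>2"
      using key[OF that] zero_le_power2[of "dist y z"] by linarith
  qed simp
  then show "z \<in> C \<and> (\<forall>y\<in>C. dist w z \<le> dist w y)" using z by blast
  fix x assume x: "x \<in> C \<and> (\<forall>y\<in>C. dist w x \<le> dist w y)"
  then have "(dist w x)\<^sup>2 \<le> (dist w z)\<^sup>2"
    using z by (intro power_mono) auto
  then have "(dist x z)\<^sup>2 \<le> 0" using key[of x] x by linarith
  then show "x = z" by simp
qed

lemma metric_proj_subspace_eqI:
  fixes S :: "'a::real_inner set"
  assumes "subspace S" "p \<in> S" "\<And>h. h \<in> S \<Longrightarrow> (x - p) \<bullet> h = 0"
  shows "metric_proj S x = p"
proof (rule metric_proj_eqI[OF assms(2)])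
  fix y assume "y \<in> S"
  then have "y - p \<in> S" using assms(1,2) by (blast intro: subspace_diff)
  then show "(x - p) \<bullet> (y - p) \<le> 0" by (metis assms(3) order_refl)
qed

lemma metric_proj_subspace:
  fixes S :: "'a::{real_inner, banach} set"
  assumes S: "subspace S" "closed S"
  shows "metric_proj S x \<in> S" "\<And>h. h \<in> S \<Longrightarrow> (x - metric_proj S x) \<bullet> h = 0"
proof -
  have "closed ((\<lambda>y. - x + y) ` S)" "convex ((\<lambda>y. - x + y) ` S)" "(\<lambda>y. - x + y) ` S \<noteq> {}"
    using S subspace_imp_convex subspace_0[OF S(1)]
    by (auto intro!: closed_translation convex_translation simp del: add_uminus_conv_diff uminus_add_conv_diff)
  from exists_min_norm[OF this] obtain p where p: "p \<in> S" "\<And>y. y \<in> S \<Longrightarrow> norm (- x + p) \<le> norm (- x + y)"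
    by auto
  have orth: "(x - p) \<bullet> h = 0" if "h \<in> S" for h
  proof (cases "h = 0")
    case False
    \<comment> \<open>Moving \<open>p\<close> by \<open>c *\<^sub>R h\<close> would lower the
      squared distance by \<open>((x - p) \<bullet> h)\<^sup>2 / (h \<bullet> h)\<close>, the
      largest drop possible along \<open>h\<close>; minimality of \<open>p\<close> forces it to be
      zero.\<close>
    define c where "c = ((x - p) \<bullet> h) / (h \<bullet> h)"
    have hh: "h \<bullet> h > 0" using False by simp
    have "p + c *\<^sub>R h \<in> S" using p(1) that S(1) by (simp add: subspace_add subspace_scale)
    then have "norm (x - p) \<le> norm (x - p - c *\<^sub>R h)"
      using p(2)[of "p + c *\<^sub>R h"] by (simp add: norm_minus_commute algebra_simps)
    then have "(norm (x - p))\<^sup>2 \<le> (norm (x - p - c *\<^sub>R h))\<^sup>2"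
      by (intro power_mono) auto
    also have "\<dots> = (norm (x - p))\<^sup>2 - 2 * c * ((x - p) \<bullet> h) + c\<^sup>2 * (h \<bullet> h)"
      unfolding power2_norm_eq_inner
      by (simp add: inner_diff_left inner_diff_right inner_commute power2_eq_square algebra_simps)
    also have "\<dots> = (norm (x - p))\<^sup>2 - ((x - p) \<bullet> h)\<^sup>2 / (h \<bullet> h)"
      using hh by (simp add: c_def power2_eq_square field_simps)
    finally have "((x - p) \<bullet> h)\<^sup>2 / (h \<bullet> h) \<le> 0" by linarith
    then have "((x - p) \<bullet> h)\<^sup>2 \<le> 0" using hh by (simp add: divide_le_0_iff)
    then show ?thesis by simp
  qed simp
  have "metric_proj S x = p"
    by (rule metric_proj_subspace_eqI[OF S(1) p(1) orth])
  then show "metric_proj S x \<in> S" "\<And>h. h \<in> S \<Longrightarrow> (x - metric_proj S x) \<bullet> h = 0"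
    using p(1) orth by auto
qed

lemma bounded_linear_metric_proj:
  fixes S :: "'a::{real_inner, banach} set"
  assumes S: "subspace S" "closed S"
  shows "bounded_linear (metric_proj S)"
proof (rule bounded_linear_intro[where K = 1])
  note P = metric_proj_subspace[OF S]
  show "metric_proj S (x + y) = metric_proj S x + metric_proj S y" for x y
  proof (rule metric_proj_subspace_eqI[OF S(1)])
    show "metric_proj S x + metric_proj S y \<in> S" by (intro subspace_add S P(1))
    fix h assume h: "h \<in> S"
    have "x + y - (metric_proj S x + metric_proj S y) = (x - metric_proj S x) + (y - metric_proj S y)"
      by simp
    then show "(x + y - (metric_proj S x + metric_proj S y)) \<bullet> h = 0"
      using P(2)[OF h, of x] P(2)[OF h, of y] by (metis add_0 inner_add_left)
  qed
  show "metric_proj S (c *\<^sub>R x) = c *\<^sub>R metric_proj S x" for c x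
  proof (rule metric_proj_subspace_eqI[OF S(1)])
    show "c *\<^sub>R metric_proj S x \<in> S" by (intro subspace_scale S P(1))
    fix h assume h: "h \<in> S"
    show "(c *\<^sub>R x - c *\<^sub>R metric_proj S x) \<bullet> h = 0"
      using P(2)[OF h, of x] by (metis inner_scaleR_left mult_zero_right scaleR_diff_right)
  qed
  show "norm (metric_proj S x) \<le> norm x * 1" for x
  proof -
    have "x \<bullet> metric_proj S x = metric_proj S x \<bullet> metric_proj S x"
      using P(2)[OF P(1), of x x] by (simp add: inner_diff_left)
    then have "norm (metric_proj S x) * norm (metric_proj S x) \<le> norm x * norm (metric_proj S x)"
      using norm_cauchy_schwarz[of x "metric_proj S x"]
      by (simp flip: power2_norm_eq_inner power2_eq_square)
    then show ?thesis by (cases "norm (metric_proj S x) = 0") auto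
  qed
qed

section \<open>Absolutely continuous curves\<close>

text \<open>Domination of increments rather than composition proper, so that a squared norm along a
  bounded curve is covered, with a constant depending on the bound.\<close>

lemma absolutely_continuous_on_compose:
  fixes f :: "real \<Rightarrow> 'a::metric_space" and g :: "real \<Rightarrow> 'b::metric_space"
  assumes f: "absolutely_continuous_on S f" and "L \<ge> 0"
    and L: "\<And>a b. a \<in> S \<Longrightarrow> b \<in> S \<Longrightarrow> dist (g a) (g b) \<le> L * dist (f a) (f b)"
  shows "absolutely_continuous_on S g"
  unfolding absolutely_continuous_on_def
proof (intro allI impI)
  fix e :: real assume "e > 0"
  \<comment> \<open>Dividing by \<open>L + 1\<close> instead of \<open>L\<close> covers
    \<open>L = 0\<close> and keeps the final inequality strict.\<close>
  then have "e / (L + 1) > 0" using \<open>L \<ge> 0\<close> by simp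
  with f obtain d where d: "d > 0" and H: "\<And>P. finite P \<and> (\<forall>(a, b)\<in>P. a \<le> b \<and> {a..b} \<subseteq> S)
        \<and> disjoint_family_on (\<lambda>(a, b). {a<..<b}) P \<and> (\<Sum>(a, b)\<in>P. b - a) < d
      \<Longrightarrow> (\<Sum>(a, b)\<in>P. dist (f a) (f b)) < e / (L + 1)"
    unfolding absolutely_continuous_on_def by blast
  show "\<exists>d>0. \<forall>P. finite P \<and> (\<forall>(a, b)\<in>P. a \<le> b \<and> {a..b} \<subseteq> S)
        \<and> disjoint_family_on (\<lambda>(a, b). {a<..<b}) P \<and> (\<Sum>(a, b)\<in>P. b - a) < d
      \<longrightarrow> (\<Sum>(a, b)\<in>P. dist (g a) (g b)) < e"
  proof (intro exI conjI allI impI, rule d)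
    fix P assume P: "finite P \<and> (\<forall>(a, b)\<in>P. a \<le> b \<and> {a..b} \<subseteq> S)
        \<and> disjoint_family_on (\<lambda>(a, b). {a<..<b}) P \<and> (\<Sum>(a, b)\<in>P. b - a) < d"
    have "(\<Sum>(a, b)\<in>P. dist (g a) (g b)) \<le> (\<Sum>(a, b)\<in>P. L * dist (f a) (f b))"
      using P by (intro sum_mono) (fastforce intro!: L)
    also have "\<dots> = L * (\<Sum>(a, b)\<in>P. dist (f a) (f b))"
      by (simp add: sum_distrib_left case_prod_unfold)
    also have "\<dots> \<le> L * (e / (L + 1))"
      using H[OF P] \<open>L \<ge> 0\<close> by (intro mult_left_mono) auto
    also have "\<dots> < e" using \<open>L \<ge> 0\<close> \<open>e > 0\<close> by (simp add: field_simps)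
    finally show "(\<Sum>(a, b)\<in>P. dist (g a) (g b)) < e" .
  qed
qed

lemma absolutely_continuous_on_subset:
  assumes "absolutely_continuous_on S f" "T \<subseteq> S"
  shows "absolutely_continuous_on T f"
  unfolding absolutely_continuous_on_def
proof (intro allI impI)
  fix e :: real assume "e > 0"
  with assms(1) obtain d where d: "d > 0" and H: "\<And>P. finite P \<and> (\<forall>(a, b)\<in>P. a \<le> b \<and> {a..b} \<subseteq> S)
        \<and> disjoint_family_on (\<lambda>(a, b). {a<..<b}) P \<and> (\<Sum>(a, b)\<in>P. b - a) < d
      \<Longrightarrow> (\<Sum>(a, b)\<in>P. dist (f a) (f b)) < e"
    unfolding absolutely_continuous_on_def by blast
  show "\<exists>d>0. \<forall>P. finite P \<and> (\<forall>(a, b)\<in>P. a \<le> b \<and> {a..b} \<subseteq> T)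
        \<and> disjoint_family_on (\<lambda>(a, b). {a<..<b}) P \<and> (\<Sum>(a, b)\<in>P. b - a) < d
      \<longrightarrow> (\<Sum>(a, b)\<in>P. dist (f a) (f b)) < e"
  proof (intro exI conjI allI impI, rule d)
    fix P assume "finite P \<and> (\<forall>(a, b)\<in>P. a \<le> b \<and> {a..b} \<subseteq> T)
        \<and> disjoint_family_on (\<lambda>(a, b). {a<..<b}) P \<and> (\<Sum>(a, b)\<in>P. b - a) < d"
    then show "(\<Sum>(a, b)\<in>P. dist (f a) (f b)) < e"
      using assms(2) by (intro H) blast
  qed
qed

lemma absolutely_continuous_on_imp_continuous:
  assumes "absolutely_continuous_on {a..b::real} f"
  shows "continuous_on {a..b} f"
  unfolding continuous_on_iff
proof (intro ballI allI impI)
  fix x e :: real assume x: "x \<in> {a..b}" and "e > 0"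
  then obtain d where d: "d > 0" and H: "\<And>P. finite P \<and> (\<forall>(u, v)\<in>P. u \<le> v \<and> {u..v} \<subseteq> {a..b})
        \<and> disjoint_family_on (\<lambda>(u, v). {u<..<v}) P \<and> (\<Sum>(u, v)\<in>P. v - u) < d
      \<Longrightarrow> (\<Sum>(u, v)\<in>P. dist (f u) (f v)) < e"
    using assms unfolding absolutely_continuous_on_def by blast
  show "\<exists>d>0. \<forall>y\<in>{a..b}. dist y x < d \<longrightarrow> dist (f y) (f x) < e"
  proof (intro exI conjI ballI impI, rule d)
    fix y assume y: "y \<in> {a..b}" "dist y x < d"
    have "(\<Sum>(u, v)\<in>{(min x y, max x y)}. dist (f u) (f v)) < e"
      using x y by (intro H) (auto simp: disjoint_family_on_def dist_real_def)
    then show "dist (f y) (f x) < e"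
      by (auto simp: min_def max_def dist_commute split: if_splits)
  qed
qed

lemma absolutely_continuous_on_plus_lipschitz:
  fixes f g :: "real \<Rightarrow> real"
  assumes f: "absolutely_continuous_on S f"
    and L: "\<And>a b. a \<in> S \<Longrightarrow> b \<in> S \<Longrightarrow> \<bar>g a - g b\<bar> \<le> L * \<bar>a - b\<bar>" and "L \<ge> 0"
  shows "absolutely_continuous_on S (\<lambda>t. f t + g t)"
  unfolding absolutely_continuous_on_def
proof (intro allI impI)
  fix e :: real assume "e > 0"
  then have "e / 2 > 0" by simp
  with f obtain d where d: "d > 0" and H: "\<And>P. finite P \<and> (\<forall>(a, b)\<in>P. a \<le> b \<and> {a..b} \<subseteq> S)
        \<and> disjoint_family_on (\<lambda>(a, b). {a<..<b}) P \<and> (\<Sum>(a, b)\<in>P. b - a) < d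
      \<Longrightarrow> (\<Sum>(a, b)\<in>P. dist (f a) (f b)) < e / 2"
    unfolding absolutely_continuous_on_def by blast
  define d' where "d' = min d (e / (2 * (L + 1)))"
  have d': "d' > 0" using d \<open>e > 0\<close> \<open>L \<ge> 0\<close> by (simp add: d'_def)
  show "\<exists>d>0. \<forall>P. finite P \<and> (\<forall>(a, b)\<in>P. a \<le> b \<and> {a..b} \<subseteq> S)
        \<and> disjoint_family_on (\<lambda>(a, b). {a<..<b}) P \<and> (\<Sum>(a, b)\<in>P. b - a) < d
      \<longrightarrow> (\<Sum>(a, b)\<in>P. dist (f a + g a) (f b + g b)) < e"
  proof (intro exI conjI allI impI, rule d')
    fix P assume P: "finite P \<and> (\<forall>(a, b)\<in>P. a \<le> b \<and> {a..b} \<subseteq> S)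
        \<and> disjoint_family_on (\<lambda>(a, b). {a<..<b}) P \<and> (\<Sum>(a, b)\<in>P. b - a) < d'"
    have "dist (f a + g a) (f b + g b) \<le> dist (f a) (f b) + L * (b - a)" if "(a, b) \<in> P" for a b
    proof -
      have "a \<le> b" "a \<in> S" "b \<in> S" using P that by fastforce+
      then show ?thesis using L[of a b] by (auto simp: dist_real_def)
    qed
    then have "(\<Sum>(a, b)\<in>P. dist (f a + g a) (f b + g b)) \<le> (\<Sum>(a, b)\<in>P. dist (f a) (f b) + L * (b - a))"
      by (intro sum_mono) auto
    also have "\<dots> = (\<Sum>(a, b)\<in>P. dist (f a) (f b)) + L * (\<Sum>(a, b)\<in>P. b - a)"
      by (simp add: sum_distrib_left case_prod_unfold sum.distrib)
    also have "\<dots> < e / 2 + e / 2"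
    proof (rule add_less_le_mono)
      show "(\<Sum>(a, b)\<in>P. dist (f a) (f b)) < e / 2"
        using P by (intro H) (auto simp: d'_def)
      have "L * (\<Sum>(a, b)\<in>P. b - a) \<le> L * (e / (2 * (L + 1)))"
        using P \<open>L \<ge> 0\<close> by (intro mult_left_mono) (auto simp: d'_def)
      also have "\<dots> \<le> e / 2" using \<open>L \<ge> 0\<close> \<open>e > 0\<close> by (simp add: field_simps)
      finally show "L * (\<Sum>(a, b)\<in>P. b - a) \<le> e / 2" .
    qed
    finally show "(\<Sum>(a, b)\<in>P. dist (f a + g a) (f b + g b)) < e" by simp
  qed
qed

text \<open>By Cousin's lemma, \<open>{a..b}\<close> splits into short intervals tagged either by a point where the
  derivative is nonpositive, or by a point of an open set of small measure covering the exceptional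
  null set; absolute continuity controls the increments over the latter.\<close>

lemma absolutely_continuous_nonincreasing:
  fixes f :: "real \<Rightarrow> real"
  assumes "a \<le> b" and ac: "absolutely_continuous_on {a..b} f"
    and ae: "AE t in lborel. a < t \<and> t < b \<longrightarrow> (\<exists>D\<le>0. (f has_real_derivative D) (at t))"
  shows "f b \<le> f a"
proof (rule field_le_epsilon)
  fix e' :: real assume "e' > 0"
  \<comment> \<open>A slope error \<open>e\<close> over the length \<open>b - a\<close>, plus one
    further \<open>e\<close> for the exceptional intervals, adds up to \<open>e'\<close>.\<close>
  define e where "e = e' / (b - a + 1)"
  have e: "e > 0" and ee': "e * (b - a) + e = e'"
  proof -
    show "e > 0" using \<open>e' > 0\<close> \<open>a \<le> b\<close> by (simp add: e_def)
    have "e * (b - a + 1) = e'" using \<open>a \<le> b\<close> by (simp add: e_def)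
    then show "e * (b - a) + e = e'" by (simp add: distrib_left)
  qed
  from ae obtain N where N: "N \<in> null_sets lborel"
    "\<And>t. t \<notin> N \<Longrightarrow> a < t \<Longrightarrow> t < b \<Longrightarrow> \<exists>D\<le>0. (f has_real_derivative D) (at t)"
    by (elim AE_E3) auto
  \<comment> \<open>The endpoints join the exceptional set, since differentiability is given in the
    open interval only.\<close>
  define M where "M = N \<union> {a, b}"
  have M: "M \<in> null_sets lborel"
    unfolding M_def by (intro null_sets.Un N finite_imp_null_set_lborel) auto
  obtain d where d: "d > 0" and H: "\<And>P. finite P \<and> (\<forall>(u, v)\<in>P. u \<le> v \<and> {u..v} \<subseteq> {a..b})
        \<and> disjoint_family_on (\<lambda>(u, v). {u<..<v}) P \<and> (\<Sum>(u, v)\<in>P. v - u) < d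
      \<Longrightarrow> (\<Sum>(u, v)\<in>P. dist (f u) (f v)) < e"
    using ac e unfolding absolutely_continuous_on_def by blast
  obtain G where G: "open G" "M \<subseteq> G" "emeasure lborel (G - M) < d"
    using outer_regular_lborel[of M d] null_setsD2[OF M] d by auto
  have emG: "emeasure lborel G < d"
  proof -
    have "emeasure lborel G = emeasure lborel (G - M)"
      using G(1) M by (intro emeasure_Diff_null_set[symmetric]) auto
    then show ?thesis using G by simp
  qed
  have "\<exists>r>0. (x \<in> M \<longrightarrow> ball x r \<subseteq> G) \<and>
     (x \<in> {a..b} - M \<longrightarrow> (\<forall>u v. u \<le> x \<and> x \<le> v \<and> u \<in> ball x r \<and> v \<in> ball x r \<longrightarrow> f v - f u \<le> e * (v - u)))" for x
  proof (cases "x \<in> M")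
    case True
    then show ?thesis using G(1,2) by (metis DiffD2 openE subsetD)
  next
    case notM: False
    show ?thesis
    proof (cases "x \<in> {a..b}")
      case False
      then show ?thesis using notM by (auto intro: exI[of _ 1])
    next
      case True
      then have "x \<notin> N" "a < x" "x < b" using notM by (auto simp: M_def less_le)
      from N(2)[OF this] obtain D where D: "D \<le> 0" "(f has_real_derivative D) (at x)" by auto
      then have "(f has_derivative (\<lambda>h. D * h)) (at x)"
        by (simp add: has_field_derivative_def)
      then obtain r where r: "r > 0" "\<And>y. \<bar>y - x\<bar> < r \<Longrightarrow> \<bar>f y - f x - D * (y - x)\<bar> \<le> e * \<bar>y - x\<bar>"
        using e unfolding has_derivative_at_alt by auto
      \<comment> \<open>Straddle estimate: because the tag \<open>x\<close> lies between
        \<open>u\<close> and \<open>v\<close>, the first-order errors \<open>e * (v - x)\<close> and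
        \<open>e * (x - u)\<close> sum to \<open>e * (v - u)\<close>.\<close>
      have "f v - f u \<le> e * (v - u)" if "u \<le> x" "x \<le> v" "u \<in> ball x r" "v \<in> ball x r" for u v
      proof -
        have "D * (v - x) \<le> 0" "D * (u - x) \<ge> 0"
          using D(1) that by (auto simp: mult_le_0_iff zero_le_mult_iff)
        moreover have "\<bar>f v - f x - D * (v - x)\<bar> \<le> e * (v - x)" "\<bar>f u - f x - D * (u - x)\<bar> \<le> e * (x - u)"
          using r(2)[of v] r(2)[of u] that by (auto simp: dist_real_def)
        ultimately show ?thesis by (simp add: algebra_simps abs_le_iff)
      qed
      then show ?thesis using r(1) notM by blast
    qed
  qed
  then obtain r where r: "\<And>x. r x > 0" "\<And>x. x \<in> M \<Longrightarrow> ball x (r x) \<subseteq> G"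
    "\<And>x u v. x \<in> {a..b} - M \<Longrightarrow> u \<le> x \<Longrightarrow> x \<le> v \<Longrightarrow> u \<in> ball x (r x) \<Longrightarrow> v \<in> ball x (r x) \<Longrightarrow> f v - f u \<le> e * (v - u)"
    by metis
  have "gauge (\<lambda>x. ball x (r x))" using r(1) by (simp add: gauge_ball_dependent)
  then obtain p where p: "p tagged_division_of {a..b}" "(\<lambda>x. ball x (r x)) fine p"
    by (rule fine_division_exists_real)
  have fin: "finite p" using p(1) by (rule tagged_division_of_finite)
  have K: "\<exists>u v. K = {u..v} \<and> u \<le> x \<and> x \<le> v" "{Inf K..Sup K} = K" "Inf K \<le> x" "x \<le> Sup K" "K \<subseteq> ball x (r x)"
      "K \<subseteq> {a..b}" "interior K = {Inf K<..<Sup K}" if "(x, K) \<in> p" for x K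
  proof -
    show 1: "\<exists>u v. K = {u..v} \<and> u \<le> x \<and> x \<le> v"
      using tagged_division_ofD(2,4)[OF p(1) that] by auto
    then show "{Inf K..Sup K} = K" "Inf K \<le> x" "x \<le> Sup K" "interior K = {Inf K<..<Sup K}"
      by auto
    show "K \<subseteq> ball x (r x)" using p(2) that by (auto simp: fine_def)
    show "K \<subseteq> {a..b}" using tagged_division_ofD(3)[OF p(1) that] .
  qed
  \<comment> \<open>Degenerate intervals are left out, so that disjointness of interiors makes the
    endpoints determine the tagged interval. Hence \<open>io\<close> is injective, and the family
    can be passed to absolute continuity as a set of endpoint pairs.\<close>
  define p1 where "p1 = {(x, K) \<in> p. x \<in> M \<and> Inf K < Sup K}"
  define io where "io = (\<lambda>(x::real, K::real set). (Inf K, Sup K))"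
  have p1p: "p1 \<subseteq> p" by (auto simp: p1_def)
  have fin1: "finite p1" using fin p1p finite_subset by blast
  have disj: "{Inf K<..<Sup K} \<inter> {Inf K'<..<Sup K'} = {}"
    if "(x, K) \<in> p" "(x', K') \<in> p" "(x, K) \<noteq> (x', K')" for x K x' K'
    using tagged_division_ofD(5)[OF p(1) that] K(7)[OF that(1)] K(7)[OF that(2)] by simp
  have inj: "inj_on io p1"
  proof (rule inj_onI)
    fix q q' assume q: "q \<in> p1" "q' \<in> p1" "io q = io q'"
    obtain x K x' K' where qq: "q = (x, K)" "q' = (x', K')" by (cases q, cases q') auto
    have eq: "Inf K = Inf K'" "Sup K = Sup K'" and ne: "Inf K < Sup K"
      using q by (auto simp: qq io_def p1_def)
    show "q = q'"
    proof (rule ccontr)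
      assume "q \<noteq> q'"
      then have "{Inf K<..<Sup K} \<inter> {Inf K'<..<Sup K'} = {}"
        using q p1p by (intro disj[of x K x' K']) (auto simp: qq)
      then show False using eq ne by simp
    qed
  qed
  have dfam: "disjoint_family_on (\<lambda>(x, K). {Inf K<..<Sup K}) p1"
    unfolding disjoint_family_on_def using disj p1p by fastforce
  have sumlen: "(\<Sum>(x, K)\<in>p1. Sup K - Inf K) < d"
  proof -
    have "ennreal (\<Sum>(x, K)\<in>p1. Sup K - Inf K) = (\<Sum>(x, K)\<in>p1. ennreal (Sup K - Inf K))"
      by (subst sum_ennreal[symmetric]) (auto simp: p1_def case_prod_unfold)
    also have "\<dots> = (\<Sum>q\<in>p1. emeasure lborel ((\<lambda>(x, K). {Inf K<..<Sup K}) q))"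
      by (intro sum.cong) (auto simp: p1_def)
    also have "\<dots> = emeasure lborel (\<Union>q\<in>p1. (\<lambda>(x, K). {Inf K<..<Sup K}) q)"
      using fin1 dfam by (intro sum_emeasure) auto
    also have "\<dots> \<le> emeasure lborel G"
    proof (rule emeasure_mono)
      have "{Inf K<..<Sup K} \<subseteq> G" if "(x, K) \<in> p1" for x K
      proof -
        have "(x, K) \<in> p" "x \<in> M" using that by (auto simp: p1_def)
        then have "K \<subseteq> G" using K(5) r(2) by blast
        then show ?thesis using K(7)[OF \<open>(x, K) \<in> p\<close>] interior_subset by blast
      qed
      then show "(\<Union>q\<in>p1. (\<lambda>(x, K). {Inf K<..<Sup K}) q) \<subseteq> G" by auto
    qed (use G in auto)
    also have "\<dots> < d" by (rule emG)
    finally show ?thesis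
      using d by (subst (asm) ennreal_less_iff) (auto intro!: sum_nonneg simp: p1_def)
  qed
  have small: "(\<Sum>(x, K)\<in>p1. f (Sup K) - f (Inf K)) \<le> e"
  proof -
    have "(\<Sum>(x, K)\<in>p1. f (Sup K) - f (Inf K)) \<le> (\<Sum>(x, K)\<in>p1. dist (f (Inf K)) (f (Sup K)))"
      by (intro sum_mono) (auto simp: dist_real_def)
    also have "\<dots> = (\<Sum>(u, v)\<in>io ` p1. dist (f u) (f v))"
      by (subst sum.reindex[OF inj]) (auto simp: io_def case_prod_unfold)
    also have "\<dots> < e"
    proof (rule H, intro conjI)
      show "finite (io ` p1)" using fin1 by simp
      show "\<forall>(u, v)\<in>io ` p1. u \<le> v \<and> {u..v} \<subseteq> {a..b}"
        using K(2,6) p1p by (fastforce simp: io_def p1_def)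
      show "disjoint_family_on (\<lambda>(u, v). {u<..<v}) (io ` p1)"
        unfolding disjoint_family_on_def
      proof (intro ballI impI)
        fix q q' assume "q \<in> io ` p1" "q' \<in> io ` p1" "q \<noteq> q'"
        then obtain z z' where z: "z \<in> p1" "z' \<in> p1" "z \<noteq> z'" and q: "q = io z" "q' = io z'" by auto
        have "(\<lambda>(u, v). {u<..<v}) (io w) = (\<lambda>(x, K). {Inf K<..<Sup K}) w" for w
          by (cases w) (simp add: io_def)
        then show "(\<lambda>(u, v). {u<..<v}) q \<inter> (\<lambda>(u, v). {u<..<v}) q' = {}"
          using dfam z unfolding q disjoint_family_on_def by metis
      qed
      show "(\<Sum>(u, v)\<in>io ` p1. v - u) < d"
        using sumlen by (subst sum.reindex[OF inj]) (auto simp: io_def case_prod_unfold)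
    qed
    finally show ?thesis by simp
  qed
  have sumall: "(\<Sum>(x, K)\<in>p. Sup K - Inf K) = b - a"
    using additive_tagged_division_1[OF \<open>a \<le> b\<close> p(1), of "\<lambda>x. x"] .
  have "f b - f a = (\<Sum>(x, K)\<in>p. f (Sup K) - f (Inf K))"
    using additive_tagged_division_1[OF \<open>a \<le> b\<close> p(1), of f] by simp
  also have "\<dots> = (\<Sum>(x, K)\<in>p - p1. f (Sup K) - f (Inf K)) + (\<Sum>(x, K)\<in>p1. f (Sup K) - f (Inf K))"
    by (rule sum.subset_diff[OF p1p fin])
  also have "(\<Sum>(x, K)\<in>p - p1. f (Sup K) - f (Inf K)) \<le> (\<Sum>(x, K)\<in>p - p1. e * (Sup K - Inf K))"
  proof (rule sum_mono)
    fix q assume "q \<in> p - p1"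
    then obtain x K where q: "q = (x, K)" "(x, K) \<in> p" "x \<notin> M \<or> Inf K = Sup K"
      using K(3,4) by (cases q) (force simp: p1_def)
    have "f (Sup K) - f (Inf K) \<le> e * (Sup K - Inf K)"
    proof (cases "Inf K = Sup K")
      case False
      have mem: "x \<in> K" "Inf K \<in> K" "Sup K \<in> K"
        using K(2,3,4)[OF q(2)] by (metis atLeastAtMost_iff order.trans order_refl)+
      then have "x \<in> {a..b} - M" using q(3) K(6)[OF q(2)] False by auto
      moreover note mem(2,3)
      ultimately show ?thesis using r(3)[of x "Inf K" "Sup K"] K(3,4,5)[OF q(2)] by blast
    qed simp
    then show "(case q of (x, K) \<Rightarrow> f (Sup K) - f (Inf K)) \<le> (case q of (x, K) \<Rightarrow> e * (Sup K - Inf K))"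
      by (simp add: q)
  qed
  also have "\<dots> \<le> (\<Sum>(x, K)\<in>p. e * (Sup K - Inf K))"
    using e fin K(3,4) by (intro sum_mono2) (force intro!: mult_nonneg_nonneg)+
  also have "\<dots> = e * (b - a)"
    by (simp add: sum_distrib_left case_prod_unfold flip: sumall)
  finally have "f b - f a \<le> e * (b - a) + e" using small by linarith
  then show "f b \<le> f a + e'" using ee' by linarith
qed

section \<open>Square integrable functions and the monotone cone\<close>

global_interpretation mass: finite_measure \<mm>
  by (rule finite_measure_mass)

lemma space_mass [simp]: "space \<mm> = \<Omega>"
  by (simp add: space_restrict_space)

lemma measure_mass_space [simp]: "measure \<mm> \<Omega> = 1"
  by (simp add: measure_restrict_space Omega_def)

lemma AE_mass_iff: "(AE m in \<mm>. P m) \<longleftrightarrow> (AE m in lebesgue. m \<in> \<Omega> \<longrightarrow> P m)"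
  by (subst AE_restrict_space_iff) (auto simp: Omega_def)

lemma AE_mass_ex:
  assumes "AE m in \<mm>. P m" "0 \<le> u" "u < v" "v \<le> 1"
  shows "\<exists>x. u < x \<and> x < v \<and> P x"
proof (rule ccontr)
  assume no: "\<nexists>x. u < x \<and> x < v \<and> P x"
  have "AE m in lebesgue. m \<notin> {u<..<v}"
    using assms(1)[unfolded AE_mass_iff]
    by eventually_elim (use no assms in \<open>auto simp: Omega_def\<close>)
  then have "{u<..<v} \<in> null_sets lebesgue"
    by (subst AE_iff_null_sets) auto
  then show False using assms by (simp add: null_sets_def)
qed

lemma square_integrable_const [simp]: "square_integrable \<mm> (\<lambda>_. c)"
  by (simp add: square_integrable_def)

lemma square_integrable_imp_integrable_mass: "square_integrable \<mm> f \<Longrightarrow> integrable \<mm> f"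
  using square_integrable_mult[of \<mm> f "\<lambda>_. 1"] by simp

lemma square_integrable_abs: "square_integrable M f \<Longrightarrow> square_integrable M (\<lambda>x. \<bar>f x\<bar>)"
  by (auto simp: square_integrable_def)

lemma square_integrable_mono:
  assumes "square_integrable M g" "f \<in> borel_measurable M" "AE x in M. \<bar>f x\<bar> \<le> \<bar>g x\<bar>"
  shows "square_integrable M f"
  unfolding square_integrable_def
proof
  show "integrable M (\<lambda>x. (f x)\<^sup>2)"
  proof (rule Bochner_Integration.integrable_bound)
    show "integrable M (\<lambda>x. (g x)\<^sup>2)" using assms(1) by (simp add: square_integrable_def)
    show "AE x in M. norm ((f x)\<^sup>2) \<le> norm ((g x)\<^sup>2)"
      using assms(3) by eventually_elim (simp add: abs_le_square_iff)
  qed (use assms in measurable)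
qed (use assms in simp)

lemma square_integrable_cong_AE:
  assumes "square_integrable M g" "f \<in> borel_measurable M" "AE x in M. f x = g x"
  shows "square_integrable M f"
  using assms by (auto intro: square_integrable_mono elim: eventually_mono)

lemma abs_l2_eq_iff:
  assumes "square_integrable \<mm> f" "square_integrable \<mm> g"
  shows "abs_l2 f = abs_l2 g \<longleftrightarrow> (AE m in \<mm>. f m = g m)"
  using assms Quotient3_rel[OF Quotient3_l2, of f g] by (auto simp: l2_rel_def)

lemma rep_abs_l2:
  assumes "square_integrable \<mm> f"
  shows "AE m in \<mm>. rep_l2 (abs_l2 f) m = f m"
  using abs_l2_eq_iff[OF square_integrable_rep_l2 assms, of "abs_l2 f"] by (simp add: abs_rep_l2)

lemma inner_abs_l2:
  "square_integrable \<mm> f \<Longrightarrow> square_integrable \<mm> g \<Longrightarrow> abs_l2 f \<bullet> abs_l2 g = (\<integral>m. f m * g m \<partial>\<mm>)"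
  by (simp add: inner_l2.abs_eq)

lemma norm_abs_l2_mono:
  assumes "square_integrable \<mm> f" "square_integrable \<mm> g" "AE m in \<mm>. \<bar>f m\<bar> \<le> \<bar>g m\<bar>"
  shows "norm (abs_l2 f) \<le> norm (abs_l2 g)"
proof -
  have "(\<integral>m. f m * f m \<partial>\<mm>) \<le> (\<integral>m. g m * g m \<partial>\<mm>)"
  proof (rule integral_mono_AE)
    show "AE m in \<mm>. f m * f m \<le> g m * g m"
      using assms(3) by eventually_elim (simp add: abs_le_square_iff flip: power2_eq_square)
  qed (use assms in \<open>auto intro: square_integrable_mult\<close>)
  then show ?thesis using assms by (simp add: norm_eq_sqrt_inner inner_abs_l2)
qed

lemma l2_tendsto_AE_subseq:
  assumes "Y \<longlonglongrightarrow> Z"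
  shows "\<exists>r::nat \<Rightarrow> nat. strict_mono r \<and> (AE m in \<mm>. (\<lambda>n. rep_l2 (Y (r n)) m) \<longlonglongrightarrow> rep_l2 Z m)"
proof -
  define u where "u n m = (rep_l2 (Y n) m - rep_l2 Z m)\<^sup>2" for n m
  have sq: "square_integrable \<mm> (\<lambda>m. rep_l2 (Y n) m - rep_l2 Z m)" for n
    by (intro square_integrable_diff square_integrable_rep_l2)
  have int: "integrable \<mm> (u n)" for n
    using sq[of n] by (simp add: u_def[abs_def] square_integrable_def)
  have eq: "(\<integral>m. norm (u n m) \<partial>\<mm>) = (norm (Y n - Z))\<^sup>2" for n
    using norm_abs_diff_l2[OF square_integrable_rep_l2 square_integrable_rep_l2, of "Y n" Z]
    by (simp add: abs_rep_l2 u_def)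
  have "(\<lambda>n. (norm (Y n - Z))\<^sup>2) \<longlonglongrightarrow> (norm (Z - Z))\<^sup>2"
    by (intro tendsto_intros assms)
  then have "(\<lambda>n. (\<integral>m. norm (u n m) \<partial>\<mm>)) \<longlonglongrightarrow> 0" unfolding eq by simp
  from tendsto_L1_AE_subseq[OF int this] obtain r where
    r: "strict_mono r" "AE m in \<mm>. (\<lambda>n. u (r n) m) \<longlonglongrightarrow> 0" by blast
  have "AE m in \<mm>. (\<lambda>n. rep_l2 (Y (r n)) m) \<longlonglongrightarrow> rep_l2 Z m"
    using r(2)
  proof eventually_elim
    case (elim m)
    then have "(\<lambda>n. sqrt (u (r n) m)) \<longlonglongrightarrow> sqrt 0" by (intro tendsto_intros)
    then have "(\<lambda>n. \<bar>rep_l2 (Y (r n)) m - rep_l2 Z m\<bar>) \<longlonglongrightarrow> 0" by (simp add: u_def)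
    then show ?case by (metis LIM_zero_cancel tendsto_rabs_zero_cancel)
  qed
  with r(1) show ?thesis by blast
qed

section \<open>Right-continuous representatives and the cone \<open>\<K>\<close>\<close>

lemma mono_on_imp_measurable_mass:
  fixes f :: "real \<Rightarrow> real"
  assumes "mono_on \<Omega> f"
  shows "f \<in> borel_measurable \<mm>"
proof (rule borel_measurable_subalgebra)
  show "f \<in> borel_measurable (restrict_space borel \<Omega>)"
    using assms by (rule borel_measurable_mono_on_fnc)
  show "sets (restrict_space borel \<Omega>) \<subseteq> sets \<mm>"
    unfolding sets_restrict_space by (intro image_mono) (metis sets_completionI_sets sets_lborel subsetI)
qed (simp add: space_restrict_space)

lemma monotone_repr_mono_repr: "X \<in> \<K> \<Longrightarrow> monotone_repr X (mono_repr X)"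
  using someI_ex[of "monotone_repr X"] by (simp add: Kcone_def mono_repr_def)

lemma mono_reprD:
  assumes "X \<in> \<K>"
  shows "square_integrable \<mm> (mono_repr X)" "abs_l2 (mono_repr X) = X" "mono_on \<Omega> (mono_repr X)"
    "mono_repr X \<in> borel_measurable \<mm>" "AE m in \<mm>. rep_l2 X m = mono_repr X m"
  using monotone_repr_mono_repr[OF assms] rep_abs_l2[of "mono_repr X"]
  by (auto simp: monotone_repr_def square_integrable_def)

text \<open>The representative is the right limit of \<open>f\<close> along \<open>G\<close>. At a
  continuity point of \<open>g\<close>, the value \<open>f m\<close> is squeezed between the left
  limit of \<open>g\<close> and \<open>g m\<close>, and a monotone function has countably many
  discontinuities. The set \<open>G\<close> is there because an almost everywhere limit of monotone
  functions is known to be monotone only where convergence holds.\<close>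

lemma exists_right_continuous_mono:
  fixes f :: "real \<Rightarrow> real"
  assumes G: "AE m in \<mm>. m \<in> G" and G\<Omega>: "G \<subseteq> \<Omega>" and f: "mono_on G f"
  shows "\<exists>g. mono_on \<Omega> g \<and> (\<forall>m\<in>\<Omega>. continuous (at_right m) g) \<and> (AE m in \<mm>. f m = g m)"
proof -
  define g where "g m = Inf (f ` {x\<in>G. m < x})" for m
  have dense: "\<exists>x\<in>G. u < x \<and> x < v" if "0 \<le> u" "u < v" "v \<le> 1" for u v
    using AE_mass_ex[OF G that] by blast
  have ne: "f ` {x\<in>G. m < x} \<noteq> {}" if "m \<in> \<Omega>" for m
    using dense[of m 1] that by (auto simp: Omega_def)
  have bdd: "bdd_below (f ` {x\<in>G. m < x})" if m: "m \<in> \<Omega>" for m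
  proof -
    obtain z where z: "z \<in> G" "z < m" using dense[of 0 m] m by (auto simp: Omega_def)
    show ?thesis
      using z f by (intro bdd_belowI2[of _ "f z"]) (auto intro: mono_onD)
  qed
  have g_le: "g m \<le> f x" if "m \<in> \<Omega>" "x \<in> G" "m < x" for m x
    unfolding g_def using bdd[OF that(1)] that by (intro cInf_lower) auto
  have le_g: "c \<le> g m" if "m \<in> \<Omega>" "\<And>x. x \<in> G \<Longrightarrow> m < x \<Longrightarrow> c \<le> f x" for c m
    unfolding g_def using ne[OF that(1)] that by (intro cInf_greatest) auto
  have mono: "mono_on \<Omega> g"
    by (intro mono_onI le_g g_le) auto
  have rc: "continuous (at_right m) g" if m: "m \<in> \<Omega>" for m
    unfolding continuous_within
  proof (rule order_tendstoI)
    have ev: "\<forall>\<^sub>F y in at_right m. m < y \<and> y < b" if "m < b" for b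
      using that by (auto simp: eventually_at_right_field)
    fix a assume "a < g m"
    have "m < 1" using m by (simp add: Omega_def)
    from ev[OF this] show "\<forall>\<^sub>F y in at_right m. a < g y"
    proof eventually_elim
      case (elim y)
      then have "g m \<le> g y" using m by (intro mono_onD[OF mono]) (auto simp: Omega_def)
      then show ?case using \<open>a < g m\<close> by simp
    qed
  next
    fix a assume "g m < a"
    then obtain x where x: "x \<in> G" "m < x" "f x < a"
      using cInf_lessD[OF ne[OF m], of a] by (auto simp: g_def)
    have "\<forall>\<^sub>F y in at_right m. m < y \<and> y < x"
      using x(2) by (auto simp: eventually_at_right_field)
    then show "\<forall>\<^sub>F y in at_right m. g y < a"
    proof eventually_elim
      case (elim y)
      then have "g y \<le> f x" using x m G\<Omega> by (intro g_le) (auto simp: Omega_def)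
      then show ?case using x by simp
    qed
  qed
  have eq: "f m = g m" if m: "m \<in> G" "isCont g m" for m
  proof (rule antisym)
    have m\<Omega>: "m \<in> \<Omega>" using m G\<Omega> by auto
    show "f m \<le> g m"
      using m m\<Omega> f by (intro le_g) (auto intro: mono_onD)
    show "g m \<le> f m"
    proof (rule tendsto_upperbound)
      show "(g \<longlongrightarrow> g m) (at_left m)"
        using m(2) by (simp add: isCont_def filterlim_at_split)
      have "0 < m" using m\<Omega> by (simp add: Omega_def)
      then have "\<forall>\<^sub>F y in at_left m. 0 < y \<and> y < m"
        by (auto simp: eventually_at_left_field)
      then show "\<forall>\<^sub>F y in at_left m. g y \<le> f m"
        by eventually_elim (use m m\<Omega> in \<open>auto intro!: g_le simp: Omega_def\<close>)
    qed simp
  qed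
  have "countable {a\<in>\<Omega>. \<not> isCont g a}"
    using mono by (intro mono_on_ctble_discont_open) (auto simp: Omega_def)
  then have "AE m in lebesgue. m \<notin> {a\<in>\<Omega>. \<not> isCont g a}"
    by (intro AE_completion AE_not_in countable_imp_null_set_lborel)
  then have "AE m in \<mm>. isCont g m"
    unfolding AE_mass_iff by eventually_elim auto
  with G have "AE m in \<mm>. f m = g m"
    by eventually_elim (auto intro: eq)
  then show ?thesis using mono rc by blast
qed

lemma abs_l2_in_Kcone:
  assumes sq: "square_integrable \<mm> f" and G: "AE m in \<mm>. m \<in> G" and f: "mono_on G f"
  shows "abs_l2 f \<in> \<K>"
proof -
  have "AE m in \<mm>. m \<in> G \<inter> \<Omega>"
    using G AE_space[of \<mm>] by eventually_elim auto
  moreover have "mono_on (G \<inter> \<Omega>) f" using f by (rule mono_on_subset) auto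
  ultimately obtain g where g: "mono_on \<Omega> g" "\<forall>m\<in>\<Omega>. continuous (at_right m) g" "AE m in \<mm>. f m = g m"
    using exists_right_continuous_mono[of "G \<inter> \<Omega>" f] by blast
  have sqg: "square_integrable \<mm> g"
    using g(3) by (intro square_integrable_cong_AE[OF sq mono_on_imp_measurable_mass[OF g(1)]])
      (auto elim: eventually_mono)
  moreover have "abs_l2 g = abs_l2 f"
    using g(3) by (simp add: abs_l2_eq_iff sq sqg eq_commute)
  ultimately show ?thesis
    using g by (auto simp: Kcone_def monotone_repr_def)
qed

lemma abs_l2_in_Kcone': "square_integrable \<mm> f \<Longrightarrow> mono_on \<Omega> f \<Longrightarrow> abs_l2 f \<in> \<K>"
  using AE_space[of \<mm>] by (intro abs_l2_in_Kcone[of f \<Omega>]) auto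

lemma Kcone_add: "X \<in> \<K> \<Longrightarrow> Y \<in> \<K> \<Longrightarrow> X + Y \<in> \<K>"
proof -
  assume X: "X \<in> \<K>" and Y: "Y \<in> \<K>"
  note XY = mono_reprD[OF X] mono_reprD[OF Y]
  have "abs_l2 (\<lambda>m. mono_repr X m + mono_repr Y m) \<in> \<K>"
    using XY by (intro abs_l2_in_Kcone' square_integrable_add)
      (auto intro!: mono_onI add_mono dest: mono_onD)
  also have "abs_l2 (\<lambda>m. mono_repr X m + mono_repr Y m) = abs_l2 (mono_repr X) + abs_l2 (mono_repr Y)"
    using XY by (subst plus_l2.abs_eq) auto
  finally show ?thesis using XY by simp
qed

lemma Kcone_scaleR: "X \<in> \<K> \<Longrightarrow> 0 \<le> c \<Longrightarrow> c *\<^sub>R X \<in> \<K>"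
proof -
  assume X: "X \<in> \<K>" and c: "0 \<le> c"
  note X = mono_reprD[OF X]
  have "abs_l2 (\<lambda>m. c * mono_repr X m) \<in> \<K>"
    using X c by (intro abs_l2_in_Kcone' square_integrable_scale)
      (auto intro!: mono_onI mult_left_mono dest: mono_onD)
  also have "abs_l2 (\<lambda>m. c * mono_repr X m) = c *\<^sub>R abs_l2 (mono_repr X)"
    using X by (subst scaleR_l2.abs_eq) auto
  finally show ?thesis using X by simp
qed

lemma Kcone_const: "abs_l2 (\<lambda>_. c) \<in> \<K>"
  by (intro abs_l2_in_Kcone') (auto intro: mono_onI)

lemma Kcone_0: "0 \<in> \<K>"
  using Kcone_const[of 0] by (simp add: zero_l2_def)

lemma convex_Kcone: "convex \<K>"
  by (auto simp: convex_def intro: Kcone_add Kcone_scaleR)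

lemma closed_Kcone: "closed \<K>"
  unfolding closed_sequential_limits
proof (intro allI impI)
  fix Y Z assume "(\<forall>n. Y n \<in> \<K>) \<and> Y \<longlonglongrightarrow> Z"
  then have Y: "\<And>n. Y n \<in> \<K>" and lim: "Y \<longlonglongrightarrow> Z" by auto
  obtain r :: "nat \<Rightarrow> nat" where r: "AE m in \<mm>. (\<lambda>n. rep_l2 (Y (r n)) m) \<longlonglongrightarrow> rep_l2 Z m"
    using l2_tendsto_AE_subseq[OF lim] by blast
  define G where "G = {m \<in> \<Omega>. (\<lambda>n. mono_repr (Y (r n)) m) \<longlonglongrightarrow> rep_l2 Z m}"
  have "AE m in \<mm>. \<forall>n. rep_l2 (Y n) m = mono_repr (Y n) m"
    using mono_reprD(5)[OF Y] by (simp add: AE_all_countable)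
  with r AE_space have "AE m in \<mm>. m \<in> G"
    by eventually_elim (simp add: G_def)
  moreover have "mono_on G (rep_l2 Z)"
  proof (rule mono_onI)
    fix x y assume xy: "x \<in> G" "y \<in> G" "x \<le> y"
    then have "mono_repr (Y (r n)) x \<le> mono_repr (Y (r n)) y" for n
      using mono_reprD(3)[OF Y] by (auto simp: G_def intro: mono_onD)
    then show "rep_l2 Z x \<le> rep_l2 Z y"
      using xy by (intro LIMSEQ_le[of _ "rep_l2 Z x"]) (auto simp: G_def)
  qed
  ultimately have "abs_l2 (rep_l2 Z) \<in> \<K>"
    by (intro abs_l2_in_Kcone square_integrable_rep_l2)
  then show "Z \<in> \<K>" by (simp add: abs_rep_l2)
qed

text \<open>For a convex cone the variational inequality splits: the test point \<open>X + Y\<close>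
  gives nonpositivity on \<open>\<K>\<close>, in particular at \<open>X\<close>, and the test point
  \<open>0\<close> gives the reverse inequality there.\<close>

lemma mem_subdiff_K_iff:
  assumes "X \<in> \<K>"
  shows "W \<in> subdiff_K X \<longleftrightarrow> (\<forall>Y\<in>\<K>. W \<bullet> Y \<le> 0) \<and> W \<bullet> X = 0"
proof
  assume W: "W \<in> subdiff_K X"
  then have le: "W \<bullet> (Y - X) \<le> 0" if "Y \<in> \<K>" for Y using that by (auto simp: subdiff_K_def)
  have "W \<bullet> Y \<le> 0" if "Y \<in> \<K>" for Y
    using le[OF Kcone_add[OF assms that]] by simp
  moreover have "W \<bullet> X \<ge> 0" using le[OF Kcone_0] by simp
  ultimately show "(\<forall>Y\<in>\<K>. W \<bullet> Y \<le> 0) \<and> W \<bullet> X = 0" using assms by (auto intro: antisym)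
qed (auto simp: subdiff_K_def inner_diff_right)

section \<open>Functions that are constant on the flat parts\<close>

lemma Omega_flat_antimono_Hspace: "Omega_flat X \<subseteq> Omega_flat Y \<Longrightarrow> Hspace Y \<subseteq> Hspace X"
  unfolding Hspace_def by blast

lemma convex_level_set:
  fixes f :: "real \<Rightarrow> real"
  assumes "mono_on \<Omega> f"
  shows "convex {m\<in>\<Omega>. f m = (y::real)}"
proof -
  have "f x = y" if "f a = y" "f b = y" "a \<in> \<Omega>" "b \<in> \<Omega>" "a \<le> x" "x \<le> b" for a b x
  proof -
    have "x \<in> \<Omega>" using that by (auto simp: Omega_def)
    then show ?thesis using that mono_onD[OF assms, of a x] mono_onD[OF assms, of x b] by auto
  qed
  then show ?thesis
    by (auto simp flip: is_interval_convex_1 simp: is_interval_1 Omega_def)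
qed

text \<open>Trades intervals inside the flat set for level sets of \<open>mono_repr X\<close>, on
  which averages can be formed. A level set is convex, its interior is a flat interval and its
  frontier is null; conversely, a locally constant function is constant on a connected set.\<close>

lemma Hspace_iff:
  assumes "X \<in> \<K>"
  shows "U \<in> Hspace X \<longleftrightarrow> (\<forall>y. \<exists>c. AE m in \<mm>. mono_repr X m = y \<longrightarrow> rep_l2 U m = c)"
proof
  note X = mono_reprD[OF assms]
  assume U: "U \<in> Hspace X"
  show "\<forall>y. \<exists>c. AE m in \<mm>. mono_repr X m = y \<longrightarrow> rep_l2 U m = c"
  proof
    fix y
    define L where "L = {m\<in>\<Omega>. mono_repr X m = y}"
    have cL: "convex L" unfolding L_def by (rule convex_level_set[OF X(3)])
    have "interior L \<subseteq> Omega_flat X"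
    proof
      fix m assume m: "m \<in> interior L"
      then obtain e where e: "e > 0" "ball m e \<subseteq> L" by (auto simp: mem_interior)
      then have "m \<in> L" by auto
      have "mono_repr X constant_on ball m e"
        unfolding constant_on_def using e(2) by (intro exI[of _ y]) (auto simp: L_def)
      then show "m \<in> Omega_flat X"
        using e \<open>m \<in> L\<close> unfolding Omega_flat_def L_def by blast
    qed
    moreover have "is_interval (interior L)"
      using cL by (simp add: is_interval_convex_1 convex_interior)
    ultimately obtain c where c: "AE m in \<mm>. m \<in> interior L \<longrightarrow> rep_l2 U m = c"
      using U by (auto simp: Hspace_def)
    have "AE m in lebesgue. m \<notin> frontier L"
      using negligible_convex_frontier[OF cL] by (intro AE_not_in) (simp add: negligible_iff_null_sets)
    then have "AE m in \<mm>. m \<notin> frontier L"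
      unfolding AE_mass_iff by eventually_elim auto
    with c AE_space have "AE m in \<mm>. mono_repr X m = y \<longrightarrow> rep_l2 U m = c"
    proof eventually_elim
      case (elim m)
      have "m \<in> interior L" if "mono_repr X m = y"
        using elim that closure_subset[of L] by (auto simp: frontier_def L_def)
      then show ?case using elim by auto
    qed
    then show "\<exists>c. AE m in \<mm>. mono_repr X m = y \<longrightarrow> rep_l2 U m = c" by blast
  qed
next
  assume U: "\<forall>y. \<exists>c. AE m in \<mm>. mono_repr X m = y \<longrightarrow> rep_l2 U m = c"
  show "U \<in> Hspace X"
    unfolding Hspace_def mem_Collect_eq
  proof (intro allI impI)
    fix I assume I: "is_interval I \<and> I \<subseteq> Omega_flat X"
    then have con: "connected I" by (simp add: is_interval_connected_1)
    have const: "mono_repr X a = mono_repr X b" if "a \<in> I" "b \<in> I" for a b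
    proof (rule connected_local_const[OF con that])
      show "\<forall>a\<in>I. \<forall>\<^sub>F b in at a within I. mono_repr X a = mono_repr X b"
      proof
        fix a assume "a \<in> I"
        then obtain e where "e > 0" "mono_repr X constant_on ball a e"
          using I by (auto simp: Omega_flat_def)
        then have "\<forall>b\<in>I. b \<noteq> a \<and> dist b a < e \<longrightarrow> mono_repr X a = mono_repr X b"
          by (auto simp: constant_on_def dist_commute)
        then show "\<forall>\<^sub>F b in at a within I. mono_repr X a = mono_repr X b"
          using \<open>e > 0\<close> unfolding eventually_at by blast
      qed
    qed
    show "\<exists>c. AE m in \<mm>. m \<in> I \<longrightarrow> rep_l2 U m = c"
    proof (cases "I = {}")
      case False
      then obtain a where a: "a \<in> I" by auto
      obtain c where "AE m in \<mm>. mono_repr X m = mono_repr X a \<longrightarrow> rep_l2 U m = c"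
        using U by blast
      then have "AE m in \<mm>. m \<in> I \<longrightarrow> rep_l2 U m = c"
        by eventually_elim (use const a in blast)
      then show ?thesis by blast
    qed simp
  qed
qed

lemma abs_l2_in_Hspace:
  assumes "X \<in> \<K>" "square_integrable \<mm> (\<lambda>m. u (mono_repr X m))"
  shows "abs_l2 (\<lambda>m. u (mono_repr X m)) \<in> Hspace X"
  unfolding Hspace_iff[OF assms(1)]
proof
  fix y
  have "AE m in \<mm>. mono_repr X m = y \<longrightarrow> rep_l2 (abs_l2 (\<lambda>m. u (mono_repr X m))) m = u y"
    using rep_abs_l2[OF assms(2)] by eventually_elim auto
  then show "\<exists>c. AE m in \<mm>. mono_repr X m = y \<longrightarrow> rep_l2 (abs_l2 (\<lambda>m. u (mono_repr X m))) m = c" ..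
qed

lemma self_in_Hspace: "X \<in> \<K> \<Longrightarrow> X \<in> Hspace X"
  using abs_l2_in_Hspace[of X "\<lambda>x. x"] mono_reprD[of X] by simp

text \<open>Turns membership in a function space into stickiness. Monotonicity upgrades almost
  everywhere constancy to constancy: every point of the ball lies between two points at which
  \<open>mono_repr Y\<close> takes the value \<open>c\<close>.\<close>

lemma Omega_flat_mono_Hspace:
  assumes X: "X \<in> \<K>" and Y: "Y \<in> \<K>" and YX: "Y \<in> Hspace X"
  shows "Omega_flat X \<subseteq> Omega_flat Y"
proof
  fix m assume "m \<in> Omega_flat X"
  then obtain e y where m: "m \<in> \<Omega>" and e: "e > 0" "ball m e \<subseteq> \<Omega>"
    and y: "\<And>x. x \<in> ball m e \<Longrightarrow> mono_repr X x = y"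
    by (auto simp: Omega_flat_def constant_on_def)
  obtain c where "AE m in \<mm>. mono_repr X m = y \<longrightarrow> rep_l2 Y m = c"
    using YX unfolding Hspace_iff[OF X] by blast
  with mono_reprD(5)[OF Y] have ae: "AE x in \<mm>. x \<in> ball m e \<longrightarrow> mono_repr Y x = c"
    by eventually_elim (use y in auto)
  have "mono_repr Y x = c" if x: "x \<in> ball m e" for x
  proof -
    have sub: "{m - e<..<m + e} \<subseteq> \<Omega>" using e(2) by (simp add: ball_eq_greaterThanLessThan)
    have x': "m - e < x" "x < m + e" using x by (auto simp: dist_real_def)
    have bd: "0 \<le> m - e" "m + e \<le> 1"
      using sub e(1) by (auto simp: Omega_def greaterThanLessThan_subseteq_greaterThanLessThan)
    obtain p q where p: "m - e < p" "p < x" "p \<in> ball m e \<longrightarrow> mono_repr Y p = c"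
      and q: "x < q" "q < m + e" "q \<in> ball m e \<longrightarrow> mono_repr Y q = c"
      using AE_mass_ex[OF ae, of "m - e" x] AE_mass_ex[OF ae, of x "m + e"] x' bd by auto
    have "p \<in> ball m e" "q \<in> ball m e" using p q x' by (auto simp: dist_real_def)
    then show ?thesis
      using p q e(2) x mono_onD[OF mono_reprD(3)[OF Y], of p x] mono_onD[OF mono_reprD(3)[OF Y], of x q]
      by (force intro: antisym)
  qed
  then show "m \<in> Omega_flat Y" using m e by (auto simp: Omega_flat_def constant_on_def)
qed

section \<open>Averaging over a single level set\<close>

definition level_average :: "l2 \<Rightarrow> real \<Rightarrow> l2 \<Rightarrow> real" where
  "level_average X y U = (\<integral>m. (if mono_repr X m = y then rep_l2 U m else 0) \<partial>\<mm>) / measure \<mm> {m\<in>\<Omega>. mono_repr X m = y}"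

text \<open>What averaging removes: \<open>U - level_deviation X y U\<close> is the mean of
  \<open>U\<close> on the level set and \<open>U\<close> elsewhere. On a null level set the mean is
  a quotient by 0, hence 0, and the deviation vanishes as an element of \<open>l2\<close>.\<close>

definition level_deviation :: "l2 \<Rightarrow> real \<Rightarrow> l2 \<Rightarrow> l2" where
  "level_deviation X y U = abs_l2 (\<lambda>m. if mono_repr X m = y then rep_l2 U m - level_average X y U else 0)"

context
  fixes X :: l2 and y :: real
  assumes X: "X \<in> \<K>"
begin

private definition dv where
  "dv U m = (if mono_repr X m = y then rep_l2 U m - level_average X y U else 0)"

private lemma meas [measurable]: "mono_repr X \<in> borel_measurable \<mm>" "rep_l2 U \<in> borel_measurable \<mm>"
  using mono_reprD(4)[OF X] square_integrable_rep_l2[of U] by (auto simp: square_integrable_def)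

private lemma level_sets: "{m\<in>\<Omega>. mono_repr X m = y} \<in> sets \<mm>"
proof -
  have "{m\<in>space \<mm>. mono_repr X m = y} \<in> sets \<mm>" by measurable
  then show ?thesis by simp
qed

private lemma sq_dv: "square_integrable \<mm> (dv U)"
proof (rule square_integrable_mono)
  show "square_integrable \<mm> (\<lambda>m. rep_l2 U m - level_average X y U)"
    by (intro square_integrable_diff square_integrable_rep_l2 square_integrable_const)
  show "dv U \<in> borel_measurable \<mm>" unfolding dv_def by measurable
qed (simp add: dv_def)

private lemma meas_dv [measurable]: "dv U \<in> borel_measurable \<mm>"
  using sq_dv[of U] by (simp add: square_integrable_def)

private lemma dev_eq: "level_deviation X y U = abs_l2 (dv U)"
  by (simp add: level_deviation_def dv_def[abs_def])

private lemma sq_part: "square_integrable \<mm> (\<lambda>m. if mono_repr X m = y then rep_l2 U m else 0)"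
  by (rule square_integrable_mono[OF square_integrable_rep_l2[of U]]) auto

private lemma int_dv: "integral\<^sup>L \<mm> (dv U) = 0"
proof -
  let ?L = "{m\<in>\<Omega>. mono_repr X m = y}"
  have "integral\<^sup>L \<mm> (dv U) = (\<integral>m. (if mono_repr X m = y then rep_l2 U m else 0) - level_average X y U * indicator ?L m \<partial>\<mm>)"
    by (rule Bochner_Integration.integral_cong) (auto simp: dv_def)
  also have "\<dots> = (\<integral>m. (if mono_repr X m = y then rep_l2 U m else 0) \<partial>\<mm>) - level_average X y U * measure \<mm> ?L"
    using square_integrable_imp_integrable_mass[OF sq_part[of U]] level_sets
    by (subst Bochner_Integration.integral_diff) (auto simp: mass.emeasure_finite[unfolded less_top] Int_absorb2)
  also have "\<dots> = 0"
  proof (cases "measure \<mm> ?L = 0")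
    case True
    then have "?L \<in> null_sets \<mm>"
      using level_sets by (simp add: null_sets_def mass.emeasure_eq_measure)
    then have "AE m in \<mm>. m \<notin> ?L" by (rule AE_not_in)
    with AE_space have "AE m in \<mm>. (if mono_repr X m = y then rep_l2 U m else 0) = 0"
      by eventually_elim auto
    then show ?thesis using True by (simp add: integral_eq_zero_AE)
  qed (simp add: level_average_def)
  finally show ?thesis .
qed

lemma inner_level_deviation_Hspace:
  assumes "V \<in> Hspace X"
  shows "V \<bullet> level_deviation X y U = 0"
proof -
  obtain c where c: "AE m in \<mm>. mono_repr X m = y \<longrightarrow> rep_l2 V m = c"
    using assms unfolding Hspace_iff[OF X] by blast
  have "V \<bullet> level_deviation X y U = (\<integral>m. rep_l2 V m * dv U m \<partial>\<mm>)"
    using inner_abs_l2[OF square_integrable_rep_l2 sq_dv] by (simp add: dev_eq abs_rep_l2)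
  also have "\<dots> = (\<integral>m. c * dv U m \<partial>\<mm>)"
  proof (rule integral_cong_AE)
    show "AE m in \<mm>. rep_l2 V m * dv U m = c * dv U m"
      using c by eventually_elim (auto simp: dv_def)
  qed measurable
  finally show ?thesis by (simp add: int_dv)
qed

text \<open>Averaging is an orthogonal projection: on the level set, \<open>U\<close> minus the
  deviation is the constant mean; off it the deviation is zero; and the deviation has integral
  zero.\<close>

lemma inner_level_deviation_self:
  "U \<bullet> level_deviation X y U = level_deviation X y U \<bullet> level_deviation X y U"
proof -
  have "(U - level_deviation X y U) \<bullet> level_deviation X y U
      = (\<integral>m. (rep_l2 U m - dv U m) * dv U m \<partial>\<mm>)"
    using inner_abs_l2[OF square_integrable_diff[OF square_integrable_rep_l2[of U] sq_dv[of U]] sq_dv]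
    by (subst (asm) minus_l2.abs_eq[symmetric])
      (auto simp: dev_eq abs_rep_l2 sq_dv square_integrable_rep_l2)
  also have "\<dots> = (\<integral>m. level_average X y U * dv U m \<partial>\<mm>)"
    by (rule Bochner_Integration.integral_cong) (auto simp: dv_def)
  finally show ?thesis by (simp add: int_dv inner_diff_left)
qed

lemma level_deviation_eq_0D:
  assumes "level_deviation X y U = 0"
  shows "AE m in \<mm>. mono_repr X m = y \<longrightarrow> rep_l2 U m = level_average X y U"
proof -
  have "abs_l2 (dv U) = abs_l2 (\<lambda>_. 0)"
    using assms by (simp add: dev_eq zero_l2_def)
  then have "AE m in \<mm>. dv U m = 0"
    by (subst (asm) abs_l2_eq_iff[OF sq_dv]) auto
  then show ?thesis
    by eventually_elim (auto simp: dv_def split: if_splits)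
qed

private lemma null_level:
  assumes "measure \<mm> {m\<in>\<Omega>. mono_repr X m = y} = 0"
  shows "level_deviation X y U = 0"
proof -
  have "{m\<in>\<Omega>. mono_repr X m = y} \<in> null_sets \<mm>"
    using level_sets assms by (simp add: null_sets_def mass.emeasure_eq_measure)
  then have "AE m in \<mm>. m \<notin> {m\<in>\<Omega>. mono_repr X m = y}" by (rule AE_not_in)
  with AE_space have "AE m in \<mm>. dv U m = 0" by eventually_elim (auto simp: dv_def)
  then show ?thesis
    unfolding dev_eq zero_l2_def by (subst abs_l2_eq_iff[OF sq_dv]) auto
qed

private lemma average_bounds:
  assumes pos: "measure \<mm> {m\<in>\<Omega>. mono_repr X m = y} > 0"
    and z: "AE m in \<mm>. rep_l2 Z m = z m"
  shows "(\<And>m. m \<in> \<Omega> \<Longrightarrow> mono_repr X m = y \<Longrightarrow> k \<le> z m) \<Longrightarrow> k \<le> level_average X y Z"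
    and "(\<And>m. m \<in> \<Omega> \<Longrightarrow> mono_repr X m = y \<Longrightarrow> z m \<le> k) \<Longrightarrow> level_average X y Z \<le> k"
proof -
  let ?L = "{m\<in>\<Omega>. mono_repr X m = y}"
  have int: "integrable \<mm> (\<lambda>m. if mono_repr X m = y then rep_l2 Z m else 0)"
    by (rule square_integrable_imp_integrable_mass[OF sq_part])
  have ik: "integrable \<mm> (\<lambda>m. k * indicator ?L m)" "(\<integral>m. k * indicator ?L m \<partial>\<mm>) = k * measure \<mm> ?L"
    using level_sets by (auto simp: mass.emeasure_finite[unfolded less_top] Int_absorb2)
  {
    assume k: "\<And>m. m \<in> \<Omega> \<Longrightarrow> mono_repr X m = y \<Longrightarrow> k \<le> z m"
    have "(\<integral>m. k * indicator ?L m \<partial>\<mm>) \<le> (\<integral>m. (if mono_repr X m = y then rep_l2 Z m else 0) \<partial>\<mm>)"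
    proof (rule integral_mono_AE[OF ik(1) int])
      show "AE m in \<mm>. k * indicator ?L m \<le> (if mono_repr X m = y then rep_l2 Z m else 0)"
        using z AE_space by eventually_elim (use k in \<open>auto simp: indicator_def\<close>)
    qed
    then show "k \<le> level_average X y Z"
      using pos unfolding ik(2) by (simp add: level_average_def pos_le_divide_eq)
  }
  {
    assume k: "\<And>m. m \<in> \<Omega> \<Longrightarrow> mono_repr X m = y \<Longrightarrow> z m \<le> k"
    have "(\<integral>m. (if mono_repr X m = y then rep_l2 Z m else 0) \<partial>\<mm>) \<le> (\<integral>m. k * indicator ?L m \<partial>\<mm>)"
    proof (rule integral_mono_AE[OF int ik(1)])
      show "AE m in \<mm>. (if mono_repr X m = y then rep_l2 Z m else 0) \<le> k * indicator ?L m"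
        using z AE_space by eventually_elim (use k in \<open>auto simp: indicator_def\<close>)
    qed
    then show "level_average X y Z \<le> k"
      using pos unfolding ik(2) by (simp add: level_average_def pos_divide_le_eq)
  }
qed

text \<open>A point outside the level set lies wholly before or wholly after it, so the value of
  \<open>Z\<close> there bounds all values on the level set from below or above, and hence their
  mean too.\<close>

lemma level_averaging_Kcone:
  assumes Z: "Z \<in> \<K>"
  shows "Z - level_deviation X y Z \<in> \<K>"
proof (cases "measure \<mm> {m\<in>\<Omega>. mono_repr X m = y} = 0")
  case True
  then show ?thesis using Z by (simp add: null_level)
next
  case False
  then have pos: "measure \<mm> {m\<in>\<Omega>. mono_repr X m = y} > 0"
    by (simp add: zero_less_measure_iff)
  note z = mono_reprD[OF Z]
  define c where "c = level_average X y Z"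
  define g where "g m = (if mono_repr X m = y then c else mono_repr Z m)" for m
  have "Z - level_deviation X y Z = abs_l2 (\<lambda>m. rep_l2 Z m - dv Z m)"
    by (subst minus_l2.abs_eq[symmetric]) (auto simp: dev_eq abs_rep_l2 sq_dv square_integrable_rep_l2)
  moreover have sqg: "square_integrable \<mm> g"
  proof (rule square_integrable_mono)
    show "square_integrable \<mm> (\<lambda>m. \<bar>mono_repr Z m\<bar> + \<bar>c\<bar>)"
      by (intro square_integrable_add square_integrable_abs z square_integrable_const)
    show "g \<in> borel_measurable \<mm>" unfolding g_def using z(4) by measurable
  qed (auto simp: g_def)
  moreover have "abs_l2 (\<lambda>m. rep_l2 Z m - dv Z m) = abs_l2 g"
  proof (subst abs_l2_eq_iff)
    show "AE m in \<mm>. rep_l2 Z m - dv Z m = g m"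
      using z(5) by eventually_elim (auto simp: g_def dv_def c_def)
  qed (use sqg in \<open>auto intro: square_integrable_diff square_integrable_rep_l2 sq_dv\<close>)
  moreover have "mono_on \<Omega> g"
  proof (rule mono_onI)
    fix s t assume st: "s \<in> \<Omega>" "t \<in> \<Omega>" "s \<le> t"
    have f: "mono_repr X s \<le> mono_repr X t" "mono_repr Z s \<le> mono_repr Z t"
      using st mono_onD[OF mono_reprD(3)[OF X]] mono_onD[OF z(3)] by auto
    have lt: "m < m'" if "mono_repr X m < mono_repr X m'" "m \<in> \<Omega>" "m' \<in> \<Omega>" for m m'
      using that mono_onD[OF mono_reprD(3)[OF X], of m' m] by (meson linorder_not_le)
    show "g s \<le> g t"
    proof (cases "mono_repr X s = y"; cases "mono_repr X t = y")
      assume a: "mono_repr X s \<noteq> y" "mono_repr X t = y"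
      have "mono_repr Z s \<le> c"
        unfolding c_def
      proof (rule average_bounds(1)[OF pos z(5)])
        fix m assume "m \<in> \<Omega>" "mono_repr X m = y"
        then show "mono_repr Z s \<le> mono_repr Z m"
          using lt[of s m] a f st by (intro mono_onD[OF z(3)]) auto
      qed
      then show ?thesis using a by (simp add: g_def)
    next
      assume a: "mono_repr X s = y" "mono_repr X t \<noteq> y"
      have "c \<le> mono_repr Z t"
        unfolding c_def
      proof (rule average_bounds(2)[OF pos z(5)])
        fix m assume "m \<in> \<Omega>" "mono_repr X m = y"
        then show "mono_repr Z m \<le> mono_repr Z t"
          using lt[of m t] a f st by (intro mono_onD[OF z(3)]) auto
      qed
      then show ?thesis using a by (simp add: g_def)
    qed (use f in \<open>auto simp: g_def\<close>)
  qed
  ultimately show ?thesis using abs_l2_in_Kcone' by simp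
qed

text \<open>Chebyshev's inequality: on the level set, \<open>Z - level_average X y Z\<close> changes sign once, at a
  point where the nondecreasing function \<open>Z'\<close> crosses the constant \<open>k\<close>.\<close>

lemma inner_level_deviation_nonneg:
  assumes Z: "Z \<in> \<K>" and Z': "Z' \<in> \<K>"
  shows "0 \<le> Z' \<bullet> level_deviation X y Z"
proof -
  note z = mono_reprD[OF Z] and z' = mono_reprD[OF Z']
  define c where "c = level_average X y Z"
  define D where "D m = (if mono_repr X m = y then mono_repr Z m - c else 0)" for m
  have D_dv: "AE m in \<mm>. dv Z m = D m"
    using z(5) by eventually_elim (auto simp: D_def dv_def c_def)
  have measD [measurable]: "D \<in> borel_measurable \<mm>" unfolding D_def using z(4) by measurable
  have sqD: "square_integrable \<mm> D"
    using D_dv by (intro square_integrable_cong_AE[OF sq_dv[of Z] measD]) (simp add: eq_commute)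
  have intD: "integral\<^sup>L \<mm> D = 0"
    using integral_cong_AE[OF meas_dv measD D_dv] int_dv by simp
  have eq: "Z' \<bullet> level_deviation X y Z = (\<integral>m. mono_repr Z' m * D m \<partial>\<mm>)"
  proof -
    have "level_deviation X y Z = abs_l2 D"
      unfolding dev_eq using D_dv by (simp add: abs_l2_eq_iff sq_dv sqD)
    then show ?thesis using inner_abs_l2[OF z'(1) sqD] z'(2) by simp
  qed
  show ?thesis
  proof (cases "(\<exists>a\<in>\<Omega>. D a < 0) \<and> (\<exists>b\<in>\<Omega>. 0 < D b)")
    case True
    then obtain a0 b0 where a0: "a0 \<in> \<Omega>" "D a0 < 0" and b0: "b0 \<in> \<Omega>" "0 < D b0" by blast
    have le: "mono_repr Z' a \<le> mono_repr Z' b" if "a \<in> \<Omega>" "b \<in> \<Omega>" "D a < 0" "0 < D b" for a b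
    proof -
      have "mono_repr Z a < mono_repr Z b" using that by (auto simp: D_def split: if_splits)
      then have "a \<le> b" using that mono_onD[OF z(3), of b a] by (meson linorder_not_le less_imp_le)
      then show ?thesis using that by (intro mono_onD[OF z'(3)]) auto
    qed
    define k where "k = Sup (mono_repr Z' ` {a\<in>\<Omega>. D a < 0})"
    have k1: "mono_repr Z' a \<le> k" if "a \<in> \<Omega>" "D a < 0" for a
      unfolding k_def using that le[OF _ b0(1) _ b0(2)]
      by (intro cSup_upper bdd_aboveI2[of _ _ "mono_repr Z' b0"]) auto
    have k2: "k \<le> mono_repr Z' b" if "b \<in> \<Omega>" "0 < D b" for b
      unfolding k_def using that le a0 by (intro cSup_least) auto
    have "0 \<le> (\<integral>m. (mono_repr Z' m - k) * D m \<partial>\<mm>)"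
    proof (rule integral_nonneg_AE)
      show "AE m in \<mm>. 0 \<le> (mono_repr Z' m - k) * D m"
        using AE_space
      proof eventually_elim
        case (elim m)
        then show ?case using k1[of m] k2[of m]
          by (cases "D m" "0::real" rule: linorder_cases) (auto intro: mult_nonpos_nonpos)
      qed
    qed
    also have "\<dots> = (\<integral>m. mono_repr Z' m * D m - k * D m \<partial>\<mm>)"
      by (simp add: left_diff_distrib)
    also have "\<dots> = (\<integral>m. mono_repr Z' m * D m \<partial>\<mm>)"
      using square_integrable_mult[OF z'(1) sqD] square_integrable_imp_integrable_mass[OF sqD] intD
      by (subst Bochner_Integration.integral_diff) auto
    finally show ?thesis by (simp add: eq)
  next
    case False
    \<comment> \<open>If \<open>D\<close> does not take both signs, having integral zero it vanishes
      almost everywhere.\<close>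
    have "AE m in \<mm>. D m = 0"
    proof (cases "\<exists>a\<in>\<Omega>. D a < 0")
      case True
      then have "AE m in \<mm>. 0 \<le> - D m" using False AE_space by (auto simp: not_less)
      then show ?thesis
        using integral_nonneg_eq_0_iff_AE[of \<mm> "\<lambda>m. - D m"] square_integrable_imp_integrable_mass[OF sqD] intD
        by simp
    next
      case False
      then have "AE m in \<mm>. 0 \<le> D m" using AE_space by (auto simp: not_less)
      then show ?thesis
        using integral_nonneg_eq_0_iff_AE[of \<mm> D] square_integrable_imp_integrable_mass[OF sqD] intD
        by simp
    qed
    then have "AE m in \<mm>. mono_repr Z' m * D m = 0" by eventually_elim simp
    then show ?thesis by (simp add: eq integral_eq_zero_AE)
  qed
qed

end

text \<open>An element orthogonal to its own deviations has none, by
  \<open>inner_level_deviation_self\<close>. Being an orthogonal complement, \<open>Hspace X\<close>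
  is then visibly a closed subspace.\<close>

lemma Hspace_eq_orthogonal:
  assumes "X \<in> \<K>"
  shows "Hspace X = {U. \<forall>y V. U \<bullet> level_deviation X y V = 0}"
proof (intro set_eqI iffI CollectI)
  fix U assume "U \<in> {U. \<forall>y V. U \<bullet> level_deviation X y V = 0}"
  then have "U \<bullet> level_deviation X y U = 0" for y by simp
  then have "level_deviation X y U = 0" for y
    unfolding inner_level_deviation_self[OF assms] by simp
  then show "U \<in> Hspace X"
    unfolding Hspace_iff[OF assms] using level_deviation_eq_0D[OF assms] by blast
next
  fix U assume "U \<in> Hspace X"
  then show "\<forall>y V. U \<bullet> level_deviation X y V = 0"
    by (intro allI inner_level_deviation_Hspace[OF assms])
qed

lemma subspace_Hspace: "X \<in> \<K> \<Longrightarrow> subspace (Hspace X)"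
  unfolding subspace_def Hspace_eq_orthogonal by (simp add: inner_add_left)

lemma closed_Hspace:
  assumes "X \<in> \<K>"
  shows "closed (Hspace X)"
proof -
  have "Hspace X = (\<Inter>y. \<Inter>V. {U. U \<bullet> level_deviation X y V = 0})"
    using Hspace_eq_orthogonal[OF assms] by auto
  moreover have "closed \<dots>"
    by (intro closed_INT ballI closed_Collect_eq continuous_intros)
  ultimately show ?thesis by simp
qed

text \<open>The projection of \<open>Z\<close> is the element of least norm among all \<open>Y \<in> \<K>\<close> that pass for a
  projection when tested against \<open>\<K>\<close> and \<open>Hspace X\<close>: averaging \<open>Y\<close> over a level set of \<open>X\<close> gives
  another such element, of strictly smaller norm unless \<open>Y\<close> was already constant there.\<close>

lemma metric_proj_Hspace_Kcone:
  assumes X: "X \<in> \<K>" and Z: "Z \<in> \<K>"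
  shows "metric_proj (Hspace X) Z \<in> \<K>" "\<And>Z'. Z' \<in> \<K> \<Longrightarrow> 0 \<le> Z' \<bullet> (Z - metric_proj (Hspace X) Z)"
proof -
  define C where "C = \<K> \<inter> (\<Inter>Z'\<in>\<K>. {Y. Z' \<bullet> Y \<le> Z' \<bullet> Z}) \<inter> (\<Inter>h\<in>Hspace X. {Y. h \<bullet> Y = h \<bullet> Z})"
  have "closed C"
    unfolding C_def
    by (intro closed_Int closed_INT ballI closed_Collect_le closed_Collect_eq closed_Kcone continuous_intros)
  moreover have "convex C"
    unfolding C_def
    by (intro convex_Int convex_INT convex_Kcone convex_halfspace_le convex_hyperplane)
  moreover have "C \<noteq> {}" using Z by (auto simp: C_def)
  ultimately have "\<exists>Y\<in>C. \<forall>Y'\<in>C. norm Y \<le> norm Y'"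
    by (rule exists_min_norm)
  then obtain Y where Y: "Y \<in> C" and min: "\<And>Y'. Y' \<in> C \<Longrightarrow> norm Y \<le> norm Y'"
    by blast
  have YK: "Y \<in> \<K>" and Ytest: "\<And>Z'. Z' \<in> \<K> \<Longrightarrow> Z' \<bullet> Y \<le> Z' \<bullet> Z" "\<And>h. h \<in> Hspace X \<Longrightarrow> h \<bullet> Y = h \<bullet> Z"
    using Y unfolding C_def by blast+
  have "level_deviation X y Y = 0" for y
  proof -
    define d where "d = level_deviation X y Y"
    have "Y - d \<in> C"
    proof -
      have "Z' \<bullet> (Y - d) \<le> Z' \<bullet> Z" if "Z' \<in> \<K>" for Z'
        using inner_level_deviation_nonneg[OF X YK that, of y] Ytest(1)[OF that]
        by (simp add: inner_diff_right d_def)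
      moreover have "h \<bullet> (Y - d) = h \<bullet> Z" if "h \<in> Hspace X" for h
        using inner_level_deviation_Hspace[OF X that, of y Y] Ytest(2)[OF that]
        by (simp add: inner_diff_right d_def)
      ultimately show ?thesis
        using level_averaging_Kcone[OF X YK, of y] unfolding C_def d_def by blast
    qed
    from min[OF this] have "Y \<bullet> Y \<le> (Y - d) \<bullet> (Y - d)" by (simp add: norm_le)
    also have "\<dots> = Y \<bullet> Y - d \<bullet> d"
      using inner_level_deviation_self[OF X, of Y y]
      by (simp add: inner_diff_left inner_diff_right inner_commute d_def)
    finally have "d \<bullet> d = 0" using inner_ge_zero[of d] by linarith
    then show ?thesis by (simp add: d_def)
  qed
  then have YH: "Y \<in> Hspace X"
    unfolding Hspace_iff[OF X] using level_deviation_eq_0D[OF X] by blast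
  have "metric_proj (Hspace X) Z = Y"
  proof (rule metric_proj_subspace_eqI[OF subspace_Hspace[OF X] YH])
    fix h assume "h \<in> Hspace X"
    then show "(Z - Y) \<bullet> h = 0"
      using Ytest(2)[of h] by (simp add: inner_commute[of _ h] inner_diff_right)
  qed
  then show "metric_proj (Hspace X) Z \<in> \<K>" "\<And>Z'. Z' \<in> \<K> \<Longrightarrow> 0 \<le> Z' \<bullet> (Z - metric_proj (Hspace X) Z)"
    using YK Ytest(1) by (simp_all add: inner_diff_right)
qed

section \<open>Elements of \<open>Hspace X\<close> as Borel functions of \<open>X\<close>\<close>

text \<open>A level set with more than one point contains a rational, so the countable set
  \<open>C\<close> holds all nontrivial levels; there \<open>u\<close> takes the constant value
  \<open>k y\<close>. At other levels attained by \<open>X\<close>, the generalized inverse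
  \<open>F\<close> recovers the mass variable, and a Borel version \<open>w\<close> of
  \<open>U\<close> is composed with it.\<close>

lemma Hspace_repr:
  assumes X: "X \<in> \<K>" and U: "U \<in> Hspace X"
  obtains u where "u \<in> borel_measurable borel" "AE m in \<mm>. rep_l2 U m = u (mono_repr X m)"
proof -
  define f where "f = mono_repr X"
  have f: "mono_on \<Omega> f" using mono_reprD(3)[OF X] by (simp add: f_def)
  have \<Omega>: "\<Omega> \<in> sets lebesgue" by (simp add: Omega_def)
  have "rep_l2 U \<in> borel_measurable \<mm>"
    using square_integrable_rep_l2[of U] by (simp add: square_integrable_def)
  then have "(\<lambda>x. if x \<in> \<Omega> then rep_l2 U x else 0) \<in> borel_measurable lebesgue"
    using \<Omega> by (rule borel_measurable_if_I)
  from completion_ex_borel_measurable_real[OF this]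
  obtain w where "w \<in> borel_measurable lborel"
    and wU: "AE x in lborel. (if x \<in> \<Omega> then rep_l2 U x else 0) = w x"
    by blast
  then have w [measurable]: "w \<in> borel_measurable borel" by simp
  from wU have "AE x in lebesgue. (if x \<in> \<Omega> then rep_l2 U x else 0) = w x"
    by (intro AE_completion)
  then have wU: "AE m in \<mm>. rep_l2 U m = w m"
    unfolding AE_mass_iff by eventually_elim auto
  obtain k where k: "\<And>y. AE m in \<mm>. f m = y \<longrightarrow> rep_l2 U m = k y"
    using U unfolding Hspace_iff[OF X] f_def by metis
  define F where "F y = Sup (insert 0 {m\<in>\<Omega>. f m \<le> y})" for y
  have bdd: "bdd_above (insert 0 {m\<in>\<Omega>. f m \<le> y})" for y
    by (intro bdd_aboveI[of _ 1]) (auto simp: Omega_def)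
  have "mono F"
    unfolding F_def by (intro monoI cSup_subset_mono bdd) auto
  then have F [measurable]: "F \<in> borel_measurable borel" by (rule borel_measurable_mono)
  define C where "C = f ` (\<rat> \<inter> \<Omega>)"
  have "countable C" unfolding C_def using countable_rat by blast
  define u where "u y = (if y \<in> C then k y else w (F y))" for y
  show ?thesis
  proof (rule that)
    have "(\<lambda>y. w (F y)) \<in> borel_measurable borel" by measurable
    then show "u \<in> borel_measurable borel"
      by (rule measurable_discrete_difference[OF _ \<open>countable C\<close>]) (auto simp: u_def)
    have "AE m in \<mm>. \<forall>y\<in>C. f m = y \<longrightarrow> rep_l2 U m = k y"
      using k by (intro AE_ball_countable' \<open>countable C\<close>)
    then show "AE m in \<mm>. rep_l2 U m = u (mono_repr X m)"
      using wU AE_space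
    proof eventually_elim
      case (elim m)
      show ?case
      proof (cases "f m \<in> C")
        case True
        then show ?thesis using elim by (simp add: u_def f_def)
      next
        case False
        have m: "0 < m" "m < 1" "m \<in> \<Omega>" using elim by (auto simp: Omega_def)
        have single: "x \<le> m" if "x \<in> \<Omega>" "f x \<le> f m" for x
        proof (rule ccontr)
          assume "\<not> x \<le> m"
          then obtain q where q: "q \<in> \<rat>" "m < q" "q < x" using Rats_dense_in_real[of m x] by auto
          then have "q \<in> \<Omega>" using m that by (auto simp: Omega_def)
          then have "f m \<le> f q" "f q \<le> f x"
            using q m that by (auto intro: mono_onD[OF f])
          then have "f m = f q" using that by simp
          then show False using False q \<open>q \<in> \<Omega>\<close> by (auto simp: C_def)
        qed
        have "F (f m) = m"
          unfolding F_def
        proof (rule cSup_eq_maximum)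
          show "m \<in> insert 0 {x \<in> \<Omega>. f x \<le> f m}" using m by simp
          show "x \<le> m" if "x \<in> insert 0 {x \<in> \<Omega>. f x \<le> f m}" for x
            using that single m by auto
        qed
        then show ?thesis using elim False by (simp add: u_def f_def)
      qed
    qed
  qed
qed

section \<open>The subdifferential and the orthogonal complement of \<open>Hspace X\<close>\<close>

text \<open>The remainder is the pointwise minimum of \<open>X\<close> and \<open>c\<close>. A
  \<open>W\<close> that is nonpositive on \<open>\<K>\<close> and vanishes at the sum
  \<open>X\<close> of the two pieces must vanish at both.\<close>

lemma positive_part_Kcone:
  assumes X: "X \<in> \<K>"
  shows "abs_l2 (\<lambda>m. max 0 (mono_repr X m - c)) \<in> \<K>"
    and "square_integrable \<mm> (\<lambda>m. max 0 (mono_repr X m - c))"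
    and "X - abs_l2 (\<lambda>m. max 0 (mono_repr X m - c)) \<in> \<K>"
proof -
  note f = mono_reprD[OF X]
  have sqc: "square_integrable \<mm> (\<lambda>m. mono_repr X m - c)"
    by (intro square_integrable_diff f square_integrable_const)
  show sq: "square_integrable \<mm> (\<lambda>m. max 0 (mono_repr X m - c))"
    using f(4) by (intro square_integrable_mono[OF sqc]) auto
  show "abs_l2 (\<lambda>m. max 0 (mono_repr X m - c)) \<in> \<K>"
    using mono_onD[OF f(3)] by (intro abs_l2_in_Kcone' sq mono_onI) (force simp: max_def)
  have "X - abs_l2 (\<lambda>m. max 0 (mono_repr X m - c))
      = abs_l2 (\<lambda>m. mono_repr X m - max 0 (mono_repr X m - c))"
    by (subst minus_l2.abs_eq[symmetric]) (auto simp: f(1,2) sq)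
  also have "\<dots> \<in> \<K>"
    using mono_onD[OF f(3)] by (intro abs_l2_in_Kcone' square_integrable_diff f(1) sq mono_onI)
      (force simp: max_def)
  finally show "X - abs_l2 (\<lambda>m. max 0 (mono_repr X m - c)) \<in> \<K>" .
qed

lemma superlevel_inner_zero:
  assumes X: "X \<in> \<K>" and W: "\<And>c. W \<bullet> abs_l2 (\<lambda>m. max 0 (mono_repr X m - c)) = 0"
  shows "(\<integral>m. rep_l2 W m * indicator {c<..} (mono_repr X m) \<partial>\<mm>) = 0"
proof -
  have [measurable]: "mono_repr X \<in> borel_measurable \<mm>" "rep_l2 W \<in> borel_measurable \<mm>"
    using mono_reprD(4)[OF X] square_integrable_rep_l2[of W] by (auto simp: square_integrable_def)
  note sq = positive_part_Kcone(2)[OF X]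
  have W0: "(\<integral>m. rep_l2 W m * max 0 (mono_repr X m - c) \<partial>\<mm>) = 0" for c
    using W[of c] inner_abs_l2[OF square_integrable_rep_l2[of W] sq] by (simp add: abs_rep_l2)
  \<comment> \<open>Difference quotient in \<open>c\<close> of the truncations: \<open>g n\<close>
    ramps from 0 to 1 between the levels \<open>c\<close> and \<open>c + 1 / Suc n\<close> and tends
    to the indicator of the superlevel set.\<close>
  define g where "g n m = real (Suc n) * (max 0 (mono_repr X m - c) - max 0 (mono_repr X m - (c + 1 / Suc n)))" for n m
  have "(\<integral>m. rep_l2 W m * g n m \<partial>\<mm>) = 0" for n
  proof -
    have "(\<integral>m. rep_l2 W m * g n m \<partial>\<mm>) = (\<integral>m. real (Suc n) * (rep_l2 W m * max 0 (mono_repr X m - c))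
        - real (Suc n) * (rep_l2 W m * max 0 (mono_repr X m - (c + 1 / Suc n))) \<partial>\<mm>)"
      by (rule Bochner_Integration.integral_cong) (auto simp: g_def algebra_simps)
    also have "\<dots> = real (Suc n) * (\<integral>m. rep_l2 W m * max 0 (mono_repr X m - c) \<partial>\<mm>)
        - real (Suc n) * (\<integral>m. rep_l2 W m * max 0 (mono_repr X m - (c + 1 / Suc n)) \<partial>\<mm>)"
      using square_integrable_mult[OF square_integrable_rep_l2[of W] sq]
      by (subst Bochner_Integration.integral_diff) (auto simp del: of_nat_Suc)
    also have "\<dots> = 0" by (simp only: W0)
    finally show ?thesis .
  qed
  moreover have "(\<lambda>n. \<integral>m. rep_l2 W m * g n m \<partial>\<mm>)
      \<longlonglongrightarrow> (\<integral>m. rep_l2 W m * indicator {c<..} (mono_repr X m) \<partial>\<mm>)"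
  proof (rule integral_dominated_convergence[where w = "\<lambda>m. \<bar>rep_l2 W m\<bar>"])
    show "integrable \<mm> (\<lambda>m. \<bar>rep_l2 W m\<bar>)"
      using square_integrable_imp_integrable_mass[OF square_integrable_rep_l2[of W]] by simp
    show "(\<lambda>m. rep_l2 W m * g n m) \<in> borel_measurable \<mm>" for n
      unfolding g_def by measurable
    have "\<bar>g n m\<bar> \<le> 1" for n m
    proof -
      define D where "D = max 0 (mono_repr X m - c) - max 0 (mono_repr X m - (c + 1 / Suc n))"
      have "0 \<le> 1 / real (Suc n)" by simp
      then have D: "0 \<le> D" "D \<le> 1 / real (Suc n)"
        unfolding D_def max_def by (smt (verit))+
      have "real (Suc n) * D \<le> real (Suc n) * (1 / real (Suc n))"
        using D(2) by (rule mult_left_mono) simp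
      also have "\<dots> = 1" by simp
      finally have "real (Suc n) * D \<le> 1" .
      moreover have "g n m = real (Suc n) * D" unfolding g_def D_def ..
      ultimately show ?thesis using D(1) by (simp del: of_nat_Suc)
    qed
    then show "AE m in \<mm>. norm (rep_l2 W m * g n m) \<le> \<bar>rep_l2 W m\<bar>" for n
      by (auto simp: abs_mult intro!: mult_left_le)
    have "(\<lambda>n. g n m) \<longlonglongrightarrow> indicator {c<..} (mono_repr X m)" for m
    proof (cases "mono_repr X m > c")
      case True
      then obtain N where N: "1 / Suc N < mono_repr X m - c"
        using reals_Archimedean[of "mono_repr X m - c"] by (auto simp: inverse_eq_divide)
      have "\<forall>\<^sub>F n in sequentially. indicator {c<..} (mono_repr X m) = g n m"
        using eventually_ge_at_top[of N]
      proof eventually_elim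
        case (elim n)
        then have "1 / real (Suc n) \<le> 1 / real (Suc N)" by (simp add: frac_le)
        then show ?case using N True by (auto simp: g_def max_def simp del: of_nat_Suc)
      qed
      then show ?thesis by (rule Lim_transform_eventually[OF tendsto_const])
    next
      case False
      have "g n m = 0" for n
      proof -
        have "0 \<le> 1 / real (Suc n)" by simp
        then have "mono_repr X m - c \<le> 0" "mono_repr X m - (c + 1 / real (Suc n)) \<le> 0"
          using False by linarith+
        then show ?thesis unfolding g_def by (simp only: max_absorb1 diff_self mult_zero_right)
      qed
      then show ?thesis using False by simp
    qed
    then show "AE m in \<mm>. (\<lambda>n. rep_l2 W m * g n m) \<longlonglongrightarrow> rep_l2 W m * indicator {c<..} (mono_repr X m)"
      by (intro AE_I2 tendsto_mult tendsto_const)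
  qed measurable
  ultimately have "(\<lambda>n::nat. 0) \<longlonglongrightarrow> (\<integral>m. rep_l2 W m * indicator {c<..} (mono_repr X m) \<partial>\<mm>)"
    by simp
  then show ?thesis by (simp add: LIMSEQ_const_iff)
qed

text \<open>Dynkin argument: the open half-lines are stable under intersection and generate the
  Borel sets; \<open>W1\<close> supplies the integral over the whole interval, from which
  complements are taken.\<close>

lemma borel_level_inner_zero:
  assumes X: "X \<in> \<K>" and W: "\<And>c. W \<bullet> abs_l2 (\<lambda>m. max 0 (mono_repr X m - c)) = 0"
    and W1: "W \<bullet> abs_l2 (\<lambda>_. 1) = 0" and B: "B \<in> sets borel"
  shows "(\<integral>m. rep_l2 W m * indicator B (mono_repr X m) \<partial>\<mm>) = 0"
proof -
  have [measurable]: "mono_repr X \<in> borel_measurable \<mm>" "rep_l2 W \<in> borel_measurable \<mm>"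
    using mono_reprD(4)[OF X] square_integrable_rep_l2[of W] by (auto simp: square_integrable_def)
  have intW: "integrable \<mm> (rep_l2 W)"
    by (rule square_integrable_imp_integrable_mass[OF square_integrable_rep_l2])
  have int: "integrable \<mm> (\<lambda>m. rep_l2 W m * indicator A (mono_repr X m))" if "A \<in> sets borel" for A
    by (rule Bochner_Integration.integrable_bound[OF intW]) (use that in \<open>auto simp: indicator_def\<close>)
  have W1': "(\<integral>m. rep_l2 W m \<partial>\<mm>) = 0"
    using W1 inner_abs_l2[OF square_integrable_rep_l2[of W], of "\<lambda>_. 1"] by (simp add: abs_rep_l2)
  have stable: "Int_stable (range (greaterThan :: real \<Rightarrow> real set))"
  proof (rule Int_stableI_image)
    fix i j :: real
    have "{i<..} \<inter> {j<..} = {max i j<..}" by auto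
    then show "\<exists>k\<in>UNIV. {i<..} \<inter> {j<..} = {k<..}" by blast
  qed
  have borel: "sets borel = sigma_sets UNIV (range (greaterThan :: real \<Rightarrow> real set))"
    by (subst borel_Ioi) simp
  have B': "B \<in> sigma_sets UNIV (range (greaterThan :: real \<Rightarrow> real set))"
    using B borel by blast
  show ?thesis
  proof (rule sigma_sets_induct_disjoint[OF stable _ B',
        where P = "\<lambda>B. (\<integral>m. rep_l2 W m * indicator B (mono_repr X m) \<partial>\<mm>) = 0"])
    fix A :: "real set" assume "A \<in> range greaterThan"
    then obtain c where "A = {c<..}" by auto
    then show "(\<integral>m. rep_l2 W m * indicator A (mono_repr X m) \<partial>\<mm>) = 0"
      using superlevel_inner_zero[OF X W] by simp
  next
    fix A assume A: "A \<in> sigma_sets UNIV (range greaterThan)"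
      "(\<integral>m. rep_l2 W m * indicator A (mono_repr X m) \<partial>\<mm>) = 0"
    have "(\<integral>m. rep_l2 W m * indicator (UNIV - A) (mono_repr X m) \<partial>\<mm>)
        = (\<integral>m. rep_l2 W m - rep_l2 W m * indicator A (mono_repr X m) \<partial>\<mm>)"
      by (rule Bochner_Integration.integral_cong) (auto simp: indicator_def)
    also have "\<dots> = 0"
      using A int intW W1' borel by (subst Bochner_Integration.integral_diff) auto
    finally show "(\<integral>m. rep_l2 W m * indicator (UNIV - A) (mono_repr X m) \<partial>\<mm>) = 0" .
  next
    fix A :: "nat \<Rightarrow> real set"
    assume A: "disjoint_family A" "range A \<subseteq> sigma_sets UNIV (range greaterThan)"
      "\<And>i. (\<integral>m. rep_l2 W m * indicator (A i) (mono_repr X m) \<partial>\<mm>) = 0"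
    have Ab [measurable]: "A i \<in> sets borel" for i using A(2) borel by blast
    have pre: "mono_repr X -` A i \<inter> \<Omega> \<in> sets \<mm>" for i
      using measurable_sets[of "mono_repr X" \<mm> borel "A i"] by simp
    have setint: "(\<integral>m. rep_l2 W m * indicator B (mono_repr X m) \<partial>\<mm>)
        = (LINT m:(mono_repr X -` B \<inter> \<Omega>)|\<mm>. rep_l2 W m)" for B
      unfolding set_lebesgue_integral_def
      by (rule Bochner_Integration.integral_cong) (auto simp: indicator_def)
    have "(LINT m:(\<Union>i. mono_repr X -` A i \<inter> \<Omega>)|\<mm>. rep_l2 W m)
        = (\<Sum>i. LINT m:(mono_repr X -` A i \<inter> \<Omega>)|\<mm>. rep_l2 W m)"
    proof (rule lebesgue_integral_countable_add)
      show "mono_repr X -` A i \<inter> \<Omega> \<in> sets \<mm>" for i by (rule pre)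
      show "(mono_repr X -` A i \<inter> \<Omega>) \<inter> (mono_repr X -` A j \<inter> \<Omega>) = {}" if "i \<noteq> j" for i j
        using A(1) that by (auto simp: disjoint_family_on_def)
      show "set_integrable \<mm> (\<Union>i. mono_repr X -` A i \<inter> \<Omega>) (rep_l2 W)"
        unfolding set_integrable_def using intW
        by (intro integrable_mult_indicator sets.countable_UN) (auto intro: pre)
    qed
    also have "\<dots> = 0" using A(3) by (simp flip: setint)
    also have "(\<Union>i. mono_repr X -` A i \<inter> \<Omega>) = mono_repr X -` (\<Union>i. A i) \<inter> \<Omega>" by auto
    finally show "(\<integral>m. rep_l2 W m * indicator (\<Union>i. A i) (mono_repr X m) \<partial>\<mm>) = 0"
      by (simp add: setint)
  qed auto
qed

text \<open>The projection \<open>p\<close> of \<open>W\<close> has the same integrals as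
  \<open>W\<close> over preimages of Borel sets, because their indicators belong to
  \<open>Hspace X\<close>; so these vanish. Being a Borel function \<open>u\<close> of
  \<open>X\<close>, \<open>p\<close> can be tested where \<open>u\<close> has a fixed sign, which
  gives \<open>p = 0\<close>.\<close>

lemma orthogonal_Hspace:
  assumes X: "X \<in> \<K>" and W: "\<And>c. W \<bullet> abs_l2 (\<lambda>m. max 0 (mono_repr X m - c)) = 0"
    and W1: "W \<bullet> abs_l2 (\<lambda>_. 1) = 0" and U: "U \<in> Hspace X"
  shows "W \<bullet> U = 0"
proof -
  define p where "p = metric_proj (Hspace X) W"
  note P = metric_proj_subspace[OF subspace_Hspace[OF X] closed_Hspace[OF X], where x = W, folded p_def]
  note f = mono_reprD(4)[OF X]
  obtain u where u [measurable]: "u \<in> borel_measurable borel"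
    and pu: "AE m in \<mm>. rep_l2 p m = u (mono_repr X m)"
    using Hspace_repr[OF X P(1)] .
  have sqp: "square_integrable \<mm> (\<lambda>m. u (mono_repr X m))"
    using f pu by (intro square_integrable_cong_AE[OF square_integrable_rep_l2[of p]]) (auto simp: eq_commute)
  have zero: "(\<integral>m. rep_l2 p m * indicator B (mono_repr X m) \<partial>\<mm>) = 0" if B [measurable]: "B \<in> sets borel" for B
  proof -
    have sq: "square_integrable \<mm> (\<lambda>m. indicator B (mono_repr X m) :: real)"
      using f by (intro square_integrable_mono[OF square_integrable_const[of 1]]) (auto simp: indicator_def)
    have "(\<integral>m. rep_l2 V m * indicator B (mono_repr X m) \<partial>\<mm>) = V \<bullet> abs_l2 (\<lambda>m. indicator B (mono_repr X m))" for V
      using inner_abs_l2[OF square_integrable_rep_l2[of V] sq] by (simp add: abs_rep_l2)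
    moreover have "(W - p) \<bullet> abs_l2 (\<lambda>m. indicator B (mono_repr X m)) = 0"
      by (rule P(2)[OF abs_l2_in_Hspace[OF X sq]])
    ultimately show ?thesis
      using borel_level_inner_zero[OF X W W1 B] by (simp add: inner_diff_left)
  qed
  have "AE m in \<mm>. u (mono_repr X m) = 0"
  proof -
    have part: "AE m in \<mm>. u (mono_repr X m) * indicator B (mono_repr X m) = 0"
      if B [measurable]: "B \<in> sets borel" and s: "\<bar>s\<bar> = (1::real)"
        and pos: "\<And>y. y \<in> B \<Longrightarrow> 0 \<le> s * u y" for B s
    proof -
      have "AE m in \<mm>. 0 \<le> s * (u (mono_repr X m) * indicator B (mono_repr X m))"
        using pos by (auto simp: indicator_def)
      moreover have "integrable \<mm> (\<lambda>m. s * (u (mono_repr X m) * indicator B (mono_repr X m)))"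
        by (intro integrable_mult_right Bochner_Integration.integrable_bound[OF square_integrable_imp_integrable_mass[OF sqp]])
          (use f in \<open>auto simp: indicator_def\<close>)
      moreover have "(\<integral>m. u (mono_repr X m) * indicator B (mono_repr X m) \<partial>\<mm>)
          = (\<integral>m. rep_l2 p m * indicator B (mono_repr X m) \<partial>\<mm>)"
        using f pu square_integrable_rep_l2[of p]
        by (intro integral_cong_AE) (auto simp: square_integrable_def elim: eventually_mono)
      ultimately have "AE m in \<mm>. s * (u (mono_repr X m) * indicator B (mono_repr X m)) = 0"
        using zero[OF B]
          integral_nonneg_eq_0_iff_AE[of \<mm> "\<lambda>m. s * (u (mono_repr X m) * indicator B (mono_repr X m))"]
        by simp
      then show ?thesis using s by auto
    qed
    have "AE m in \<mm>. u (mono_repr X m) * indicator {y. 0 \<le> u y} (mono_repr X m) = 0"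
      by (rule part[of _ 1]) auto
    moreover have "AE m in \<mm>. u (mono_repr X m) * indicator {y. u y \<le> 0} (mono_repr X m) = 0"
      by (rule part[of _ "-1"]) auto
    ultimately show ?thesis
      by eventually_elim (auto simp: indicator_def split: if_splits)
  qed
  with pu have "AE m in \<mm>. rep_l2 p m = 0" by eventually_elim simp
  then have "abs_l2 (rep_l2 p) = abs_l2 (\<lambda>_. 0)"
    by (subst abs_l2_eq_iff) (auto simp: square_integrable_rep_l2)
  then have "p = 0" by (simp add: abs_rep_l2 zero_l2_def)
  then show ?thesis using P(2)[OF U] by simp
qed

text \<open>Strengthens \<open>W \<bullet> X = 0\<close> to orthogonality to all of
  \<open>Hspace X\<close>: the truncations of \<open>X\<close> are annihilated by splitting
  \<open>X\<close>, the constants because \<open>\<K>\<close> contains both signs of them.\<close>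

lemma mem_subdiff_K_iff_Hspace:
  assumes X: "X \<in> \<K>"
  shows "W \<in> subdiff_K X \<longleftrightarrow> (\<forall>Y\<in>\<K>. W \<bullet> Y \<le> 0) \<and> (\<forall>U\<in>Hspace X. W \<bullet> U = 0)"
proof
  assume "W \<in> subdiff_K X"
  then have W: "\<And>Y. Y \<in> \<K> \<Longrightarrow> W \<bullet> Y \<le> 0" "W \<bullet> X = 0"
    by (auto simp: mem_subdiff_K_iff[OF X])
  have "W \<bullet> U = 0" if "U \<in> Hspace X" for U
  proof (rule orthogonal_Hspace[OF X _ _ that])
    fix c
    have "W \<bullet> abs_l2 (\<lambda>m. max 0 (mono_repr X m - c)) \<le> 0"
      and "W \<bullet> (X - abs_l2 (\<lambda>m. max 0 (mono_repr X m - c))) \<le> 0"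
      by (intro W(1) positive_part_Kcone[OF X])+
    then show "W \<bullet> abs_l2 (\<lambda>m. max 0 (mono_repr X m - c)) = 0"
      using W(2) by (simp add: inner_diff_right)
  next
    have "W \<bullet> (abs_l2 (\<lambda>_. 1) + abs_l2 (\<lambda>_. -1)) = W \<bullet> 0"
      by (subst plus_l2.abs_eq) (auto simp: zero_l2_def)
    then show "W \<bullet> abs_l2 (\<lambda>_. 1) = 0"
      using W(1)[OF Kcone_const[of 1]] W(1)[OF Kcone_const[of "-1"]] by (simp add: inner_add_right)
  qed
  with W show "(\<forall>Y\<in>\<K>. W \<bullet> Y \<le> 0) \<and> (\<forall>U\<in>Hspace X. W \<bullet> U = 0)" by blast
qed (auto simp: mem_subdiff_K_iff[OF X] self_in_Hspace[OF X])

section \<open>The interaction operator\<close>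

context
  fixes \<phi> :: "real \<Rightarrow> real"
  assumes \<phi>: "communication_protocol \<phi>"
begin

section \<open>Modulus of continuity of the primitive\<close>

lemma protocol_integrable: "set_integrable lborel {a<..<b} \<phi>"
proof -
  have "set_integrable lborel {a..b} \<phi>"
    using \<phi> by (simp add: communication_protocol_def)
  then show ?thesis by (rule set_integrable_subset) auto
qed

lemma primitive_diff:
  assumes "x \<le> y"
  shows "primitive \<phi> y - primitive \<phi> x = (LINT z:{x<..<y}|lborel. \<phi> z)"
proof -
  have "interval_lebesgue_integrable lborel (ereal a) (ereal b) \<phi>" if "a \<le> b" for a b
    using protocol_integrable that by (simp add: interval_lebesgue_integrable_def)
  then have "primitive \<phi> x + (LBINT z=ereal x..ereal y. \<phi> z) = primitive \<phi> y"
    unfolding primitive_def by (intro interval_integral_sum) (auto simp: min_def max_def)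
  then show ?thesis using assms by (simp add: interval_lebesgue_integral_def)
qed

lemma primitive_0: "primitive \<phi> 0 = 0"
  by (simp add: primitive_def zero_ereal_def)

lemma primitive_mono: "x \<le> y \<Longrightarrow> primitive \<phi> x \<le> primitive \<phi> y"
proof -
  assume "x \<le> y"
  have "0 \<le> (LINT z:{x<..<y}|lborel. \<phi> z)"
    unfolding set_lebesgue_integral_def
    using \<phi> by (intro integral_nonneg_AE) (simp add: communication_protocol_def)
  then show ?thesis using primitive_diff[OF \<open>x \<le> y\<close>] by linarith
qed

lemma primitive_minus: "primitive \<phi> (- x) = - primitive \<phi> x"
proof -
  have "primitive \<phi> (- x) = (LBINT y=ereal x..0. \<phi> (- y))"
    unfolding primitive_def by (subst interval_integral_reflect) (simp add: zero_ereal_def)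
  also have "\<dots> = (LBINT y=ereal x..0. \<phi> y)"
    using \<phi> by (simp add: communication_protocol_def)
  also have "\<dots> = - primitive \<phi> x"
    unfolding primitive_def by (subst interval_integral_endpoints_reverse) (simp add: zero_ereal_def)
  finally show ?thesis .
qed

text \<open>Concavity on the half-line in disguise: shifting the window \<open>{0<..<y}\<close> to
  the right by \<open>x\<close> lowers the protocol pointwise. The open window avoids the origin,
  away from which monotonicity is assumed.\<close>

lemma primitive_subadditive:
  assumes "0 \<le> x" "0 \<le> y"
  shows "primitive \<phi> (x + y) \<le> primitive \<phi> x + primitive \<phi> y"
proof -
  have eq: "indicator {x<..<x + y} (x + t) = (indicator {0<..<y} t :: real)" for t
    by (auto simp: indicator_def)
  have int: "integrable lborel (\<lambda>z. indicator {x<..<x + y} z * \<phi> z)" for x y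
    using protocol_integrable[of x "x + y"] by (simp add: set_integrable_def)
  have "primitive \<phi> (x + y) - primitive \<phi> x = (\<integral>z. indicator {x<..<x + y} z * \<phi> z \<partial>lborel)"
    using primitive_diff[of x "x + y"] assms by (simp add: set_lebesgue_integral_def)
  also have "\<dots> = (\<integral>t. indicator {0<..<y} t * \<phi> (x + t) \<partial>lborel)"
    using lborel_integral_real_affine[of 1 "\<lambda>z. indicator {x<..<x + y} z * \<phi> z" x] by (simp add: eq)
  also have "\<dots> \<le> (\<integral>t. indicator {0<..<y} t * \<phi> t \<partial>lborel)"
  proof (rule integral_mono)
    show "integrable lborel (\<lambda>t. indicator {0<..<y} t * \<phi> (x + t))"
      using lborel_integrable_real_affine[OF int[of x y], of 1 x] by (simp add: eq)
    show "integrable lborel (\<lambda>t. indicator {0<..<y} t * \<phi> t)" using int[of 0] by simp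
    fix t show "indicator {0<..<y} t * \<phi> (x + t) \<le> indicator {0<..<y} t * \<phi> t"
      using \<phi> assms by (auto simp: indicator_def communication_protocol_def)
  qed
  also have "\<dots> = primitive \<phi> y"
    using primitive_diff[of 0 y] assms by (simp add: set_lebesgue_integral_def primitive_0)
  finally show ?thesis by simp
qed

text \<open>Iterates subadditivity over \<open>n\<close> steps of length \<open>e\<close>, with
  \<open>n\<close> at most \<open>1 + d / e\<close>. This affine bound at a chosen scale replaces a
  Lipschitz bound, which fails if the protocol is unbounded near the origin.\<close>

lemma primitive_linear_bound:
  assumes "0 < e" "0 \<le> d"
  shows "primitive \<phi> d \<le> primitive \<phi> e * (1 + d / e)"
proof -
  have nonneg: "0 \<le> primitive \<phi> e" using primitive_mono[of 0 e] assms by (simp add: primitive_0)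
  have mult: "primitive \<phi> (real n * e) \<le> real n * primitive \<phi> e" for n
  proof (induction n)
    case (Suc n)
    have "primitive \<phi> (real n * e + e) \<le> primitive \<phi> (real n * e) + primitive \<phi> e"
      using assms by (intro primitive_subadditive) auto
    then show ?case using Suc by (simp add: algebra_simps)
  qed (simp add: primitive_0)
  define n where "n = nat \<lceil>d / e\<rceil>"
  have n: "d / e \<le> real n" "real n \<le> 1 + d / e"
  proof -
    have "0 \<le> d / e" using assms by simp
    then have "0 \<le> \<lceil>d / e\<rceil>" by simp
    then have "real n = real_of_int \<lceil>d / e\<rceil>" by (simp add: n_def)
    then show "d / e \<le> real n" "real n \<le> 1 + d / e"
      using ceiling_correct[of "d / e"] by linarith+
  qed
  then have "d \<le> real n * e" using assms by (simp add: field_simps)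
  then have "primitive \<phi> d \<le> real n * primitive \<phi> e"
    using primitive_mono mult order_trans by blast
  also have "\<dots> \<le> (1 + d / e) * primitive \<phi> e" using n nonneg by (intro mult_right_mono)
  finally show ?thesis by (simp add: mult.commute)
qed

text \<open>The factor 2 pays for arguments of opposite sign, where each contributes at most the
  primitive of the distance; on one side of the origin, subadditivity gives factor 1.\<close>

lemma primitive_modulus:
  assumes "0 < e"
  shows "\<bar>primitive \<phi> x - primitive \<phi> y\<bar> \<le> 2 * primitive \<phi> e * (1 + \<bar>x - y\<bar> / e)"
proof -
  have "primitive \<phi> y - primitive \<phi> x \<le> 2 * primitive \<phi> (y - x)" if "x \<le> y" for x y
  proof -
    have nonneg: "0 \<le> primitive \<phi> (y - x)" using primitive_mono[of 0 "y - x"] that by (simp add: primitive_0)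
    consider "0 \<le> x" | "y \<le> 0" | "x < 0" "0 < y" by linarith
    then show ?thesis
    proof cases
      case 1
      then show ?thesis using primitive_subadditive[of x "y - x"] that nonneg by simp
    next
      case 2
      then show ?thesis using primitive_subadditive[of "- y" "y - x"] that nonneg by (simp add: primitive_minus)
    next
      case 3
      then show ?thesis
        using primitive_mono[of y "y - x"] primitive_mono[of "- x" "y - x"] by (simp add: primitive_minus)
    qed
  qed
  from this[of x y] this[of y x]
  have "\<bar>primitive \<phi> x - primitive \<phi> y\<bar> \<le> 2 * primitive \<phi> \<bar>x - y\<bar>"
    using primitive_mono[of x y] primitive_mono[of y x] by (cases "x \<le> y") (auto simp: abs_if)
  also have "\<dots> \<le> 2 * (primitive \<phi> e * (1 + \<bar>x - y\<bar> / e))"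
    using primitive_linear_bound[OF assms] by simp
  finally show ?thesis by simp
qed

lemma primitive_small:
  assumes "0 < \<eta>"
  obtains e where "0 < e" "primitive \<phi> e < \<eta>"
proof -
  have "(\<lambda>n. \<integral>z. indicator {0<..<1 / real (Suc n)} z * \<phi> z \<partial>lborel) \<longlonglongrightarrow> (\<integral>z. 0 \<partial>(lborel :: real measure))"
  proof (rule integral_dominated_convergence[where w = "\<lambda>z. indicator {0<..<1} z * \<phi> z"])
    show "integrable lborel (\<lambda>z. indicator {0<..<1} z * \<phi> z)"
      using protocol_integrable[of 0 1] by (simp add: set_integrable_def)
    show "(\<lambda>z. indicator {0<..<1 / real (Suc n)} z * \<phi> z) \<in> borel_measurable lborel" for n
      using protocol_integrable[of 0 "1 / real (Suc n)"]
      by (simp add: set_integrable_def borel_measurable_integrable del: of_nat_Suc)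
    have le: "1 / real (Suc n) \<le> 1" for n by simp
    show "AE z in lborel. norm (indicator {0<..<1 / real (Suc n)} z * \<phi> z) \<le> indicator {0<..<1} z * \<phi> z" for n
    proof (rule AE_I2)
      fix z
      show "norm (indicator {0<..<1 / real (Suc n)} z * \<phi> z) \<le> indicator {0<..<1} z * \<phi> z"
      proof (cases "z \<in> {0<..<1 / real (Suc n)}")
        case True
        then have "z \<in> {0<..<1}" using le[of n] unfolding greaterThanLessThan_iff by linarith
        then show ?thesis using True \<phi> by (simp add: communication_protocol_def)
      qed (use \<phi> in \<open>simp add: communication_protocol_def\<close>)
    qed
    have "(\<lambda>n. indicator {0<..<1 / real (Suc n)} z * \<phi> z) \<longlonglongrightarrow> 0" for z
    proof (cases "0 < z")
      case True
      then obtain N where N: "1 / real (Suc N) < z"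
        using reals_Archimedean[of z] by (auto simp: inverse_eq_divide)
      have "\<forall>\<^sub>F n in sequentially. 0 = indicator {0<..<1 / real (Suc n)} z * \<phi> z"
        using eventually_ge_at_top[of N]
      proof eventually_elim
        case (elim n)
        then have "1 / real (Suc n) \<le> 1 / real (Suc N)" by (simp add: frac_le)
        then show ?case using N by (auto simp: indicator_def simp del: of_nat_Suc)
      qed
      then show ?thesis by (rule Lim_transform_eventually[OF tendsto_const])
    qed simp
    then show "AE z in lborel. (\<lambda>n. indicator {0<..<1 / real (Suc n)} z * \<phi> z) \<longlonglongrightarrow> 0" by simp
  qed simp
  moreover have "(\<integral>z. indicator {0<..<1 / real (Suc n)} z * \<phi> z \<partial>lborel) = primitive \<phi> (1 / real (Suc n))" for n
    using primitive_diff[of 0 "1 / real (Suc n)"] by (simp add: set_lebesgue_integral_def primitive_0 del: of_nat_Suc)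
  ultimately have "(\<lambda>n. primitive \<phi> (1 / real (Suc n))) \<longlonglongrightarrow> 0" by simp
  then have "\<forall>\<^sub>F n in sequentially. primitive \<phi> (1 / real (Suc n)) < \<eta>"
    using assms by (rule order_tendstoD)
  then obtain n where "primitive \<phi> (1 / real (Suc n)) < \<eta>"
    by (auto simp: eventually_sequentially)
  then show ?thesis by (intro that[of "1 / real (Suc n)"]) auto
qed

section \<open>The interaction term: monotonicity and continuity\<close>

lemma conv_integrable:
  assumes "X \<in> \<K>"
  shows "integrable \<mm> (\<lambda>\<omega>. primitive \<phi> (x - mono_repr X \<omega>))"
proof (rule Bochner_Integration.integrable_bound)
  show "integrable \<mm> (\<lambda>\<omega>. 2 * primitive \<phi> 1 * (1 + (\<bar>x\<bar> + \<bar>mono_repr X \<omega>\<bar>)))"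
    using square_integrable_imp_integrable_mass[OF mono_reprD(1)[OF assms]] by simp
  show "(\<lambda>\<omega>. primitive \<phi> (x - mono_repr X \<omega>)) \<in> borel_measurable \<mm>"
    using primitive_measurable[OF \<phi>] mono_reprD(4)[OF assms] by measurable
  have p1: "0 \<le> primitive \<phi> 1" using primitive_mono[of 0 1] by (simp add: primitive_0)
  have "\<bar>primitive \<phi> (x - y)\<bar> \<le> \<bar>2 * primitive \<phi> 1 * (1 + (\<bar>x\<bar> + \<bar>y\<bar>))\<bar>" for y
  proof -
    have "\<bar>primitive \<phi> (x - y)\<bar> \<le> 2 * primitive \<phi> 1 * (1 + \<bar>x - y\<bar>)"
      using primitive_modulus[of 1 "x - y" 0] by (simp add: primitive_0)
    also have "\<dots> \<le> 2 * primitive \<phi> 1 * (1 + (\<bar>x\<bar> + \<bar>y\<bar>))"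
      using p1 by (intro mult_left_mono) auto
    finally show ?thesis by linarith
  qed
  then show "AE \<omega> in \<mm>. norm (primitive \<phi> (x - mono_repr X \<omega>))
      \<le> norm (2 * primitive \<phi> 1 * (1 + (\<bar>x\<bar> + \<bar>mono_repr X \<omega>\<bar>)))"
    by simp
qed

lemma conv_measurable:
  assumes "X \<in> \<K>"
  shows "mono_on \<Omega> (\<lambda>m. \<integral>\<omega>. primitive \<phi> (mono_repr X m - mono_repr X \<omega>) \<partial>\<mm>)"
    and "(\<lambda>m. \<integral>\<omega>. primitive \<phi> (mono_repr X m - mono_repr X \<omega>) \<partial>\<mm>) \<in> borel_measurable \<mm>"
proof -
  show mono: "mono_on \<Omega> (\<lambda>m. \<integral>\<omega>. primitive \<phi> (mono_repr X m - mono_repr X \<omega>) \<partial>\<mm>)"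
    using mono_onD[OF mono_reprD(3)[OF assms]]
    by (intro mono_onI integral_mono conv_integrable[OF assms] primitive_mono) auto
  show "(\<lambda>m. \<integral>\<omega>. primitive \<phi> (mono_repr X m - mono_repr X \<omega>) \<partial>\<mm>) \<in> borel_measurable \<mm>"
    using mono by (rule mono_on_imp_measurable_mass)
qed

text \<open>The pointwise modulus involves \<open>D m + D \<omega>\<close>; integrating out
  \<open>\<omega>\<close> leaves the mean of \<open>D\<close> and \<open>D m\<close> itself, so that
  the distance in \<open>l2\<close> will control both.\<close>

lemma conv_difference_bound:
  assumes X: "X \<in> \<K>" and Y: "Y \<in> \<K>" and e: "0 < e"
  defines "D \<equiv> \<lambda>m. \<bar>mono_repr X m - mono_repr Y m\<bar>"
  shows "\<bar>(\<integral>\<omega>. primitive \<phi> (mono_repr X m - mono_repr X \<omega>) \<partial>\<mm>)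
      - (\<integral>\<omega>. primitive \<phi> (mono_repr Y m - mono_repr Y \<omega>) \<partial>\<mm>)\<bar>
    \<le> 2 * primitive \<phi> e * (1 + (\<integral>\<omega>. D \<omega> \<partial>\<mm>) / e) + 2 * primitive \<phi> e / e * D m"
proof -
  have pe: "0 \<le> primitive \<phi> e" using primitive_mono[of 0 e] e by (simp add: primitive_0)
  have intD: "integrable \<mm> D"
    unfolding D_def using mono_reprD(1)[OF X] mono_reprD(1)[OF Y]
    by (intro square_integrable_imp_integrable_mass square_integrable_abs square_integrable_diff)
  let ?d = "\<lambda>\<omega>. primitive \<phi> (mono_repr X m - mono_repr X \<omega>) - primitive \<phi> (mono_repr Y m - mono_repr Y \<omega>)"
  have intd: "integrable \<mm> ?d"
    by (intro Bochner_Integration.integrable_diff conv_integrable X Y)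
  have "\<bar>(\<integral>\<omega>. primitive \<phi> (mono_repr X m - mono_repr X \<omega>) \<partial>\<mm>)
      - (\<integral>\<omega>. primitive \<phi> (mono_repr Y m - mono_repr Y \<omega>) \<partial>\<mm>)\<bar> = \<bar>\<integral>\<omega>. ?d \<omega> \<partial>\<mm>\<bar>"
    by (subst Bochner_Integration.integral_diff) (auto intro: conv_integrable X Y)
  also have "\<dots> \<le> (\<integral>\<omega>. \<bar>?d \<omega>\<bar> \<partial>\<mm>)"
    using integral_norm_bound[of \<mm> ?d] by simp
  also have "\<dots> \<le> (\<integral>\<omega>. 2 * primitive \<phi> e * (1 + D m / e) + 2 * primitive \<phi> e / e * D \<omega> \<partial>\<mm>)"
  proof (rule integral_mono)
    fix \<omega>
    have "\<bar>?d \<omega>\<bar> \<le> 2 * primitive \<phi> e * (1 + \<bar>(mono_repr X m - mono_repr X \<omega>) - (mono_repr Y m - mono_repr Y \<omega>)\<bar> / e)"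
      by (rule primitive_modulus[OF e])
    also have "\<dots> \<le> 2 * primitive \<phi> e * (1 + (D m + D \<omega>) / e)"
      using pe e by (intro mult_left_mono add_left_mono divide_right_mono) (auto simp: D_def)
    also have "\<dots> = 2 * primitive \<phi> e * (1 + D m / e) + 2 * primitive \<phi> e / e * D \<omega>"
      using e by (simp add: field_simps)
    finally show "\<bar>?d \<omega>\<bar> \<le> 2 * primitive \<phi> e * (1 + D m / e) + 2 * primitive \<phi> e / e * D \<omega>" .
  qed (use intD intd in auto)
  also have "\<dots> = 2 * primitive \<phi> e * (1 + D m / e) + 2 * primitive \<phi> e / e * (\<integral>\<omega>. D \<omega> \<partial>\<mm>)"
    using intD by simp
  also have "\<dots> = 2 * primitive \<phi> e * (1 + (\<integral>\<omega>. D \<omega> \<partial>\<mm>) / e) + 2 * primitive \<phi> e / e * D m"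
    using e by (simp add: field_simps)
  finally show ?thesis .
qed

lemma square_integrable_conv:
  assumes X: "X \<in> \<K>"
  shows "square_integrable \<mm> (\<lambda>m. \<integral>\<omega>. primitive \<phi> (mono_repr X m - mono_repr X \<omega>) \<partial>\<mm>)"
proof -
  let ?k = "2 * primitive \<phi> 1" and ?I = "\<integral>\<omega>. \<bar>mono_repr X \<omega>\<bar> \<partial>\<mm>"
  have p1: "0 \<le> primitive \<phi> 1" using primitive_mono[of 0 1] by (simp add: primitive_0)
  note f = mono_reprD(1)[OF X]
  have intf: "integrable \<mm> (\<lambda>\<omega>. \<bar>mono_repr X \<omega>\<bar>)"
    using square_integrable_imp_integrable_mass[OF f] by simp
  show ?thesis
  proof (rule square_integrable_mono)
    show "square_integrable \<mm> (\<lambda>m. ?k * (1 + ?I) + ?k * \<bar>mono_repr X m\<bar>)"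
      by (intro square_integrable_add square_integrable_scale square_integrable_abs f square_integrable_const)
    show "AE m in \<mm>. \<bar>\<integral>\<omega>. primitive \<phi> (mono_repr X m - mono_repr X \<omega>) \<partial>\<mm>\<bar>
        \<le> \<bar>?k * (1 + ?I) + ?k * \<bar>mono_repr X m\<bar>\<bar>"
    proof (rule AE_I2)
      fix m
      have "\<bar>\<integral>\<omega>. primitive \<phi> (mono_repr X m - mono_repr X \<omega>) \<partial>\<mm>\<bar>
          \<le> (\<integral>\<omega>. \<bar>primitive \<phi> (mono_repr X m - mono_repr X \<omega>)\<bar> \<partial>\<mm>)"
        using integral_norm_bound[of \<mm> "\<lambda>\<omega>. primitive \<phi> (mono_repr X m - mono_repr X \<omega>)"] by simp
      also have "\<dots> \<le> (\<integral>\<omega>. ?k * (1 + \<bar>mono_repr X m\<bar>) + ?k * \<bar>mono_repr X \<omega>\<bar> \<partial>\<mm>)"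
      proof (rule integral_mono)
        fix \<omega>
        have "\<bar>primitive \<phi> (mono_repr X m - mono_repr X \<omega>)\<bar> \<le> ?k * (1 + \<bar>mono_repr X m - mono_repr X \<omega>\<bar>)"
          using primitive_modulus[of 1 "mono_repr X m - mono_repr X \<omega>" 0] by (simp add: primitive_0)
        also have "\<dots> \<le> ?k * (1 + \<bar>mono_repr X m\<bar> + \<bar>mono_repr X \<omega>\<bar>)"
          using p1 by (intro mult_left_mono) auto
        finally show "\<bar>primitive \<phi> (mono_repr X m - mono_repr X \<omega>)\<bar>
            \<le> ?k * (1 + \<bar>mono_repr X m\<bar>) + ?k * \<bar>mono_repr X \<omega>\<bar>"
          by (simp add: algebra_simps)
      qed (use intf conv_integrable[OF X] in auto)
      also have "\<dots> = ?k * (1 + \<bar>mono_repr X m\<bar>) + ?k * ?I" using intf by simp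
      finally show "\<bar>\<integral>\<omega>. primitive \<phi> (mono_repr X m - mono_repr X \<omega>) \<partial>\<mm>\<bar>
          \<le> \<bar>?k * (1 + ?I) + ?k * \<bar>mono_repr X m\<bar>\<bar>"
        by (simp add: algebra_simps)
    qed
  qed (rule conv_measurable(2)[OF X])
qed

lemma conv_law_Kcone: "X \<in> \<K> \<Longrightarrow> conv_law \<phi> X \<in> \<K>"
  unfolding conv_law_eq[OF \<phi>]
  by (intro abs_l2_in_Kcone' square_integrable_conv conv_measurable)

lemma conv_law_Hspace: "X \<in> \<K> \<Longrightarrow> conv_law \<phi> X \<in> Hspace X"
  unfolding conv_law_eq[OF \<phi>]
  using abs_l2_in_Hspace[of X "\<lambda>x. \<integral>\<omega>. primitive \<phi> (x - mono_repr X \<omega>) \<partial>\<mm>"] square_integrable_conv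
  by simp

text \<open>The scale \<open>e\<close> bounds the distance, so the ratios \<open>c / e\<close> and
  \<open>norm (abs_l2 D) / e\<close> are at most 1. The total is \<open>2 * k + k\<close> with
  \<open>k = 2 * primitive \<phi> e\<close>, whence the 6.\<close>

lemma norm_conv_law_diff:
  assumes X: "X \<in> \<K>" and Y: "Y \<in> \<K>" and e: "0 < e" "norm (X - Y) \<le> e"
  shows "norm (conv_law \<phi> X - conv_law \<phi> Y) \<le> 6 * primitive \<phi> e"
proof -
  define D where "D m = \<bar>mono_repr X m - mono_repr Y m\<bar>" for m
  define k where "k = 2 * primitive \<phi> e"
  define c where "c = (\<integral>\<omega>. D \<omega> \<partial>\<mm>)"
  note f = mono_reprD(1,2)[OF X] and g = mono_reprD(1,2)[OF Y]
  have k0: "0 \<le> k" using primitive_mono[of 0 e] e by (simp add: primitive_0 k_def)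
  have sqD: "square_integrable \<mm> D"
    unfolding D_def by (intro square_integrable_abs square_integrable_diff f g)
  have "norm (abs_l2 D) = norm (X - Y)"
    using norm_abs_diff_l2[OF f(1) g(1)] inner_abs_l2[OF sqD sqD]
    by (simp add: norm_eq_sqrt_inner f g D_def power2_eq_square flip: abs_mult)
  then have D: "norm (abs_l2 D) \<le> e" using e by simp
  have n1: "norm (abs_l2 (\<lambda>_. 1)) = 1"
    by (simp add: norm_eq_sqrt_inner inner_abs_l2)
  have "c = abs_l2 (\<lambda>_. 1) \<bullet> abs_l2 D"
    by (simp add: c_def inner_abs_l2 sqD)
  also have "\<dots> \<le> norm (abs_l2 (\<lambda>_. 1)) * norm (abs_l2 D)" by (rule norm_cauchy_schwarz)
  finally have c: "c \<le> e" using D n1 by simp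
  have c0: "0 \<le> c" unfolding c_def D_def by (rule integral_nonneg_AE) simp
  have sqB: "square_integrable \<mm> (\<lambda>m. k * (1 + c / e) + k / e * D m)"
    by (intro square_integrable_add square_integrable_scale sqD square_integrable_const)
  note sqX = square_integrable_conv[OF X] and sqY = square_integrable_conv[OF Y]
  have "norm (conv_law \<phi> X - conv_law \<phi> Y) \<le> norm (abs_l2 (\<lambda>m. k * (1 + c / e) + k / e * D m))"
    unfolding conv_law_eq[OF \<phi> X] conv_law_eq[OF \<phi> Y]
  proof (subst minus_l2.abs_eq)
    show "norm (abs_l2 (\<lambda>m. (\<integral>\<omega>. primitive \<phi> (mono_repr X m - mono_repr X \<omega>) \<partial>\<mm>)
        - (\<integral>\<omega>. primitive \<phi> (mono_repr Y m - mono_repr Y \<omega>) \<partial>\<mm>)))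
      \<le> norm (abs_l2 (\<lambda>m. k * (1 + c / e) + k / e * D m))"
    proof (rule norm_abs_l2_mono[OF square_integrable_diff[OF sqX sqY] sqB], rule AE_I2)
      fix m
      show "\<bar>(\<integral>\<omega>. primitive \<phi> (mono_repr X m - mono_repr X \<omega>) \<partial>\<mm>)
        - (\<integral>\<omega>. primitive \<phi> (mono_repr Y m - mono_repr Y \<omega>) \<partial>\<mm>)\<bar> \<le> \<bar>k * (1 + c / e) + k / e * D m\<bar>"
        using conv_difference_bound[OF X Y e(1), of m] by (simp add: k_def c_def D_def)
    qed
  qed (use sqX sqY in simp_all)
  also have "abs_l2 (\<lambda>m. k * (1 + c / e) + k / e * D m)
      = (k * (1 + c / e)) *\<^sub>R abs_l2 (\<lambda>_. 1) + (k / e) *\<^sub>R abs_l2 D"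
  proof -
    have "(k * (1 + c / e)) *\<^sub>R abs_l2 (\<lambda>_. 1) = abs_l2 (\<lambda>_. k * (1 + c / e))"
      by (subst scaleR_l2.abs_eq) auto
    moreover have "(k / e) *\<^sub>R abs_l2 D = abs_l2 (\<lambda>m. k / e * D m)"
      using sqD by (subst scaleR_l2.abs_eq) auto
    ultimately show ?thesis
      using sqD by (simp only:) (subst plus_l2.abs_eq; simp only: l2_rel_refl square_integrable_const square_integrable_scale)
  qed
  also have "norm \<dots> \<le> k * (1 + c / e) + k / e * norm (abs_l2 D)"
    using k0 c0 e n1 by (intro norm_triangle_le) simp
  also have "\<dots> \<le> k * (1 + e / e) + k / e * e"
    using k0 e c D by (intro add_mono mult_left_mono divide_right_mono) auto
  also have "\<dots> = 6 * primitive \<phi> e" using e by (simp add: k_def)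
  finally show ?thesis .
qed

lemma continuous_on_conv_law: "continuous_on \<K> (conv_law \<phi>)"
  unfolding continuous_on_iff
proof (intro ballI allI impI)
  fix X \<eta> assume X: "X \<in> \<K>" and "0 < (\<eta>::real)"
  then obtain e where e: "0 < e" "primitive \<phi> e < \<eta> / 6" using primitive_small[of "\<eta> / 6"] by auto
  have "dist (conv_law \<phi> Y) (conv_law \<phi> X) < \<eta>" if "Y \<in> \<K>" "dist Y X < e" for Y
    using norm_conv_law_diff[OF that(1) X e(1)] that(2) e(2) by (simp add: dist_norm)
  then show "\<exists>d>0. \<forall>Y\<in>\<K>. dist Y X < d \<longrightarrow> dist (conv_law \<phi> Y) (conv_law \<phi> X) < \<eta>"
    using e(1) by blast
qed

end

section \<open>The Lagrangian solution\<close>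

lemma subspace_closure_real_normed:
  fixes S :: "'a::real_normed_vector set"
  assumes "subspace S"
  shows "subspace (closure S)"
  unfolding subspace_def
proof (intro conjI ballI allI)
  show "0 \<in> closure S" using subspace_0[OF assms] closure_subset by blast
next
  fix x y assume "x \<in> closure S" "y \<in> closure S"
  then obtain u v where "\<And>n. u n \<in> S" "u \<longlonglongrightarrow> x" "\<And>n. v n \<in> S" "v \<longlonglongrightarrow> y"
    unfolding closure_sequential by blast
  then show "x + y \<in> closure S"
    unfolding closure_sequential using assms
    by (intro exI[of _ "\<lambda>n. u n + v n"]) (auto intro: tendsto_add subspace_add)
next
  fix c x assume "x \<in> closure S"
  then obtain u where "\<And>n. u n \<in> S" "u \<longlonglongrightarrow> x"
    unfolding closure_sequential by blast
  then show "c *\<^sub>R x \<in> closure S"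
    unfolding closure_sequential using assms
    by (intro exI[of _ "\<lambda>n. c *\<^sub>R u n"]) (auto intro: tendsto_scaleR subspace_scale)
qed

locale lagrangian_flow =
  fixes \<phi> :: "real \<Rightarrow> real" and Xbar Vbar :: l2 and X :: "real \<Rightarrow> l2"
  assumes protocol: "communication_protocol \<phi>"
    and Vbar: "Vbar \<in> Hspace Xbar"
    and solution: "lagrangian_solution \<phi> Xbar Vbar X"
begin

definition Psibar where "Psibar = Psi \<phi> Xbar Vbar"

abbreviation H where "H t \<equiv> Hspace (X t)"
abbreviation P where "P t \<equiv> metric_proj (H t)"
abbreviation A where "A t \<equiv> conv_law \<phi> (X t)"

text \<open>The inclusion solved for the element of the subdifferential. The condition
  \<open>0 < t\<close> leaves room on both sides of \<open>t\<close> for minimum arguments.\<close>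

definition evolves where
  "evolves t D \<longleftrightarrow> 0 < t \<and> (X has_vector_derivative D) (at t) \<and> Psibar - A t - D \<in> subdiff_K (X t)"

lemma X_in [simp]: "0 \<le> t \<Longrightarrow> X t \<in> \<K>"
  and X_0: "X 0 = Xbar"
  and X_ac: "0 \<le> T \<Longrightarrow> absolutely_continuous_on {0..T} X"
  using solution by (auto simp: lagrangian_solution_def)

lemma velocity_U_eq: "0 \<le> t \<Longrightarrow> velocity_U \<phi> Xbar Vbar (X t) = Psibar - A t"
  by (simp add: velocity_U_def Psibar_def conv_law_eq[OF protocol])

lemma AE_evolves: "AE t in lborel. 0 < t \<longrightarrow> (\<exists>D. evolves t D)"
proof -
  have "AE t in lborel. t > 0 \<longrightarrow>
          (\<exists>D. (X has_vector_derivative D) (at t)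
             \<and> - D \<in> (\<lambda>W. - velocity_U \<phi> Xbar Vbar (X t) + W) ` subdiff_K (X t))"
    using solution by (simp add: lagrangian_solution_def)
  then show ?thesis
  proof eventually_elim
    case (elim t)
    show ?case
    proof
      assume t: "0 < t"
      with elim obtain D W where D: "(X has_vector_derivative D) (at t)" "W \<in> subdiff_K (X t)"
        "- D = - velocity_U \<phi> Xbar Vbar (X t) + W" by blast
      have "W = velocity_U \<phi> Xbar Vbar (X t) + (- velocity_U \<phi> Xbar Vbar (X t) + W)" by simp
      also have "\<dots> = velocity_U \<phi> Xbar Vbar (X t) + - D" by (simp only: D(3))
      finally have "W = velocity_U \<phi> Xbar Vbar (X t) - D" by simp
      then have "W = Psibar - A t - D" using t by (simp add: velocity_U_eq)
      then show "\<exists>D. evolves t D" using D t by (auto simp: evolves_def)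
    qed
  qed
qed

lemma continuous_on_X: "continuous_on {0..} X"
  unfolding continuous_on_eq_continuous_within
proof
  fix t :: real assume t: "t \<in> {0..}"
  have "continuous (at t within {0..t + 1}) X"
    using absolutely_continuous_on_imp_continuous[OF X_ac[of "t + 1"]] t
    by (auto simp: continuous_on_eq_continuous_within)
  moreover have "at t within {0..} = at t within {0..t + 1}"
    by (rule at_within_nhd[of _ "{t - 1<..<t + 1}"]) auto
  ultimately show "continuous (at t within {0..}) X" by simp
qed

lemma continuous_on_A: "continuous_on {0..} A"
  by (rule continuous_on_compose2[OF continuous_on_conv_law[OF protocol] continuous_on_X]) auto

lemma continuous_on_A_interval: "0 \<le> a \<Longrightarrow> continuous_on {a..b} A"
  by (rule continuous_on_subset[OF continuous_on_A]) auto

lemma P_in: "0 \<le> t \<Longrightarrow> P t U \<in> H t"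
  by (intro metric_proj_subspace subspace_Hspace closed_Hspace X_in)

lemma P_orth: "0 \<le> t \<Longrightarrow> V \<in> H t \<Longrightarrow> (U - P t U) \<bullet> V = 0"
  by (intro metric_proj_subspace subspace_Hspace closed_Hspace X_in)

lemma P_eqI:
  assumes "0 \<le> t" "p \<in> H t" "\<And>V. V \<in> H t \<Longrightarrow> (U - p) \<bullet> V = 0"
  shows "P t U = p"
  using assms by (intro metric_proj_subspace_eqI subspace_Hspace) auto

lemma P_id: "0 \<le> t \<Longrightarrow> U \<in> H t \<Longrightarrow> P t U = U"
  by (rule P_eqI) auto

lemma bounded_linear_P: "0 \<le> t \<Longrightarrow> bounded_linear (P t)"
  by (intro bounded_linear_metric_proj subspace_Hspace closed_Hspace) auto

lemma P_diff: "0 \<le> t \<Longrightarrow> P t (U - V) = P t U - P t V"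
  using bounded_linear.linear[OF bounded_linear_P] by (rule linear_diff)

lemma P_self_adjoint:
  assumes t: "0 \<le> t"
  shows "P t U \<bullet> V = U \<bullet> P t V"
proof -
  have "V \<bullet> P t U = P t V \<bullet> P t U" for U V
    using P_orth[OF t P_in[OF t, of U], of V] by (simp add: inner_diff_left)
  then show ?thesis by (metis inner_commute)
qed

lemma Q_self_adjoint: "0 \<le> t \<Longrightarrow> (U - P t U) \<bullet> V = U \<bullet> (V - P t V)"
  by (simp add: inner_diff_left inner_diff_right P_self_adjoint)

lemma Q_inner_H: "0 \<le> t \<Longrightarrow> V \<in> H t \<Longrightarrow> V \<bullet> (U - P t U) = 0"
  by (metis P_orth inner_commute)

lemma P_Kcone: "0 \<le> t \<Longrightarrow> Y \<in> \<K> \<Longrightarrow> P t Y \<in> \<K>"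
  by (intro metric_proj_Hspace_Kcone) auto

lemma Q_Kcone_nonneg: "0 \<le> t \<Longrightarrow> Y \<in> \<K> \<Longrightarrow> Z \<in> \<K> \<Longrightarrow> 0 \<le> Z \<bullet> (Y - P t Y)"
  by (intro metric_proj_Hspace_Kcone) auto

lemma X_in_H: "0 \<le> t \<Longrightarrow> X t \<in> H t"
  by (intro self_in_Hspace) auto

lemma A_in_H: "0 \<le> t \<Longrightarrow> A t \<in> H t"
  by (intro conv_law_Hspace protocol) auto

lemma A_in_K: "0 \<le> t \<Longrightarrow> A t \<in> \<K>"
  by (intro conv_law_Kcone protocol) auto

lemma evolvesD:
  assumes "evolves t D"
  shows "0 < t" "(X has_vector_derivative D) (at t)"
    "\<And>Y. Y \<in> \<K> \<Longrightarrow> (Psibar - A t - D) \<bullet> Y \<le> 0" "\<And>U. U \<in> H t \<Longrightarrow> (Psibar - A t - D) \<bullet> U = 0"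
  using assms mem_subdiff_K_iff_Hspace[of "X t" "Psibar - A t - D"] by (auto simp: evolves_def)

section \<open>Scalar comparison along the solution\<close>

lemma X_inner_derivative:
  "(X has_vector_derivative D) (at t) \<Longrightarrow> ((\<lambda>t. X t \<bullet> Z) has_real_derivative D \<bullet> Z) (at t)"
  using bounded_linear.has_vector_derivative[OF bounded_linear_inner_left[of Z]]
  by (simp add: has_real_derivative_iff_has_vector_derivative)

text \<open>Takes the place of integrating the inclusion in \<open>l2\<close>: after pairing with a
  fixed \<open>Z\<close>, a bound on derivatives at evolving times becomes an inequality between the
  endpoints. The term \<open>g\<close> carries whatever \<open>X\<close> is compared with; its
  derivative is bounded on the compact interval, so it is Lipschitz.\<close>

lemma X_nonincreasing:
  assumes ab: "0 \<le> a" "a \<le> b"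
    and g: "\<And>t. t \<in> {a..b} \<Longrightarrow> (g has_real_derivative g' t) (at t within {a..b})"
    and g': "continuous_on {a..b} g'"
    and le: "\<And>t D. a < t \<Longrightarrow> t < b \<Longrightarrow> evolves t D \<Longrightarrow> D \<bullet> Z + g' t \<le> 0"
  shows "X b \<bullet> Z + g b \<le> X a \<bullet> Z + g a"
proof (rule absolutely_continuous_nonincreasing[OF ab(2)])
  have "compact (g' ` {a..b})" by (intro compact_continuous_image g') auto
  then obtain L where L: "L \<ge> 0" "\<And>t. t \<in> {a..b} \<Longrightarrow> norm (g' t) \<le> L"
    using compact_imp_bounded bounded_pos by (metis image_eqI less_imp_le)
  have "absolutely_continuous_on {a..b} X"
    by (rule absolutely_continuous_on_subset[OF X_ac[of b]]) (use ab in auto)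
  then have "absolutely_continuous_on {a..b} (\<lambda>t. X t \<bullet> Z)"
  proof (rule absolutely_continuous_on_compose)
    fix s t
    have "\<bar>(X s - X t) \<bullet> Z\<bar> \<le> norm (X s - X t) * norm Z" by (rule Cauchy_Schwarz_ineq2)
    then show "dist (X s \<bullet> Z) (X t \<bullet> Z) \<le> norm Z * dist (X s) (X t)"
      by (simp add: dist_norm inner_diff_left mult.commute)
  qed simp
  then show "absolutely_continuous_on {a..b} (\<lambda>t. X t \<bullet> Z + g t)"
  proof (rule absolutely_continuous_on_plus_lipschitz)
    show "\<bar>g s - g t\<bar> \<le> L * \<bar>s - t\<bar>" if "s \<in> {a..b}" "t \<in> {a..b}" for s t
      using field_differentiable_bound[OF _ g L(2) that] by auto
  qed (rule L)
  show "AE t in lborel. a < t \<and> t < b \<longrightarrow> (\<exists>D\<le>0. ((\<lambda>t. X t \<bullet> Z + g t) has_real_derivative D) (at t))"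
    using AE_evolves
  proof eventually_elim
    case (elim t)
    show ?case
    proof
      assume t: "a < t \<and> t < b"
      with elim ab obtain D where D: "evolves t D" by auto
      have "(g has_real_derivative g' t) (at t)"
        using g[of t] t by (simp add: at_within_Icc_at)
      then have "((\<lambda>t. X t \<bullet> Z + g t) has_real_derivative D \<bullet> Z + g' t) (at t)"
        by (intro DERIV_add X_inner_derivative evolvesD(2)[OF D])
      then show "\<exists>D\<le>0. ((\<lambda>t. X t \<bullet> Z + g t) has_real_derivative D) (at t)"
        using le[OF _ _ D] t by blast
    qed
  qed
qed

section \<open>Stickiness\<close>

text \<open>By self-adjointness of \<open>P s\<close>, this says that
  \<open>Psibar - P s Psibar\<close> belongs to \<open>subdiff_K (X s)\<close>: the reaction force
  that holds merged mass together at time \<open>s\<close> is admissible. Only the state at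
  \<open>s\<close> is involved, yet all later times are controlled.\<close>

definition sticky_time where
  "sticky_time s \<longleftrightarrow> (\<forall>Y\<in>\<K>. Psibar \<bullet> (Y - P s Y) \<le> 0)"

text \<open>If \<open>Y \<in> \<K>\<close> then \<open>X t \<bullet> (Y - P s Y)\<close> is nonnegative and vanishes at \<open>t = s\<close>, an interior
  minimum; hence the two-sided derivative \<open>D\<close> at \<open>s\<close> is orthogonal to \<open>Y - P s Y\<close>.\<close>

lemma evolves_imp:
  assumes D: "evolves s D"
  shows "D = P s Psibar - A s" "sticky_time s"
proof -
  note ev = evolvesD[OF D]
  have s: "0 \<le> s" using ev(1) by simp
  have orth: "D \<bullet> (Y - P s Y) = 0" if Y: "Y \<in> \<K>" for Y
  proof (rule DERIV_local_min[OF X_inner_derivative[OF ev(2)] ev(1)], intro allI impI)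
    fix t assume "\<bar>s - t\<bar> < s"
    then have "0 \<le> t" by auto
    then show "X s \<bullet> (Y - P s Y) \<le> X t \<bullet> (Y - P s Y)"
      using Q_Kcone_nonneg[OF s Y, of "X t"] Q_inner_H[OF s X_in_H[OF s]] by simp
  qed
  \<comment> \<open>Applying \<open>orth\<close> to \<open>X t\<close> and moving the projection
    across shows that \<open>X t \<bullet> (D - P s D)\<close> vanishes for \<open>t\<close> near
    \<open>s\<close>. Its derivative at \<open>s\<close>, which is the squared norm of
    \<open>D - P s D\<close>, is therefore zero.\<close>
  have "D \<bullet> (D - P s D) = 0"
  proof (rule DERIV_local_min[OF X_inner_derivative[OF ev(2)] ev(1)], intro allI impI)
    fix t assume "\<bar>s - t\<bar> < s"
    then have "0 \<le> t" by auto
    then have "X t \<bullet> (D - P s D) = 0"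
      using orth[of "X t"] Q_self_adjoint[OF s, of "X t" D] by (simp add: inner_commute)
    then show "X s \<bullet> (D - P s D) \<le> X t \<bullet> (D - P s D)"
      using Q_inner_H[OF s X_in_H[OF s]] by simp
  qed
  then have "(D - P s D) \<bullet> (D - P s D) = 0"
    using Q_inner_H[OF s P_in[OF s], of D D] by (simp add: inner_diff_left)
  then have DH: "D \<in> H s" using P_in[OF s, of D] by simp
  \<comment> \<open>Both summands lie in \<open>H s\<close>, to which the subdifferential element is
    orthogonal; so the inclusion is the orthogonal decomposition of \<open>Psibar\<close>.\<close>
  have "P s Psibar = A s + D"
    using subspace_Hspace[of "X s"] DH A_in_H[OF s] s ev(4)
    by (intro P_eqI) (auto intro: subspace_add simp: diff_diff_eq)
  then show "D = P s Psibar - A s" by simp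
  have "Psibar \<bullet> (Y - P s Y) \<le> 0" if "Y \<in> \<K>" for Y
    using ev(3)[OF that] Q_self_adjoint[OF s, of Psibar Y] \<open>P s Psibar = A s + D\<close>
    by (simp add: diff_diff_eq)
  then show "sticky_time s" by (simp add: sticky_time_def)
qed

lemma sticky_time_imp_H:
  assumes st: "0 \<le> s" "s \<le> t" and sticky: "sticky_time s"
  shows "X t \<in> H s"
proof -
  define Q where "Q U = U - P s U" for U
  have blQ: "bounded_linear Q"
    unfolding Q_def by (intro bounded_linear_sub bounded_linear_ident bounded_linear_P st)
  have QQ: "Q U \<bullet> Q V = U \<bullet> Q V" for U V
    using Q_inner_H[OF st(1) P_in[OF st(1), of U], of V] by (simp add: Q_def inner_diff_left)
  have "Q (X t) \<bullet> Q (X t) \<le> Q (X s) \<bullet> Q (X s)"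
  proof (rule absolutely_continuous_nonincreasing[OF st(2)])
    have "compact (X ` {s..t})"
      by (intro compact_continuous_image continuous_on_subset[OF continuous_on_X]) (use st in auto)
    then obtain M where M: "M > 0" "\<And>r. r \<in> {s..t} \<Longrightarrow> norm (X r) \<le> M"
      using compact_imp_bounded bounded_pos by (metis image_eqI)
    obtain k where k: "k > 0" "\<And>U. norm (Q U) \<le> norm U * k"
      using bounded_linear.pos_bounded[OF blQ] by blast
    have "absolutely_continuous_on {s..t} X"
      by (rule absolutely_continuous_on_subset[OF X_ac[of t]]) (use st in auto)
    then show "absolutely_continuous_on {s..t} (\<lambda>r. Q (X r) \<bullet> Q (X r))"
    proof (rule absolutely_continuous_on_compose)
      show "0 \<le> 2 * M * k * k" using M k by simp
      fix a b assume ab: "a \<in> {s..t}" "b \<in> {s..t}"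
      have "Q (X a) \<bullet> Q (X a) - Q (X b) \<bullet> Q (X b) = Q (X a - X b) \<bullet> Q (X a + X b)"
        using bounded_linear.linear[OF blQ]
        by (simp add: linear_diff linear_add inner_diff_left inner_diff_right inner_add_right inner_commute)
      then have "dist (Q (X a) \<bullet> Q (X a)) (Q (X b) \<bullet> Q (X b)) \<le> norm (Q (X a - X b)) * norm (Q (X a + X b))"
        using Cauchy_Schwarz_ineq2[of "Q (X a - X b)" "Q (X a + X b)"] by (simp add: dist_real_def)
      also have "\<dots> \<le> (norm (X a - X b) * k) * (norm (X a + X b) * k)"
        by (intro mult_mono k(2)) (use k(1) in auto)
      also have "\<dots> \<le> (norm (X a - X b) * k) * ((2 * M) * k)"
        using M(2)[OF ab(1)] M(2)[OF ab(2)] k(1) norm_triangle_ineq[of "X a" "X b"]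
        by (intro mult_left_mono mult_right_mono) auto
      finally show "dist (Q (X a) \<bullet> Q (X a)) (Q (X b) \<bullet> Q (X b)) \<le> 2 * M * k * k * dist (X a) (X b)"
        by (simp add: dist_norm mult_ac)
    qed
    show "AE r in lborel. s < r \<and> r < t \<longrightarrow>
        (\<exists>D\<le>0. ((\<lambda>r. Q (X r) \<bullet> Q (X r)) has_real_derivative D) (at r))"
      using AE_evolves
    proof eventually_elim
      case (elim r)
      show ?case
      proof
        assume r: "s < r \<and> r < t"
        with elim st obtain D where "evolves r D" by auto
        note ev = evolvesD[OF this]
        have r0: "0 \<le> r" using ev(1) by simp
        have "((\<lambda>r. Q (X r)) has_vector_derivative Q D) (at r)"
          by (rule bounded_linear.has_vector_derivative[OF blQ ev(2)])
        moreover have sym: "Q D \<bullet> Q (X r) = D \<bullet> Q (X r)" "Q (X r) \<bullet> Q D = D \<bullet> Q (X r)"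
          by (rule QQ) (metis QQ inner_commute)
        ultimately
        have "((\<lambda>r. Q (X r) \<bullet> Q (X r)) has_real_derivative 2 * (D \<bullet> Q (X r))) (at r)"
          using bounded_bilinear.has_vector_derivative[OF bounded_bilinear_inner, of "\<lambda>r. Q (X r)" "Q D" r UNIV "\<lambda>r. Q (X r)" "Q D"]
          by (simp add: has_real_derivative_iff_has_vector_derivative)
        \<comment> \<open>Write \<open>D = Psibar - A r - W\<close> with \<open>W\<close> in the
          subdifferential. Then \<open>W \<bullet> Q (X r)\<close> is nonnegative, as
          \<open>W\<close> annihilates \<open>X r\<close> and is nonpositive at
          \<open>P s (X r)\<close>; \<open>Psibar\<close> contributes a nonpositive pairing by
          \<open>sticky\<close>, and \<open>A r\<close> a nonnegative one by Chebyshev.\<close>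
        moreover have "D \<bullet> Q (X r) \<le> 0"
        proof -
          have "(Psibar - A r - D) \<bullet> P s (X r) \<le> 0" "(Psibar - A r - D) \<bullet> X r = 0"
            using ev(3,4) P_Kcone[OF st(1)] X_in_H r0 by auto
          then have "0 \<le> (Psibar - A r - D) \<bullet> Q (X r)" by (simp add: Q_def inner_diff_right)
          moreover have "Psibar \<bullet> Q (X r) \<le> 0" using sticky r0 by (simp add: sticky_time_def Q_def)
          moreover have "0 \<le> A r \<bullet> Q (X r)"
            unfolding Q_def by (intro Q_Kcone_nonneg st A_in_K r0 X_in)
          ultimately show ?thesis by (simp add: inner_diff_left)
        qed
        ultimately show "\<exists>D\<le>0. ((\<lambda>r. Q (X r) \<bullet> Q (X r)) has_real_derivative D) (at r)"
          by (intro exI[of _ "2 * (D \<bullet> Q (X r))"]) simp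
      qed
    qed
  qed
  moreover have "Q (X s) = 0" using P_id[OF st(1) X_in_H[OF st(1)]] by (simp add: Q_def)
  ultimately have "Q (X t) \<bullet> Q (X t) = 0" using inner_ge_zero[of "Q (X t)"] by simp
  then have "X t = P s (X t)" by (simp add: Q_def)
  then show ?thesis using P_in[OF st(1), of "X t"] by simp
qed

lemma sticky_time_imp_Omega_flat:
  assumes "0 \<le> s" "s \<le> t" "sticky_time s"
  shows "Omega_flat (X s) \<subseteq> Omega_flat (X t)"
  using assms by (intro Omega_flat_mono_Hspace sticky_time_imp_H) auto

lemma Psibar_in_H_0: "Psibar \<in> H 0"
  using Vbar A_in_H[of 0] subspace_Hspace[OF X_in[of 0]]
  by (simp add: X_0 Psibar_def Psi_def subspace_add)

text \<open>For almost every time this is part of \<open>evolves_imp\<close>; at an arbitrary \<open>s\<close> it follows by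
  letting \<open>r\<close> increase to \<open>s\<close>, using stickiness from almost every \<open>\<tau>\<close> in \<open>{r..s}\<close>.\<close>

lemma sticky_time:
  assumes s: "0 \<le> s"
  shows "sticky_time s"
proof (cases "s = 0")
  case True
  then show ?thesis
    using Q_inner_H[OF s] Psibar_in_H_0 by (simp add: sticky_time_def)
next
  case False
  show ?thesis
    unfolding sticky_time_def
  proof (rule ballI, rule ccontr)
    fix Y assume Y: "Y \<in> \<K>" and neg: "\<not> Psibar \<bullet> (Y - P s Y) \<le> 0"
    define Z where "Z = Y - P s Y"
    define c where "c = Psibar \<bullet> Z"
    have c: "0 < c" using neg by (simp add: c_def Z_def)
    have "continuous_on {0..} (\<lambda>t. A t \<bullet> Z)" by (intro continuous_intros continuous_on_A)
    then have "\<exists>d>0. \<forall>t\<in>{0..}. dist t s < d \<longrightarrow> dist (A t \<bullet> Z) (A s \<bullet> Z) < c / 2"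
      using s c unfolding continuous_on_iff by (meson atLeast_iff half_gt_zero)
    then obtain d where d: "d > 0" "\<And>t. 0 \<le> t \<Longrightarrow> \<bar>t - s\<bar> < d \<Longrightarrow> \<bar>A t \<bullet> Z - A s \<bullet> Z\<bar> < c / 2"
      by (auto simp: dist_real_def)
    have As: "A s \<bullet> Z = 0" unfolding Z_def by (rule Q_inner_H[OF s A_in_H[OF s]])
    define r where "r = max 0 (s - d / 2)"
    have r: "0 \<le> r" "r < s" "s - r < d" using d(1) False s by (auto simp: r_def)
    \<comment> \<open>With \<open>c\<close> positive, \<open>X t \<bullet> Z\<close> would grow at
      rate at least \<open>c / 2\<close> on \<open>{r..s}\<close>; but it is nonnegative at
      \<open>r\<close> and zero at \<open>s\<close>.\<close>
    have "X s \<bullet> (- Z) + c / 2 * s \<le> X r \<bullet> (- Z) + c / 2 * r"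
    proof (rule X_nonincreasing[where g' = "\<lambda>_. c / 2"])
      show "((*) (c / 2) has_real_derivative c / 2) (at t within {r..s})" for t
        by (auto intro!: derivative_eq_intros)
      fix t D assume t: "r < t" "t < s" and D: "evolves t D"
      note ev = evolvesD[OF D]
      have t0: "0 \<le> t" using ev(1) by simp
      \<comment> \<open>Stickiness from the evolving time \<open>t\<close> puts \<open>P s Y\<close>
        in \<open>H t\<close>, where the subdifferential element at \<open>t\<close> does not see
        it; only its sign at \<open>Y\<close> remains.\<close>
      have "H s \<subseteq> H t"
        using t t0 by (intro Omega_flat_antimono_Hspace sticky_time_imp_Omega_flat evolves_imp(2)[OF D]) auto
      then have "(Psibar - A t - D) \<bullet> P s Y = 0" using ev(4) P_in[OF s] by blast
      then have "(Psibar - A t - D) \<bullet> Z \<le> 0" using ev(3)[OF Y] by (simp add: Z_def inner_diff_right)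
      moreover have "A t \<bullet> Z < c / 2" using d(2)[OF t0] t r(3) As by (simp add: abs_less_iff)
      ultimately show "D \<bullet> (- Z) + c / 2 \<le> 0" by (simp add: inner_diff_left c_def)
    qed (use r in auto)
    moreover have "X s \<bullet> Z = 0" unfolding Z_def by (rule Q_inner_H[OF s X_in_H[OF s]])
    moreover have "0 \<le> X r \<bullet> Z" unfolding Z_def using r by (intro Q_Kcone_nonneg s Y X_in)
    ultimately have "c * s \<le> c * r" by simp
    then show False using c r(2) by simp
  qed
qed

lemma globally_sticky_X: "globally_sticky X"
  using sticky_time_imp_Omega_flat sticky_time by (simp add: globally_sticky_def)

section \<open>The nested family of projections\<close>

lemma H_antimono: "0 \<le> s \<Longrightarrow> s \<le> t \<Longrightarrow> H t \<subseteq> H s"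
  by (intro Omega_flat_antimono_Hspace sticky_time_imp_Omega_flat sticky_time)

lemma P_P:
  assumes "0 \<le> s" "s \<le> t"
  shows "P t (P s U) = P t U" "P s (P t U) = P t U"
proof -
  have t: "0 \<le> t" using assms by simp
  have "(P s U - P t U) \<bullet> V = 0" if "V \<in> H t" for V
    using P_orth[OF t that, of U] P_orth[OF assms(1), of V U] H_antimono[OF assms] that
    by (auto simp: inner_diff_left)
  then show "P t (P s U) = P t U"
    by (intro P_eqI t P_in)
  show "P s (P t U) = P t U"
    using P_in[OF t] H_antimono[OF assms] by (intro P_id assms) auto
qed

text \<open>Self-adjointness and nesting turn the pairing with \<open>Y\<close> into
  \<open>Psibar \<bullet> (Y' - P t Y')\<close> for \<open>Y' = P s Y\<close>, an admissible test
  for \<open>sticky_time\<close> at \<open>t\<close> because \<open>P s\<close> preserves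
  \<open>\<K>\<close>.\<close>

lemma P_Psibar_diff_subdiff:
  assumes st: "0 \<le> s" "s \<le> t"
  shows "P s Psibar - P t Psibar \<in> subdiff_K (X t)"
proof -
  have t: "0 \<le> t" using st by simp
  have "(P s Psibar - P t Psibar) \<bullet> Y \<le> 0" if Y: "Y \<in> \<K>" for Y
  proof -
    have "(P s Psibar - P t Psibar) \<bullet> Y = P s (Psibar - P t Psibar) \<bullet> Y"
      using P_P(2)[OF st] P_diff[OF st(1)] by simp
    also have "\<dots> = (Psibar - P t Psibar) \<bullet> P s Y" by (rule P_self_adjoint[OF st(1)])
    also have "\<dots> = Psibar \<bullet> (P s Y - P t (P s Y))" by (rule Q_self_adjoint[OF t])
    also have "\<dots> \<le> 0"
      using sticky_time[OF t] P_Kcone[OF st(1) Y] by (simp add: sticky_time_def)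
    finally show ?thesis .
  qed
  moreover have "(P s Psibar - P t Psibar) \<bullet> U = 0" if "U \<in> H t" for U
    using P_orth[OF t that, of "P s Psibar"] by (simp add: P_P(1)[OF st])
  ultimately show ?thesis using t by (simp add: mem_subdiff_K_iff_Hspace)
qed

text \<open>Right continuity of the projections: by continuity of \<open>X\<close>, the functions
  \<open>max 0 (X t - c)\<close>, which determine the orthogonal complement of \<open>H t\<close>, are limits of elements of
  \<open>H \<tau>\<close> with \<open>\<tau> > t\<close>.\<close>

lemma P_right_continuous:
  assumes t: "0 \<le> t" and e: "0 < e"
  obtains d where "d > 0" "\<And>\<tau>. t \<le> \<tau> \<Longrightarrow> \<tau> < t + d \<Longrightarrow> norm (P \<tau> U - P t U) < e"
proof -
  \<comment> \<open>The spaces grow as \<open>\<tau>\<close> decreases to \<open>t\<close>, which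
    makes the union a subspace.\<close>
  define M0 where "M0 = (\<Union>\<tau>\<in>{t<..}. H \<tau>)"
  have M0I: "V \<in> H \<tau> \<Longrightarrow> t < \<tau> \<Longrightarrow> V \<in> M0" for V \<tau> by (auto simp: M0_def)
  have subH: "subspace (H \<tau>)" if "t < \<tau>" for \<tau> using t that by (intro subspace_Hspace) auto
  have "subspace M0"
    unfolding subspace_def
  proof (intro conjI ballI allI)
    show "0 \<in> M0" using subspace_0[OF subH[of "t + 1"]] by (intro M0I[of _ "t + 1"]) auto
  next
    fix U V assume "U \<in> M0" "V \<in> M0"
    then obtain a b where ab: "t < a" "U \<in> H a" "t < b" "V \<in> H b" by (auto simp: M0_def)
    then have "U \<in> H (min a b)" "V \<in> H (min a b)"
      using H_antimono[of "min a b" a] H_antimono[of "min a b" b] t by auto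
    then have "U + V \<in> H (min a b)" using ab subH by (intro subspace_add) auto
    then show "U + V \<in> M0" using ab by (intro M0I[of _ "min a b"]) auto
  next
    fix c U assume "U \<in> M0"
    then show "c *\<^sub>R U \<in> M0" using subH by (auto simp: M0_def intro: subspace_scale)
  qed
  then have M: "subspace (closure M0)" by (rule subspace_closure_real_normed)
  note PM = metric_proj_subspace[OF M closed_closure]
  have MH: "closure M0 \<subseteq> H t"
    unfolding M0_def using t
    by (intro closure_minimal UN_least H_antimono closed_Hspace) auto
  have approx: "abs_l2 (\<lambda>m. max 0 (mono_repr (X t) m - c)) \<in> closure M0" for c
    unfolding closure_approachable
  proof (intro allI impI)
    fix \<eta> :: real assume "0 < \<eta>"
    then have "\<exists>d>0. \<forall>\<tau>\<in>{0..}. dist \<tau> t < d \<longrightarrow> dist (X \<tau>) (X t) < \<eta>"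
      using continuous_on_X t unfolding continuous_on_iff by (meson atLeast_iff)
    then obtain d where d: "d > 0" "\<And>\<tau>. 0 \<le> \<tau> \<Longrightarrow> \<bar>\<tau> - t\<bar> < d \<Longrightarrow> dist (X \<tau>) (X t) < \<eta>"
      by (auto simp: dist_real_def)
    define \<tau> where "\<tau> = t + d / 2"
    have \<tau>: "t < \<tau>" "0 \<le> \<tau>" "dist (X \<tau>) (X t) < \<eta>" using d t by (auto simp: \<tau>_def intro!: d(2))
    note f = positive_part_Kcone(2)[OF X_in[OF \<tau>(2)], of c] and g = positive_part_Kcone(2)[OF X_in[OF t], of c]
    note f' = mono_reprD[OF X_in[OF \<tau>(2)]] and g' = mono_reprD[OF X_in[OF t]]
    have "norm (abs_l2 (\<lambda>m. max 0 (mono_repr (X \<tau>) m - c)) - abs_l2 (\<lambda>m. max 0 (mono_repr (X t) m - c)))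
        = norm (abs_l2 (\<lambda>m. max 0 (mono_repr (X \<tau>) m - c) - max 0 (mono_repr (X t) m - c)))"
      using f g by (subst minus_l2.abs_eq) auto
    also have "\<dots> \<le> norm (abs_l2 (\<lambda>m. mono_repr (X \<tau>) m - mono_repr (X t) m))"
      using f g f'(1) g'(1) by (intro norm_abs_l2_mono square_integrable_diff) (auto simp: max_def)
    also have "abs_l2 (\<lambda>m. mono_repr (X \<tau>) m - mono_repr (X t) m)
        = abs_l2 (mono_repr (X \<tau>)) - abs_l2 (mono_repr (X t))"
      using f'(1) g'(1) by (subst minus_l2.abs_eq) auto
    finally have "dist (abs_l2 (\<lambda>m. max 0 (mono_repr (X \<tau>) m - c))) (abs_l2 (\<lambda>m. max 0 (mono_repr (X t) m - c))) < \<eta>"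
      using \<tau>(3) f'(2) g'(2) by (simp add: dist_norm)
    moreover have "abs_l2 (\<lambda>m. max 0 (mono_repr (X \<tau>) m - c)) \<in> M0"
      using f \<tau> by (intro M0I[of _ \<tau>] abs_l2_in_Hspace[where u = "\<lambda>x. max 0 (x - c)"]) auto
    ultimately show "\<exists>V\<in>M0. dist V (abs_l2 (\<lambda>m. max 0 (mono_repr (X t) m - c))) < \<eta>" by blast
  qed
  have one: "abs_l2 (\<lambda>_. 1) \<in> closure M0"
  proof -
    have "abs_l2 (\<lambda>m. 1) \<in> H (t + 1)"
      using t by (intro abs_l2_in_Hspace[where u = "\<lambda>_. 1"]) auto
    then show ?thesis using closure_subset M0I[of _ "t + 1"] by auto
  qed
  define p where "p = P t U"
  \<comment> \<open>\<open>W\<close> lies in \<open>H t\<close> and is orthogonal to the truncations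
    of \<open>X t\<close> and to 1, hence to all of \<open>H t\<close> and so to itself:
    \<open>p\<close> already belongs to the closure.\<close>
  define W where "W = p - metric_proj (closure M0) p"
  have p: "p \<in> H t" using P_in[OF t] by (simp add: p_def)
  have "W \<in> H t"
    unfolding W_def by (rule subspace_diff[OF subspace_Hspace[OF X_in[OF t]] p subsetD[OF MH PM(1)]])
  have "W \<bullet> W = 0"
  proof (rule orthogonal_Hspace[OF X_in[OF t] _ _ \<open>W \<in> H t\<close>])
    show "W \<bullet> abs_l2 (\<lambda>m. max 0 (mono_repr (X t) m - c)) = 0" for c
      unfolding W_def by (rule PM(2)[OF approx])
    show "W \<bullet> abs_l2 (\<lambda>_. 1) = 0" unfolding W_def by (rule PM(2)[OF one])
  qed
  then have "p \<in> closure M0" using PM(1)[of p] by (simp add: W_def)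
  then obtain h where "h \<in> M0" and h: "dist h p < e" using e unfolding closure_approachable by blast
  then obtain \<tau>0 where \<tau>0: "t < \<tau>0" "h \<in> H \<tau>0" by (auto simp: M0_def)
  \<comment> \<open>The approximant \<open>h\<close> lies in \<open>H \<tau>\<close> for all
    \<open>\<tau>\<close> from \<open>t\<close> up to \<open>\<tau>0\<close>, so one vector bounds
    the distance of \<open>p\<close> to all these spaces.\<close>
  show ?thesis
  proof (rule that[of "\<tau>0 - t"])
    show "0 < \<tau>0 - t" using \<tau>0 by simp
    fix \<tau> assume \<tau>: "t \<le> \<tau>" "\<tau> < t + (\<tau>0 - t)"
    then have \<tau>': "0 \<le> \<tau>" "h \<in> H \<tau>" using t \<tau>0 H_antimono[of \<tau> \<tau>0] by auto
    have "P \<tau> U = P \<tau> p" unfolding p_def using P_P(1)[OF t \<tau>(1)] by simp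
    moreover have "norm (p - P \<tau> p) \<le> norm (p - h)"
    proof -
      define a b where "a = p - P \<tau> p" and "b = P \<tau> p - h"
      have "a \<bullet> b = 0"
        unfolding a_def b_def
        by (rule P_orth[OF \<tau>'(1) subspace_diff[OF subspace_Hspace[OF X_in[OF \<tau>'(1)]] P_in[OF \<tau>'(1)] \<tau>'(2)]])
      then have "(a + b) \<bullet> (a + b) = a \<bullet> a + b \<bullet> b"
        by (simp add: inner_add_left inner_add_right inner_commute[of b a])
      moreover have "p - h = a + b" by (simp add: a_def b_def)
      ultimately have "(p - h) \<bullet> (p - h) = a \<bullet> a + b \<bullet> b" by simp
      then have "norm a \<le> norm (p - h)" by (simp add: norm_le)
      then show ?thesis by (simp add: a_def)
    qed
    ultimately show "norm (P \<tau> U - P t U) < e"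
      using h by (simp add: dist_norm norm_minus_commute flip: p_def)
  qed
qed

section \<open>Right derivative and projection formulas\<close>

lemma right_derivative:
  assumes t: "0 \<le> t"
  shows "(X has_vector_derivative (P t Psibar - A t)) (at_right t)"
  unfolding has_vector_derivative_def has_derivative_within_alt
proof (intro conjI allI impI)
  show "bounded_linear (\<lambda>h. h *\<^sub>R (P t Psibar - A t))" by (rule bounded_linear_scaleR_left)
  fix \<eta> :: real assume \<eta>: "0 < \<eta>"
  define v where "v = P t Psibar - A t"
  obtain d1 where d1: "d1 > 0" "\<And>\<tau>. t \<le> \<tau> \<Longrightarrow> \<tau> < t + d1 \<Longrightarrow> norm (P \<tau> Psibar - P t Psibar) < \<eta> / 2"
    using P_right_continuous[OF t, of "\<eta> / 2"] \<eta> by auto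
  have "\<exists>d>0. \<forall>\<tau>\<in>{0..}. dist \<tau> t < d \<longrightarrow> dist (A \<tau>) (A t) < \<eta> / 2"
    using continuous_on_A t \<eta> unfolding continuous_on_iff by (meson atLeast_iff half_gt_zero)
  then obtain d2 where d2: "d2 > 0" "\<And>\<tau>. 0 \<le> \<tau> \<Longrightarrow> \<bar>\<tau> - t\<bar> < d2 \<Longrightarrow> norm (A \<tau> - A t) < \<eta> / 2"
    by (auto simp: dist_norm)
  have "norm (X y - X t - (y - t) *\<^sub>R v) \<le> \<eta> * (y - t)" if y: "t < y" "y < t + min d1 d2" for y
  proof -
    \<comment> \<open>The error vector is its own test vector, so the scalar comparison bounds its
      squared norm by \<open>\<eta> * (y - t) * norm w\<close>. The constant \<open>c\<close> is
      minus the upper bound for \<open>D \<bullet> w\<close> at evolving times.\<close>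
    define w where "w = X y - X t - (y - t) *\<^sub>R v"
    define c where "c = - (v \<bullet> w + \<eta> * norm w)"
    have "X y \<bullet> w + c * y \<le> X t \<bullet> w + c * t"
    proof (rule X_nonincreasing[where g' = "\<lambda>_. c"])
      show "((*) c has_real_derivative c) (at r within {t..y})" for r
        by (auto intro!: derivative_eq_intros)
      fix \<tau> D assume \<tau>: "t < \<tau>" "\<tau> < y" and D: "evolves \<tau> D"
      have "D - v = (P \<tau> Psibar - P t Psibar) - (A \<tau> - A t)"
        by (simp add: evolves_imp(1)[OF D] v_def)
      then have "norm (D - v) \<le> norm (P \<tau> Psibar - P t Psibar) + norm (A \<tau> - A t)"
        by (metis norm_triangle_ineq4)
      also have "\<dots> < \<eta> / 2 + \<eta> / 2"
        using \<tau> y t by (intro add_strict_mono d1(2) d2(2)) auto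
      also have "\<dots> = \<eta>" by simp
      finally have "norm (D - v) \<le> \<eta>" by simp
      then have "norm (D - v) * norm w \<le> \<eta> * norm w" by (rule mult_right_mono) simp
      then have "(D - v) \<bullet> w \<le> \<eta> * norm w" using norm_cauchy_schwarz[of "D - v" w] by linarith
      then show "D \<bullet> w + c \<le> 0" by (simp add: c_def inner_diff_left)
    qed (use y t in auto)
    then have "(X y - X t - (y - t) *\<^sub>R v) \<bullet> w \<le> \<eta> * norm w * (y - t)"
      by (simp add: c_def inner_diff_left algebra_simps)
    then have "norm w * norm w \<le> \<eta> * (y - t) * norm w"
      by (simp add: mult_ac flip: w_def power2_norm_eq_inner power2_eq_square)
    then have "norm w \<le> \<eta> * (y - t)"
      using \<eta> y by (cases "norm w = 0") auto
    then show ?thesis by (simp add: w_def)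
  qed
  then show "\<exists>d>0. \<forall>y\<in>{t<..}. norm (y - t) < d \<longrightarrow>
      norm (X y - X t - (y - t) *\<^sub>R (P t Psibar - A t)) \<le> \<eta> * norm (y - t)"
    using d1(1) d2(1) by (intro exI[of _ "min d1 d2"]) (auto simp: v_def)
qed

text \<open>The argument of the projection exceeds \<open>X t\<close> by the accumulated reaction
  \<open>P s Psibar - P \<tau> Psibar\<close>, which lies in \<open>subdiff_K (X \<tau>)\<close>.
  Stickiness puts \<open>X t\<close> in \<open>H \<tau>\<close>, so each contribution is orthogonal
  to \<open>X t\<close> and nonpositive at \<open>Y\<close>: the angle is obtuse.\<close>

lemma X_eq_proj:
  assumes st: "0 \<le> s" "s \<le> t"
  shows "X t = metric_proj \<K> (X s + (t - s) *\<^sub>R P s Psibar - integral {s..t} A)"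
proof (rule metric_proj_eqI[symmetric])
  show "X t \<in> \<K>" using st by simp
  fix Y assume Y: "Y \<in> \<K>"
  define g where "g \<tau> = ((\<tau> - s) *\<^sub>R P s Psibar - integral {s..\<tau>} A) \<bullet> (Y - X t)" for \<tau>
  have "X t \<bullet> (X t - Y) + g t \<le> X s \<bullet> (X t - Y) + g s"
  proof (rule X_nonincreasing[OF st])
    fix \<tau> assume \<tau>: "\<tau> \<in> {s..t}"
    have "((\<lambda>\<tau>. integral {s..\<tau>} A) has_vector_derivative A \<tau>) (at \<tau> within {s..t})"
      using continuous_on_A_interval[OF st(1)] \<tau> by (rule integral_has_vector_derivative)
    then have "((\<lambda>\<tau>. (\<tau> - s) *\<^sub>R P s Psibar - integral {s..\<tau>} A) has_vector_derivative P s Psibar - A \<tau>) (at \<tau> within {s..t})"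
      by (auto intro!: derivative_eq_intros)
    from bounded_linear.has_vector_derivative[OF bounded_linear_inner_left[of "Y - X t"] this]
    show "(g has_real_derivative (P s Psibar - A \<tau>) \<bullet> (Y - X t)) (at \<tau> within {s..t})"
      by (simp add: g_def[abs_def] has_real_derivative_iff_has_vector_derivative)
  next
    show "continuous_on {s..t} (\<lambda>\<tau>. (P s Psibar - A \<tau>) \<bullet> (Y - X t))"
      by (intro continuous_intros continuous_on_A_interval st)
  next
    fix \<tau> D assume \<tau>: "s < \<tau>" "\<tau> < t" and D: "evolves \<tau> D"
    have \<tau>0: "0 \<le> \<tau>" using st \<tau> by simp
    have "X t \<in> H \<tau>" using X_in_H[of t] H_antimono[of \<tau> t] \<tau> \<tau>0 by auto
    then have "(P s Psibar - P \<tau> Psibar) \<bullet> (Y - X t) \<le> 0"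
      using P_Psibar_diff_subdiff[of s \<tau>] Y st \<tau> \<tau>0
      by (simp add: mem_subdiff_K_iff_Hspace inner_diff_right)
    then show "D \<bullet> (X t - Y) + (P s Psibar - A \<tau>) \<bullet> (Y - X t) \<le> 0"
      by (simp add: evolves_imp(1)[OF D] inner_diff_left inner_diff_right)
  qed
  then show "(X s + (t - s) *\<^sub>R P s Psibar - integral {s..t} A - X t) \<bullet> (Y - X t) \<le> 0"
    by (simp add: g_def inner_diff_left inner_diff_right inner_add_left)
qed

end

theorem corollary4p17:
  fixes \<phi> :: "real \<Rightarrow> real" and Xbar Vbar Psibar :: l2 and X V Psi_t :: "real \<Rightarrow> l2"
  assumes protocol: "communication_protocol \<phi>"
    and Xbar: "Xbar \<in> \<K>"
    and Vbar: "Vbar \<in> Hspace Xbar"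
    and solution: "lagrangian_solution \<phi> Xbar Vbar X"
    and V_def: "\<forall>t\<ge>0. V t = vector_derivative X (at_right t)"
    and Psi_t_def: "\<forall>t\<ge>0. Psi_t t = Psi \<phi> (X t) (V t)"
    and Psibar_def: "Psibar = Psi \<phi> Xbar Vbar"
  shows "globally_sticky X
    \<and> (\<forall>t\<ge>0. (X has_vector_derivative V t) (at_right t))
    \<and> (\<forall>t\<ge>0. V t \<in> Hspace (X t) \<and> Psi_t t \<in> Hspace (X t))
    \<and> (\<forall>s t. 0 \<le> s \<and> s \<le> t \<longrightarrow>
           Psi_t s - Psi_t t \<in> subdiff_K (X t)
         \<and> Psi_t t = metric_proj (Hspace (X t)) (Psi_t s)
         \<and> X t = metric_proj \<K>
             (X s + (t - s) *\<^sub>R Psi_t s - integral {s..t} (\<lambda>r. conv_law \<phi> (X r))))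
    \<and> (\<forall>t\<ge>0.
           V t = metric_proj (Hspace (X t)) (velocity_U \<phi> Xbar Vbar (X t))
         \<and> V t = metric_proj (Hspace (X t)) Psibar - conv_law \<phi> (X t)
         \<and> Psi_t t = metric_proj (Hspace (X t)) Psibar
         \<and> X t = metric_proj \<K> (Xbar + integral {0..t} (\<lambda>s. velocity_U \<phi> Xbar Vbar (X s)))
         \<and> X t = metric_proj \<K>
             (Xbar + t *\<^sub>R Psibar - integral {0..t} (\<lambda>s. conv_law \<phi> (X s))))
    \<and> (\<forall>t\<ge>0. \<exists>v. square_integrable (law (X t)) v \<and> V t = abs_l2 (v \<circ> mono_repr (X t))
         \<and> (\<forall>w. square_integrable (law (X t)) w \<and> V t = abs_l2 (w \<circ> mono_repr (X t))
               \<longrightarrow> (AE x in law (X t). w x = v x)))"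
proof -
  interpret lagrangian_flow \<phi> Xbar Vbar X
    by unfold_locales (use protocol Vbar solution in auto)
  have Psibar: "Psibar = lagrangian_flow.Psibar \<phi> Xbar Vbar"
    by (simp add: assms(7) lagrangian_flow.Psibar_def[OF lagrangian_flow_axioms])
  note subspace_H = subspace_Hspace[OF X_in]
  have V: "V t = P t Psibar - A t" if "0 \<le> t" for t
    using V_def that vector_derivative_within[OF trivial_limit_at_right_real right_derivative[OF that]]
    by (simp add: Psibar)
  have Psi_t: "Psi_t t = P t Psibar" if "0 \<le> t" for t
    using Psi_t_def V[OF that] that by (simp add: Psi_def)
  have V_in: "V t \<in> H t" if "0 \<le> t" for t
    unfolding V[OF that] by (intro subspace_diff subspace_H P_in A_in_H that)
  have U_eq: "velocity_U \<phi> Xbar Vbar (X t) = Psibar - A t" if "0 \<le> t" for t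
    using velocity_U_eq[OF that] by (simp add: Psibar)
  \<comment> \<open>At \<open>s = 0\<close> the projection leaves \<open>Psibar\<close> unchanged,
    by the hypothesis on \<open>Vbar\<close>.\<close>
  have X_eq_0: "X t = metric_proj \<K> (Xbar + t *\<^sub>R Psibar - integral {0..t} A)" if "0 \<le> t" for t
    using X_eq_proj[OF order_refl that] P_id[OF order_refl Psibar_in_H_0] by (simp add: X_0 Psibar)
  show ?thesis
  proof (intro conjI allI impI)
    show "globally_sticky X" by (rule globally_sticky_X)
  next
    fix t :: real assume t: "0 \<le> t"
    show "(X has_vector_derivative V t) (at_right t)"
      using right_derivative[OF t] by (simp add: V[OF t] Psibar)
    show "V t \<in> H t" by (rule V_in[OF t])
    show "Psi_t t \<in> H t" unfolding Psi_t[OF t] by (rule P_in[OF t])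
    show "V t = P t (velocity_U \<phi> Xbar Vbar (X t))"
      by (simp add: U_eq[OF t] P_diff[OF t] P_id[OF t A_in_H[OF t]] V[OF t])
    show "V t = P t Psibar - A t" by (rule V[OF t])
    show "Psi_t t = P t Psibar" by (rule Psi_t[OF t])
    show "X t = metric_proj \<K> (Xbar + t *\<^sub>R Psibar - integral {0..t} A)"
      by (rule X_eq_0[OF t])
    have "integral {0..t} (\<lambda>s. velocity_U \<phi> Xbar Vbar (X s)) = integral {0..t} (\<lambda>s. Psibar - A s)"
      by (rule integral_cong) (simp add: U_eq)
    also have "\<dots> = t *\<^sub>R Psibar - integral {0..t} A"
      using t by (subst integral_diff)
        (auto intro: integrable_continuous_real continuous_on_A_interval)
    finally show "X t = metric_proj \<K> (Xbar + integral {0..t} (\<lambda>s. velocity_U \<phi> Xbar Vbar (X s)))"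
      using X_eq_0[OF t] by (simp add: add_diff_eq)
  next
    fix s t :: real assume st: "0 \<le> s \<and> s \<le> t"
    then have s: "0 \<le> s" and t: "0 \<le> t" by auto
    show "Psi_t s - Psi_t t \<in> subdiff_K (X t)"
      unfolding Psi_t[OF s] Psi_t[OF t] Psibar using st by (intro P_Psibar_diff_subdiff) auto
    show "Psi_t t = P t (Psi_t s)"
      unfolding Psi_t[OF s] Psi_t[OF t] using st by (simp add: P_P)
    show "X t = metric_proj \<K> (X s + (t - s) *\<^sub>R Psi_t s - integral {s..t} A)"
      unfolding Psi_t[OF s] Psibar using st by (intro X_eq_proj) auto
  next
    fix t :: real assume t: "0 \<le> t"
    note f = mono_reprD(4)[OF X_in[OF t]]
    \<comment> \<open>Change of variables along \<open>mono_repr (X t)\<close>, used both for the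
      existence of \<open>v\<close> and to compare it with any other candidate.\<close>
    have comp: "square_integrable \<mm> (w \<circ> mono_repr (X t)) \<longleftrightarrow> square_integrable (law (X t)) w"
      if w: "w \<in> borel_measurable borel" for w
    proof -
      have "(\<lambda>x. (w x)\<^sup>2) \<in> borel_measurable borel" using w by measurable
      from integrable_distr_eq[OF f this] show ?thesis
        using w f measurable_compose[OF f w] by (simp add: square_integrable_def law_def o_def)
    qed
    have law_meas: "square_integrable (law (X t)) w \<Longrightarrow> w \<in> borel_measurable borel" for w
      by (simp add: square_integrable_def law_def)
    obtain v where v: "v \<in> borel_measurable borel" and Vv: "AE m in \<mm>. rep_l2 (V t) m = v (mono_repr (X t) m)"
      using Hspace_repr[OF X_in[OF t] V_in[OF t]] .
    have sq: "square_integrable \<mm> (v \<circ> mono_repr (X t))"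
      using measurable_compose[OF f v] Vv
      by (intro square_integrable_cong_AE[OF square_integrable_rep_l2[of "V t"]]) (auto simp: o_def eq_commute)
    have V_eq: "V t = abs_l2 (v \<circ> mono_repr (X t))"
      using Vv abs_l2_eq_iff[OF square_integrable_rep_l2[of "V t"] sq] by (simp add: abs_rep_l2)
    have "AE x in law (X t). w x = v x"
      if w: "square_integrable (law (X t)) w" "V t = abs_l2 (w \<circ> mono_repr (X t))" for w
    proof -
      have "AE m in \<mm>. (w \<circ> mono_repr (X t)) m = (v \<circ> mono_repr (X t)) m"
        using w V_eq abs_l2_eq_iff[OF _ sq, of "w \<circ> mono_repr (X t)"] comp[OF law_meas[OF w(1)]] by simp
      then show ?thesis
        unfolding law_def using law_meas[OF w(1)] v f by (subst AE_distr_iff) auto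
    qed
    then show "\<exists>v. square_integrable (law (X t)) v \<and> V t = abs_l2 (v \<circ> mono_repr (X t))
         \<and> (\<forall>w. square_integrable (law (X t)) w \<and> V t = abs_l2 (w \<circ> mono_repr (X t))
               \<longrightarrow> (AE x in law (X t). w x = v x))"
      using comp[OF v] sq V_eq by blast
  qed
qed

end
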